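(* The second-order differential operator \[D_0:=\partial_{\alpha_1}\partial_{\alpha_2}=\partial_{g_{1,1}}\left(\Delta_{2,2}\,\partial_{g_{1,1}}+\Delta_{1,1}\,\partial_{g_{2,2}}+\Delta_{2,1}\,\partial_{g_{1,2}}+\Delta_{1,2}\,\partial_{g_{2,1}}\right)\] is defined on the whole of $\overline{G}$. That is, the two expressions coincide (as differential operators on $G\cap(\overline{G})_0$), and the operator $\partial_{\alpha_1}\partial_{\alpha_2}\in\Gamma((\overline{G})_0,\mathscr{D}_{\overline{G}})$ is the restriction of an element of $\Gamma(\overline{G},\mathscr{D}_{\overline{G}})$.
   Context: Let $\mathbf{k}$ be an algebraically closed field of characteristic $0$ and $G=\mathrm{PGL}_3(\mathbf{k})$. For a $3\times3$ matrix $g=(g_{i,j})$ let $\mathrm{Com}(g)$ be its cofactor matrix, so $g\,{}^t\mathrm{Com}(g)=\det(g)I_3$. Let $\Delta_{i,j}(g)=(-1)^{i+j}\mathrm{Com}(g)_{i,j}$ be the minor of $g$ obtained by deleting row $i$ and column $j$. The wonderful compactification $\overline{G}$ is the closure of the image of the embedding $G\to\mathbb{P}(M_3(\mathbf{k}))\times\mathbb{P}(M_3(\mathbf{k}))$, $[g]\mapsto([g],[\mathrm{Com}(g)])$. It is a smooth projective variety containing $G$ as an open subset. The big cell is the open subset $(\overline{G})_0=\{([g],[g'])\in\overline{G}: g_{3,3}g'_{1,1}\neq0\}$. It is isomorphic to $\mathbb{A}^8$, with coordinates $\alpha_1,\alpha_2,U_{i,j}$ ($1\le i\ne j\le 3$)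 defined as follows. The point with coordinates $(\alpha_1,\alpha_2,(U_{i,j}))$ is \[\left([u\,\mathrm{diag}(\alpha_1\alpha_2,\alpha_2,1)\,u'],\ [\mathrm{Com}(u)\,\mathrm{diag}(1,\alpha_1,\alpha_1\alpha_2)\,\mathrm{Com}(u')]\right),\] where $u$ is the upper unitriangular matrix with entries $U_{1,2},U_{1,3},U_{2,3}$ above the diagonal and $u'$ is the lower unitriangular matrix with entries $U_{2,1},U_{3,1},U_{3,2}$ below the diagonal. Then $\mathbf{k}[(\overline{G})_0]=\mathbf{k}[\alpha_1,\alpha_2,U_{i,j}]$, and $\partial_{\alpha_1},\partial_{\alpha_2}$ are the partial derivatives with respect to these eight coordinates. One has $G\cap(\overline{G})_0=\{[g]\in G: g_{3,3}\ne0,\ \Delta_{1,1}(g)\neq 0\}$. Regular functions on open subsets of $G$ are identified with functions of the matrix entries $g_{i,j}$ that are homogeneous of degree $0$, and $\partial_{g_{i,j}}$ denotes the partial derivative with respect to $g_{i,j}$ in the nine matrix entries. Expressions in the $g_{i,j}$ and $\partial_{g_{i,j}}$ are operators on such degree-$0$ functions. In the formula for $D_0$, the leftmost $\partial_{g_{1,1}}$ is composed with the operator in parentheses. $\mathscr{D}_{\overline{G}}$ is the sheaf of ($\mathbf{k}$-linear, algebraic) differential operators on $\overline{G}$. *)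

theory Defs
  imports "HOL-Analysis.Analysis" "HOL-Computational_Algebra.Computational_Algebra"
begin

section \<open>Minors and the cofactor matrix\<close>

text \<open>The index type is the three-element numeral type, in which \<open>3 = 0\<close>; its order is therefore
  not the one of the row numbers 1, 2, 3 and is never used.\<close>

type_synonym 'k mat3 = "'k ^ 3 ^ 3"

definition skip :: "3 \<Rightarrow> 2 \<Rightarrow> 3" where
  "skip i p = (if p = 1 then (if i = 1 then 2 else 1) else (if i = 3 then 2 else 3))"

definition minor :: "3 \<Rightarrow> 3 \<Rightarrow> 'k::comm_ring_1 mat3 \<Rightarrow> 'k" where
  "minor i j g = det ((\<chi> p q. g $ skip i p $ skip j q) :: 'k ^ 2 ^ 2)"

text \<open>The sign is \<open>(-1)\<^sup>i\<^sup>+\<^sup>j\<close> for row and column numbers in 1, 2, 3.\<close>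

definition Com :: "'k::comm_ring_1 mat3 \<Rightarrow> 'k mat3" where
  "Com g = (\<chi> i j. (if (i = 2) = (j = 2) then 1 else - 1) * minor i j g)"

lemma mult_transpose_Com: "g ** transpose (Com g) = mat (det g)"
  by (simp add: vec_eq_iff forall_3 matrix_matrix_mult_def transpose_def Com_def minor_def mat_def
      skip_def sum_3 det_2 det_3 algebra_simps)

definition diag3 :: "'k::zero \<Rightarrow> 'k \<Rightarrow> 'k \<Rightarrow> 'k mat3" where
  "diag3 a b c = vector [vector [a, 0, 0], vector [0, b, 0], vector [0, 0, c]]"


section \<open>The product of projective spaces and its Zariski topology\<close>

text \<open>A point of the projective space of matrices is represented by the set of all its homogeneous
  coordinate matrices.\<close>

definition proj_class :: "'k::field mat3 \<Rightarrow> 'k mat3 set" where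
  "proj_class g = {map_matrix ((*) c) g | c. c \<noteq> 0}"

type_synonym 'k proj2 = "'k mat3 set \<times> 'k mat3 set"

definition proj2_space :: "'k::field proj2 set" where
  "proj2_space = {(proj_class g, proj_class g') | g g'. g \<noteq> 0 \<and> g' \<noteq> 0}"

text \<open>Polynomials in the entries of two matrices, as functions. The base field will always be infinite,
  so these are the same as formal polynomials.\<close>

inductive poly_fun :: "('k::field mat3 \<Rightarrow> 'k mat3 \<Rightarrow> 'k) \<Rightarrow> bool" where
  "poly_fun (\<lambda>g g'. c)"
| "poly_fun (\<lambda>g g'. g $ i $ j)"
| "poly_fun (\<lambda>g g'. g' $ i $ j)"
| "poly_fun P \<Longrightarrow> poly_fun Q \<Longrightarrow> poly_fun (\<lambda>g g'. P g g' + Q g g')"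
| "poly_fun P \<Longrightarrow> poly_fun Q \<Longrightarrow> poly_fun (\<lambda>g g'. P g g' * Q g g')"

definition bihom :: "nat \<Rightarrow> nat \<Rightarrow> ('k::field mat3 \<Rightarrow> 'k mat3 \<Rightarrow> 'k) \<Rightarrow> bool" where
  "bihom d e P \<longleftrightarrow> poly_fun P \<and>
     (\<forall>s t g g'. P (map_matrix ((*) s) g) (map_matrix ((*) t) g') = s ^ d * t ^ e * P g g')"

definition nonvanishing :: "('k::field mat3 \<Rightarrow> 'k mat3 \<Rightarrow> 'k) \<Rightarrow> 'k proj2 set" where
  "nonvanishing P = {(p, p') \<in> proj2_space. \<forall>g\<in>p. \<forall>g'\<in>p'. P g g' \<noteq> 0}"

definition zariski :: "'k::field proj2 topology" where
  "zariski = topology_generated_by {nonvanishing P | P d e. bihom d e P}"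


section \<open>The wonderful compactification\<close>

definition emb :: "'k::field mat3 \<Rightarrow> 'k proj2" where
  "emb g = (proj_class g, proj_class (Com g))"

text \<open>The image of \<open>PGL\<^sub>3\<close>.\<close>

definition group_points :: "'k::field proj2 set" where
  "group_points = emb ` {g. det g \<noteq> 0}"

definition wonderful :: "'k::field proj2 set" where
  "wonderful = zariski closure_of group_points"

definition zopen :: "'k::field proj2 set \<Rightarrow> bool" where
  "zopen V \<longleftrightarrow> openin (subtopology zariski wonderful) V"

text \<open>Regular functions on an open subset \<open>V\<close>, extended by zero outside \<open>V\<close>; with this convention
  the ring operations are pointwise.\<close>

definition regular :: "'k::field proj2 set \<Rightarrow> ('k proj2 \<Rightarrow> 'k) set" where
  "regular V = {f. (\<forall>x. x \<notin> V \<longrightarrow> f x = 0) \<and>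
     (\<forall>x\<in>V. \<exists>W P Q d e. zopen W \<and> x \<in> W \<and> W \<subseteq> V \<and> bihom d e P \<and> bihom d e Q \<and>
        (\<forall>(p, p')\<in>W. \<forall>g\<in>p. \<forall>g'\<in>p'. Q g g' \<noteq> 0 \<and> f (p, p') = P g g' / Q g g'))}"

definition restr :: "'k::field proj2 set \<Rightarrow> ('k proj2 \<Rightarrow> 'k) \<Rightarrow> 'k proj2 \<Rightarrow> 'k" where
  "restr V f = (\<lambda>x. if x \<in> V then f x else 0)"


section \<open>Differential operators\<close>

text \<open>Grothendieck's definition: an operator on a commutative ring of functions \<open>R\<close> has order at most
  \<open>n\<close> if its commutators with any \<open>n + 1\<close> multiplication operators vanish.\<close>

definition commutator ::
    "('p \<Rightarrow> 'k::field) \<Rightarrow> (('p \<Rightarrow> 'k) \<Rightarrow> 'p \<Rightarrow> 'k) \<Rightarrow> ('p \<Rightarrow> 'k) \<Rightarrow> 'p \<Rightarrow> 'k" where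
  "commutator a T = (\<lambda>f x. T (\<lambda>y. a y * f y) x - a x * T f x)"

primrec order_le ::
    "nat \<Rightarrow> ('p \<Rightarrow> 'k::field) set \<Rightarrow> (('p \<Rightarrow> 'k) \<Rightarrow> 'p \<Rightarrow> 'k) \<Rightarrow> bool" where
  "order_le 0 R T \<longleftrightarrow> (\<forall>a\<in>R. \<forall>f\<in>R. commutator a T f = (\<lambda>x. 0))"
| "order_le (Suc n) R T \<longleftrightarrow> (\<forall>a\<in>R. order_le n R (commutator a T))"

definition linear_op ::
    "('p \<Rightarrow> 'k::field) set \<Rightarrow> (('p \<Rightarrow> 'k) \<Rightarrow> 'p \<Rightarrow> 'k) \<Rightarrow> bool" where
  "linear_op R T \<longleftrightarrow> (\<forall>f\<in>R. T f \<in> R) \<and>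
     (\<forall>f\<in>R. \<forall>h\<in>R. T (\<lambda>x. f x + h x) = (\<lambda>x. T f x + T h x)) \<and>
     (\<forall>c. \<forall>f\<in>R. T (\<lambda>x. c * f x) = (\<lambda>x. c * T f x))"

type_synonym 'k sheaf_op = "'k proj2 set \<Rightarrow> ('k proj2 \<Rightarrow> 'k) \<Rightarrow> 'k proj2 \<Rightarrow> 'k"

text \<open>Sections over the open set \<open>U\<close> of the sheaf of differential operators: linear endomorphisms of
  the structure sheaf of \<open>U\<close> of finite order. Since \<open>U\<close> is quasi-compact, locally finite order is the
  same as a uniform bound. The values of \<open>D\<close> on arguments other than regular functions on open
  subsets of \<open>U\<close> are irrelevant.\<close>

definition diff_ops :: "'k::field proj2 set \<Rightarrow> 'k sheaf_op set" where
  "diff_ops U = {D.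
     (\<forall>V. zopen V \<and> V \<subseteq> U \<longrightarrow> linear_op (regular V) (D V)) \<and>
     (\<forall>V W. zopen V \<and> zopen W \<and> W \<subseteq> V \<and> V \<subseteq> U \<longrightarrow>
        (\<forall>f\<in>regular V. D W (restr W f) = restr W (D V f))) \<and>
     (\<exists>n. \<forall>V. zopen V \<and> V \<subseteq> U \<longrightarrow> order_le n (regular V) (D V))}"


section \<open>Partial derivatives\<close>

text \<open>The algebraic derivative at \<open>a\<close> of a function of one variable that agrees with a rational
  function \<open>p / q\<close> wherever \<open>q\<close> does not vanish, where \<open>q a \<noteq> 0\<close>.\<close>

definition rat_deriv :: "('k::field \<Rightarrow> 'k) \<Rightarrow> 'k \<Rightarrow> 'k" where
  "rat_deriv h a = (THE d. \<exists>p q. poly q a \<noteq> 0 \<and>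
      (\<forall>t. poly q t \<noteq> 0 \<longrightarrow> h t = poly p t / poly q t) \<and>
      d = (poly (pderiv p) a * poly q a - poly p a * poly (pderiv q) a) / (poly q a)\<^sup>2)"

definition set_entry :: "3 \<Rightarrow> 3 \<Rightarrow> 'k mat3 \<Rightarrow> 'k \<Rightarrow> 'k mat3" where
  "set_entry i j g t = (\<chi> k l. if k = i \<and> l = j then t else g $ k $ l)"

definition d_entry :: "3 \<Rightarrow> 3 \<Rightarrow> ('k::field mat3 \<Rightarrow> 'k) \<Rightarrow> 'k mat3 \<Rightarrow> 'k" where
  "d_entry i j F g = rat_deriv (\<lambda>t. F (set_entry i j g t)) (g $ i $ j)"

definition D0_entries :: "('k::field mat3 \<Rightarrow> 'k) \<Rightarrow> 'k mat3 \<Rightarrow> 'k" where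
  "D0_entries F = d_entry 1 1 (\<lambda>g.
       minor 2 2 g * d_entry 1 1 F g + minor 1 1 g * d_entry 2 2 F g
     + minor 2 1 g * d_entry 1 2 F g + minor 1 2 g * d_entry 2 1 F g)"


section \<open>The big cell and its coordinates\<close>

definition big_cell :: "'k::field proj2 set" where
  "big_cell = {(p, p') \<in> wonderful. \<forall>g\<in>p. \<forall>g'\<in>p'. g $ 3 $ 3 * g' $ 1 $ 1 \<noteq> 0}"

text \<open>Affine 8-space: triples \<open>(\<alpha>\<^sub>1, \<alpha>\<^sub>2, U)\<close>, where only the six off-diagonal entries of \<open>U\<close> are
  coordinates and the diagonal is set to zero.\<close>

type_synonym 'k coords8 = "'k \<times> 'k \<times> 'k mat3"

definition affine8 :: "'k::field coords8 set" where
  "affine8 = {(a1, a2, U). \<forall>i. U $ i $ i = 0}"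

definition upper_uni :: "'k::field mat3 \<Rightarrow> 'k mat3" where
  "upper_uni U = vector [vector [1, U $ 1 $ 2, U $ 1 $ 3], vector [0, 1, U $ 2 $ 3], vector [0, 0, 1]]"

definition lower_uni :: "'k::field mat3 \<Rightarrow> 'k mat3" where
  "lower_uni U = vector [vector [1, 0, 0], vector [U $ 2 $ 1, 1, 0], vector [U $ 3 $ 1, U $ 3 $ 2, 1]]"

definition cell_point :: "'k::field coords8 \<Rightarrow> 'k proj2" where
  "cell_point = (\<lambda>(a1, a2, U).
     (proj_class (upper_uni U ** diag3 (a1 * a2) a2 1 ** lower_uni U),
      proj_class (Com (upper_uni U) ** diag3 1 a1 (a1 * a2) ** Com (lower_uni U))))"

definition cell_coords :: "'k::field proj2 \<Rightarrow> 'k coords8" where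
  "cell_coords = inv_into affine8 cell_point"

definition d_alpha1 :: "'k::field sheaf_op" where
  "d_alpha1 V f = restr V (\<lambda>x. case cell_coords x of (a1, a2, U) \<Rightarrow>
     rat_deriv (\<lambda>t. f (cell_point (t, a2, U))) a1)"

definition d_alpha2 :: "'k::field sheaf_op" where
  "d_alpha2 V f = restr V (\<lambda>x. case cell_coords x of (a1, a2, U) \<Rightarrow>
     rat_deriv (\<lambda>t. f (cell_point (a1, t, U))) a2)"

definition D0 :: "'k::field sheaf_op" where
  "D0 V f = d_alpha1 V (d_alpha2 V f)"

end

theory Submission
  imports Defs
begin

text \<open>
  The operator \<open>\<partial>\<^sub>\<alpha>\<^sub>1 \<partial>\<^sub>\<alpha>\<^sub>2\<close> is regular on the big cell because it is a product of two derivations of its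
  coordinate ring. The formula in the matrix entries has polynomial coefficients, so it is regular on
  the open set of the points \<open>([g], [g'])\<close> with \<open>Com g \<noteq> 0\<close>. The complement of the union of these two
  open sets has codimension at least 2, and the operator extends across it by Hartogs' principle.

  The agreement of the two formulas is the chain rule (\<open>D0_fraction\<close>). Write a point of the cell as the
  class of \<open>M = u diag(\<alpha>\<^sub>1\<alpha>\<^sub>2, \<alpha>\<^sub>2, 1) u'\<close>. Then \<open>\<partial>M/\<partial>\<alpha>\<^sub>1 = \<alpha>\<^sub>2 E\<^sub>1\<^sub>1\<close>, and \<open>\<alpha>\<^sub>2 \<partial>M/\<partial>\<alpha>\<^sub>2\<close> is the Schur complement
  of the entry 1 in the corner of \<open>M\<close>: it lives in the upper left block, and its four entries are the
  minors in the formula. The two factors \<open>\<alpha>\<^sub>2\<close> cancel. The same computation gives the value of the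
  operator on a fraction \<open>P / Q\<close> at \<open>[g]\<close>, as a polynomial in the entries of \<open>g\<close> divided by
  \<open>Q(g, Com g)\<^sup>4\<close>.

  For the extension, regular functions on the closure are determined by their values on the big cell,
  by irreducibility (\<open>regular_unique\<close>). Hence it is enough to find, near every point, a fraction that
  agrees with the operator on the cell (\<open>D0_extends_locally\<close>): such fractions glue, and linearity,
  compatibility with restriction and the bound on the order are inherited from the cell. Every point
  lies in a translate of the cell by a pair of invertible matrices (\<open>exists_chart\<close>), again an affine
  8-space. There \<open>Com N = \<alpha>\<^sub>2 N'\<close> for the two representing matrices, so the formula in the entries has
  only a power of \<open>\<alpha>\<^sub>2\<close> as an additional denominator. A generic point of the hyperplane \<open>\<alpha>\<^sub>2 = 0\<close> of the
  translate lies in the big cell, where the operator is regular; so that power of \<open>\<alpha>\<^sub>2\<close> divides the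
  numerator (\<open>hartogs_alpha2\<close>).
\<close>

no_notation fps_nth (infixl "$" 75)

section \<open>Algebras of polynomial functions\<close>

text \<open>The algebra generated by a set of coordinate functions. Over an infinite field its elements may be
  handled as polynomials.\<close>

inductive_set poly_alg :: "('x \<Rightarrow> 'k::field) set \<Rightarrow> ('x \<Rightarrow> 'k) set" for G where
  gen: "c \<in> G \<Longrightarrow> c \<in> poly_alg G"
| const: "(\<lambda>x. c) \<in> poly_alg G"
| add: "p \<in> poly_alg G \<Longrightarrow> q \<in> poly_alg G \<Longrightarrow> (\<lambda>x. p x + q x) \<in> poly_alg G"
| mult: "p \<in> poly_alg G \<Longrightarrow> q \<in> poly_alg G \<Longrightarrow> (\<lambda>x. p x * q x) \<in> poly_alg G"

lemma poly_alg_uminus: "p \<in> poly_alg G \<Longrightarrow> (\<lambda>x. - p x) \<in> poly_alg G"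
  using poly_alg.mult[OF poly_alg.const[of "- 1"]] by fastforce

lemma poly_alg_diff:
  "p \<in> poly_alg G \<Longrightarrow> q \<in> poly_alg G \<Longrightarrow> (\<lambda>x. p x - q x) \<in> poly_alg G"
  using poly_alg.add[OF _ poly_alg_uminus] by fastforce

lemma poly_alg_power: "p \<in> poly_alg G \<Longrightarrow> (\<lambda>x. p x ^ n) \<in> poly_alg G"
  by (induction n) (auto intro: poly_alg.intros)

lemma poly_alg_sum:
  "(\<And>i. i \<in> I \<Longrightarrow> p i \<in> poly_alg G) \<Longrightarrow> (\<lambda>x. \<Sum>i\<in>I. p i x) \<in> poly_alg G"
  by (induction I rule: infinite_finite_induct) (auto intro: poly_alg.intros)

lemmas poly_alg_intros = poly_alg.const poly_alg.add poly_alg.mult poly_alg_uminus poly_alg_diff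
  poly_alg_power poly_alg_sum

lemma poly_alg_comp:
  assumes "p \<in> poly_alg G" "\<And>c. c \<in> G \<Longrightarrow> (\<lambda>y. c (\<phi> y)) \<in> poly_alg H"
  shows "(\<lambda>y. p (\<phi> y)) \<in> poly_alg H"
  using assms(1) by induction (auto intro: poly_alg.intros assms(2))

lemma poly_alg_curve:
  assumes "p \<in> poly_alg G" "\<And>c. c \<in> G \<Longrightarrow> \<exists>u. \<forall>t. c (\<gamma> t) = poly u t"
  shows "\<exists>u. \<forall>t. p (\<gamma> t) = poly u t"
  using assms(1)
proof induction
  case (gen c) then show ?case using assms(2) by blast
next
  case (const c) then show ?case by (intro exI[of _ "[:c:]"]) auto
next
  case (add p q) then show ?case by (metis poly_add)
next
  case (mult p q) then show ?case by (metis poly_mult)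
qed

text \<open>The source of all density statements below: along a curve that joins a nonzero of \<open>p\<close> to a
  nonzero of \<open>q\<close>, both are nonzero polynomials in the parameter, and together they have finitely
  many zeros.\<close>

lemma common_nonzero:
  fixes p q :: "'x \<Rightarrow> 'k::field_char_0"
  assumes "p \<in> poly_alg G" "q \<in> poly_alg G"
    and "\<And>c. c \<in> G \<Longrightarrow> \<exists>u. \<forall>t. c (\<gamma> t) = poly u t"
    and "p (\<gamma> 0) \<noteq> 0" "q (\<gamma> 1) \<noteq> 0"
  shows "\<exists>t. p (\<gamma> t) \<noteq> 0 \<and> q (\<gamma> t) \<noteq> 0"
proof -
  obtain u where u: "\<And>t. p (\<gamma> t) = poly u t" using poly_alg_curve[OF assms(1), of \<gamma>] assms(3) by blast
  obtain v where v: "\<And>t. q (\<gamma> t) = poly v t" using poly_alg_curve[OF assms(2), of \<gamma>] assms(3) by blast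
  have "u * v \<noteq> 0" using assms(4,5) u v by auto
  then have "finite {t. poly (u * v) t = 0}" by (rule poly_roots_finite)
  then obtain t where "poly (u * v) t \<noteq> 0"
    using ex_new_if_finite[OF infinite_UNIV_char_0] by blast
  then show ?thesis using u v by auto
qed


section \<open>Derivatives of rational functions of one variable\<close>

text \<open>The relation behind \<open>rat_deriv\<close>. Unlike the definite description, it comes with the usual
  rules of calculus.\<close>

definition has_rat_deriv :: "('k::field \<Rightarrow> 'k) \<Rightarrow> 'k \<Rightarrow> 'k \<Rightarrow> bool" where
  "has_rat_deriv h a d \<longleftrightarrow> (\<exists>p q. poly q a \<noteq> 0 \<and>
      (\<forall>t. poly q t \<noteq> 0 \<longrightarrow> h t = poly p t / poly q t) \<and>
      d = (poly (pderiv p) a * poly q a - poly p a * poly (pderiv q) a) / (poly q a)\<^sup>2)"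

lemma has_rat_derivI:
  assumes "poly q a \<noteq> 0" "\<And>t. poly q t \<noteq> 0 \<Longrightarrow> h t = poly p t / poly q t"
    "d = (poly (pderiv p) a * poly q a - poly p a * poly (pderiv q) a) / (poly q a)\<^sup>2"
  shows "has_rat_deriv h a d"
  unfolding has_rat_deriv_def using assms by blast

text \<open>Two fractions that represent the function off finitely many points are equal as fractions, hence
  have the same derivative.\<close>

lemma has_rat_deriv_unique:
  fixes h :: "'k::field_char_0 \<Rightarrow> 'k"
  assumes "has_rat_deriv h a d" "has_rat_deriv h a e"
  shows "d = e"
proof -
  obtain p q where pq: "poly q a \<noteq> 0" "\<And>t. poly q t \<noteq> 0 \<Longrightarrow> h t = poly p t / poly q t"
    "d = (poly (pderiv p) a * poly q a - poly p a * poly (pderiv q) a) / (poly q a)\<^sup>2"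
    using assms(1) unfolding has_rat_deriv_def by blast
  obtain u v where uv: "poly v a \<noteq> 0" "\<And>t. poly v t \<noteq> 0 \<Longrightarrow> h t = poly u t / poly v t"
    "e = (poly (pderiv u) a * poly v a - poly u a * poly (pderiv v) a) / (poly v a)\<^sup>2"
    using assms(2) unfolding has_rat_deriv_def by blast
  have "poly (q * v * (p * v - u * q)) t = 0" for t
  proof (cases "poly q t = 0 \<or> poly v t = 0")
    case False
    then have "poly p t / poly q t = poly u t / poly v t" using pq(2) uv(2) by metis
    then show ?thesis using False by (simp add: field_simps)
  qed auto
  then have "q * v * (p * v - u * q) = 0" by (metis poly_all_0_iff_0)
  moreover have "q * v \<noteq> 0" using pq(1) uv(1) by auto
  ultimately have eq: "p * v = u * q" by simp
  then have e0: "poly p a * poly v a = poly u a * poly q a" by (metis poly_mult)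
  have "pderiv (p * v) = pderiv (u * q)" using eq by simp
  then have "poly (pderiv (p * v)) a = poly (pderiv (u * q)) a" by simp
  then have e1: "poly (pderiv p) a * poly v a + poly p a * poly (pderiv v) a
      = poly (pderiv u) a * poly q a + poly u a * poly (pderiv q) a"
    by (simp add: pderiv_mult algebra_simps)
  define Q V P U P' U' Q' V' where "Q = poly q a" "V = poly v a" "P = poly p a" "U = poly u a"
    "P' = poly (pderiv p) a" "U' = poly (pderiv u) a" "Q' = poly (pderiv q) a" "V' = poly (pderiv v) a"
  note ds = this
  have nz: "Q \<noteq> 0" "V \<noteq> 0" using pq(1) uv(1) ds by auto
  have a0: "P = U * Q / V" using e0 ds nz by (simp add: field_simps)
  have a1: "P' = (U' * Q + U * Q' - P * V') / V" using e1 ds nz by (simp add: field_simps)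
  have "(P' * Q - P * Q') / Q\<^sup>2 = (U' * V - U * V') / V\<^sup>2"
    unfolding a1 unfolding a0 using nz by (simp add: field_simps power2_eq_square)
  then show ?thesis using pq(3) uv(3) ds by simp
qed

lemma rat_deriv_eq:
  fixes h :: "'k::field_char_0 \<Rightarrow> 'k"
  assumes "has_rat_deriv h a d"
  shows "rat_deriv h a = d"
proof -
  have "rat_deriv h a = (THE d. has_rat_deriv h a d)"
    by (simp add: rat_deriv_def has_rat_deriv_def)
  also have "\<dots> = d" using assms has_rat_deriv_unique by blast
  finally show ?thesis .
qed

lemma has_rat_deriv_const: "has_rat_deriv (\<lambda>t. c) a 0"
  by (rule has_rat_derivI[where p = "[:c:]" and q = 1]) (auto simp: pderiv_pCons)

lemma has_rat_deriv_affine: "has_rat_deriv (\<lambda>t. c + b * t) a b"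
  by (rule has_rat_derivI[where p = "[:c, b:]" and q = 1]) (auto simp: pderiv_pCons mult.commute)

lemma has_rat_deriv_id: "has_rat_deriv (\<lambda>t. t) a 1"
  using has_rat_deriv_affine[of 0 1] by simp

text \<open>Functions extended by zero are rational only on an open part of a line, the locus \<open>b \<noteq> 0\<close>.\<close>

lemma has_rat_deriv_local:
  assumes "has_rat_deriv h a d" "poly b a \<noteq> 0" "\<And>t. poly b t \<noteq> 0 \<Longrightarrow> h' t = h t"
  shows "has_rat_deriv h' a d"
proof -
  obtain p q where pq: "poly q a \<noteq> 0" "\<And>t. poly q t \<noteq> 0 \<Longrightarrow> h t = poly p t / poly q t"
    "d = (poly (pderiv p) a * poly q a - poly p a * poly (pderiv q) a) / (poly q a)\<^sup>2"
    using assms(1) unfolding has_rat_deriv_def by blast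
  show ?thesis
  proof (rule has_rat_derivI[where p = "p * b" and q = "q * b"])
    show "poly (q * b) a \<noteq> 0" using pq assms by simp
    show "h' t = poly (p * b) t / poly (q * b) t" if "poly (q * b) t \<noteq> 0" for t
      using that pq assms by simp
    show "d = (poly (pderiv (p * b)) a * poly (q * b) a - poly (p * b) a * poly (pderiv (q * b)) a)
        / (poly (q * b) a)\<^sup>2"
      unfolding pq(3) using pq(1) assms(2)
      by (simp add: pderiv_mult divide_simps) (simp add: algebra_simps power2_eq_square)
  qed
qed

lemma has_rat_deriv_add:
  assumes "has_rat_deriv h a d" "has_rat_deriv k a e"
  shows "has_rat_deriv (\<lambda>t. h t + k t) a (d + e)"
proof -
  obtain p q where pq: "poly q a \<noteq> 0" "\<And>t. poly q t \<noteq> 0 \<Longrightarrow> h t = poly p t / poly q t"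
    "d = (poly (pderiv p) a * poly q a - poly p a * poly (pderiv q) a) / (poly q a)\<^sup>2"
    using assms(1) unfolding has_rat_deriv_def by blast
  obtain u v where uv: "poly v a \<noteq> 0" "\<And>t. poly v t \<noteq> 0 \<Longrightarrow> k t = poly u t / poly v t"
    "e = (poly (pderiv u) a * poly v a - poly u a * poly (pderiv v) a) / (poly v a)\<^sup>2"
    using assms(2) unfolding has_rat_deriv_def by blast
  show ?thesis
  proof (rule has_rat_derivI[where p = "p * v + u * q" and q = "q * v"])
    show "poly (q * v) a \<noteq> 0" using pq uv by simp
    show "h t + k t = poly (p * v + u * q) t / poly (q * v) t" if "poly (q * v) t \<noteq> 0" for t
      using that pq(2) uv(2) by (simp add: field_simps)
    show "d + e = (poly (pderiv (p * v + u * q)) a * poly (q * v) a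
        - poly (p * v + u * q) a * poly (pderiv (q * v)) a) / (poly (q * v) a)\<^sup>2"
      unfolding pq(3) uv(3) using pq(1) uv(1)
      by (simp add: pderiv_mult pderiv_add divide_simps) (simp add: algebra_simps power2_eq_square)
  qed
qed

lemma has_rat_deriv_mult:
  assumes "has_rat_deriv h a d" "has_rat_deriv k a e"
  shows "has_rat_deriv (\<lambda>t. h t * k t) a (d * k a + h a * e)"
proof -
  obtain p q where pq: "poly q a \<noteq> 0" "\<And>t. poly q t \<noteq> 0 \<Longrightarrow> h t = poly p t / poly q t"
    "d = (poly (pderiv p) a * poly q a - poly p a * poly (pderiv q) a) / (poly q a)\<^sup>2"
    using assms(1) unfolding has_rat_deriv_def by blast
  obtain u v where uv: "poly v a \<noteq> 0" "\<And>t. poly v t \<noteq> 0 \<Longrightarrow> k t = poly u t / poly v t"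
    "e = (poly (pderiv u) a * poly v a - poly u a * poly (pderiv v) a) / (poly v a)\<^sup>2"
    using assms(2) unfolding has_rat_deriv_def by blast
  have ha: "h a = poly p a / poly q a" "k a = poly u a / poly v a" using pq uv by auto
  show ?thesis
  proof (rule has_rat_derivI[where p = "p * u" and q = "q * v"])
    show "poly (q * v) a \<noteq> 0" using pq uv by simp
    show "h t * k t = poly (p * u) t / poly (q * v) t" if "poly (q * v) t \<noteq> 0" for t
      using that pq(2) uv(2) by (simp add: field_simps)
    show "d * k a + h a * e = (poly (pderiv (p * u)) a * poly (q * v) a
        - poly (p * u) a * poly (pderiv (q * v)) a) / (poly (q * v) a)\<^sup>2"
      unfolding pq(3) uv(3) ha using pq(1) uv(1)
      by (simp add: pderiv_mult divide_simps) (simp add: algebra_simps power2_eq_square)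
  qed
qed

lemma has_rat_deriv_inverse:
  assumes "has_rat_deriv h a d" "h a \<noteq> 0"
  shows "has_rat_deriv (\<lambda>t. 1 / h t) a (- d / (h a)\<^sup>2)"
proof -
  obtain p q where pq: "poly q a \<noteq> 0" "\<And>t. poly q t \<noteq> 0 \<Longrightarrow> h t = poly p t / poly q t"
    "d = (poly (pderiv p) a * poly q a - poly p a * poly (pderiv q) a) / (poly q a)\<^sup>2"
    using assms(1) unfolding has_rat_deriv_def by blast
  have ha: "h a = poly p a / poly q a" using pq by auto
  then have pa: "poly p a \<noteq> 0" using assms(2) by auto
  show ?thesis
  proof (rule has_rat_derivI[where p = "q * q" and q = "p * q"])
    show "poly (p * q) a \<noteq> 0" using pq pa by simp
    show "1 / h t = poly (q * q) t / poly (p * q) t" if "poly (p * q) t \<noteq> 0" for t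
      using that pq(2) by simp
    show "- d / (h a)\<^sup>2 = (poly (pderiv (q * q)) a * poly (p * q) a
        - poly (q * q) a * poly (pderiv (p * q)) a) / (poly (p * q) a)\<^sup>2"
      unfolding pq(3) ha using pq(1) pa
      by (simp add: pderiv_mult divide_simps) (simp add: algebra_simps power2_eq_square)
  qed
qed

lemma has_rat_deriv_divide:
  assumes "has_rat_deriv h a d" "has_rat_deriv k a e" "k a \<noteq> 0"
  shows "has_rat_deriv (\<lambda>t. h t / k t) a ((d * k a - h a * e) / (k a)\<^sup>2)"
proof -
  have "has_rat_deriv (\<lambda>t. h t * (1 / k t)) a (d * (1 / k a) + h a * (- e / (k a)\<^sup>2))"
    by (intro has_rat_deriv_mult has_rat_deriv_inverse assms)
  moreover have "d * (1 / k a) + h a * (- e / (k a)\<^sup>2) = (d * k a - h a * e) / (k a)\<^sup>2"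
    using assms(3) by (simp add: field_simps power2_eq_square)
  ultimately show ?thesis by simp
qed


section \<open>The polynomial rings of matrices and of affine 8-space\<close>

definition entries :: "('k::field mat3 \<Rightarrow> 'k) set" where
  "entries = {\<lambda>g. g $ i $ j | i j. True}"

definition coords :: "('k::field coords8 \<Rightarrow> 'k) set" where
  "coords = {\<lambda>v. fst v, \<lambda>v. fst (snd v)} \<union> {\<lambda>v. (snd (snd v) :: 'k mat3) $ i $ j | i j. True}"

lemma entry_in: "(\<lambda>g. g $ i $ j) \<in> poly_alg entries"
  by (rule poly_alg.gen) (auto simp: entries_def)

lemma coords_in:
  "(\<lambda>v. fst v) \<in> poly_alg coords" "(\<lambda>v. fst (snd v)) \<in> poly_alg coords"
  "(\<lambda>v. (snd (snd v) :: 'k::field mat3) $ i $ j) \<in> poly_alg coords"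
  by (rule poly_alg.gen; auto simp: coords_def)+

lemma coords_cases [consumes 1, case_names alpha1 alpha2 U]:
  fixes c :: "'k::field coords8 \<Rightarrow> 'k"
  assumes "c \<in> coords"
  obtains "c = (\<lambda>v. fst v)" | "c = (\<lambda>v. fst (snd v))"
  | i j where "c = (\<lambda>v. (snd (snd v) :: 'k mat3) $ i $ j)"
  using assms by (auto simp: coords_def)

text \<open>The partial derivatives of a polynomial in the entries, characterised by the chain rule along
  arbitrary rational curves. This covers the lines that change one entry as well as the coordinate
  lines of the big cell.\<close>

definition is_gradient :: "('k::field mat3 \<Rightarrow> 'k) \<Rightarrow> (3 \<Rightarrow> 3 \<Rightarrow> 'k mat3 \<Rightarrow> 'k) \<Rightarrow> bool" where
  "is_gradient F Fd \<longleftrightarrow> (\<forall>\<gamma> a D. (\<forall>i j. has_rat_deriv (\<lambda>t. \<gamma> t $ i $ j) a (D i j)) \<longrightarrow>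
     has_rat_deriv (\<lambda>t. F (\<gamma> t)) a (\<Sum>i\<in>UNIV. \<Sum>j\<in>UNIV. Fd i j (\<gamma> a) * D i j))"

lemma is_gradientD:
  assumes "is_gradient F Fd" "\<And>i j. has_rat_deriv (\<lambda>t. \<gamma> t $ i $ j) a (D i j)"
  shows "has_rat_deriv (\<lambda>t. F (\<gamma> t)) a (\<Sum>i\<in>UNIV. \<Sum>j\<in>UNIV. Fd i j (\<gamma> a) * D i j)"
  using assms unfolding is_gradient_def by blast

lemma gradient:
  fixes F :: "'k::field mat3 \<Rightarrow> 'k"
  assumes "F \<in> poly_alg entries"
  shows "\<exists>Fd. (\<forall>i j. Fd i j \<in> poly_alg entries) \<and> is_gradient F Fd"
  using assms
proof induction
  case (gen c)
  then obtain k l where c: "c = (\<lambda>g. (g :: 'k mat3) $ k $ l)" by (auto simp: entries_def)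
  have *: "(\<Sum>i\<in>UNIV. \<Sum>j\<in>UNIV. (if i = k \<and> j = l then 1 else 0) * D i j) = (D k l :: 'k)" for D
  proof -
    have "(\<Sum>j\<in>UNIV. (if i = k \<and> j = l then 1 else 0) * D i j) = (if i = k then D i l else 0)" for i
      by (cases "i = k") (simp_all add: sum.delta' if_distrib[of "\<lambda>x. x * _"] cong: if_cong)
    then show ?thesis by (simp add: sum.delta')
  qed
  have "is_gradient c (\<lambda>i j g. if i = k \<and> j = l then 1 else 0)"
    unfolding c is_gradient_def * by blast
  then show ?case
    by (intro exI[of _ "\<lambda>i j g. if i = k \<and> j = l then 1 else 0"]) (auto intro: poly_alg.const)
next
  case (const c)
  have "is_gradient (\<lambda>g. c :: 'k) (\<lambda>i j g. 0)"
    by (auto simp: is_gradient_def intro: has_rat_deriv_const)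
  then show ?case by (intro exI[of _ "\<lambda>i j g. 0"]) (auto intro: poly_alg.const)
next
  case (add F G)
  then obtain Fd Gd where F: "\<And>i j. Fd i j \<in> poly_alg entries" "is_gradient F Fd"
    and G: "\<And>i j. Gd i j \<in> poly_alg entries" "is_gradient G Gd"
    by blast
  have "is_gradient (\<lambda>g. F g + G g) (\<lambda>i j g. Fd i j g + Gd i j g)"
    unfolding is_gradient_def
  proof (intro allI impI)
    fix \<gamma> :: "'k \<Rightarrow> 'k mat3" and a D
    assume D: "\<forall>i j. has_rat_deriv (\<lambda>t. \<gamma> t $ i $ j) a (D i j)"
    show "has_rat_deriv (\<lambda>t. F (\<gamma> t) + G (\<gamma> t)) a
        (\<Sum>i\<in>UNIV. \<Sum>j\<in>UNIV. (Fd i j (\<gamma> a) + Gd i j (\<gamma> a)) * D i j)"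
      using has_rat_deriv_add[OF is_gradientD[OF F(2)] is_gradientD[OF G(2)], of \<gamma> a D \<gamma> D] D
      by (simp add: sum.distrib algebra_simps)
  qed
  then show ?case
    by (intro exI[of _ "\<lambda>i j g. Fd i j g + Gd i j g"]) (auto intro!: poly_alg_intros F G)
next
  case (mult F G)
  then obtain Fd Gd where F: "\<And>i j. Fd i j \<in> poly_alg entries" "is_gradient F Fd"
    and G: "\<And>i j. Gd i j \<in> poly_alg entries" "is_gradient G Gd"
    by blast
  have "is_gradient (\<lambda>g. F g * G g) (\<lambda>i j g. Fd i j g * G g + F g * Gd i j g)"
    unfolding is_gradient_def
  proof (intro allI impI)
    fix \<gamma> :: "'k \<Rightarrow> 'k mat3" and a D
    assume D: "\<forall>i j. has_rat_deriv (\<lambda>t. \<gamma> t $ i $ j) a (D i j)"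
    show "has_rat_deriv (\<lambda>t. F (\<gamma> t) * G (\<gamma> t)) a
        (\<Sum>i\<in>UNIV. \<Sum>j\<in>UNIV. (Fd i j (\<gamma> a) * G (\<gamma> a) + F (\<gamma> a) * Gd i j (\<gamma> a)) * D i j)"
      using has_rat_deriv_mult[OF is_gradientD[OF F(2)] is_gradientD[OF G(2)], of \<gamma> a D \<gamma> D] D
      by (simp add: sum.distrib sum_distrib_left sum_distrib_right algebra_simps)
  qed
  then show ?case
    by (intro exI[of _ "\<lambda>i j g. Fd i j g * G g + F g * Gd i j g"])
      (auto intro!: poly_alg_intros F G mult.hyps)
qed

lemma partial_coords:
  assumes "r \<in> poly_alg coords"
  shows "\<exists>r1\<in>poly_alg coords. \<exists>r2\<in>poly_alg coords. \<forall>a1 a2 U.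
    has_rat_deriv (\<lambda>t. r (t, a2, U)) a1 (r1 (a1, a2, U)) \<and>
    has_rat_deriv (\<lambda>t. r (a1, t, U)) a2 (r2 (a1, a2, U))"
  using assms
proof induction
  case (gen c)
  then show ?case
  proof (cases rule: coords_cases)
    case alpha1
    show ?thesis unfolding alpha1
      by (rule bexI[of _ "\<lambda>v. 1"], rule bexI[of _ "\<lambda>v. 0"])
        (auto intro: poly_alg_intros has_rat_deriv_const has_rat_deriv_id)
  next
    case alpha2
    show ?thesis unfolding alpha2
      by (rule bexI[of _ "\<lambda>v. 0"], rule bexI[of _ "\<lambda>v. 1"])
        (auto intro: poly_alg_intros has_rat_deriv_const has_rat_deriv_id)
  next
    case (U i j)
    show ?thesis unfolding U
      by (rule bexI[of _ "\<lambda>v. 0"], rule bexI[of _ "\<lambda>v. 0"])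
        (auto intro: poly_alg_intros has_rat_deriv_const)
  qed
next
  case (const c)
  show ?case
    by (rule bexI[of _ "\<lambda>v. 0"], rule bexI[of _ "\<lambda>v. 0"])
      (auto intro: poly_alg_intros has_rat_deriv_const)
next
  case (add p q)
  then obtain p1 p2 q1 q2 where *: "p1 \<in> poly_alg coords" "p2 \<in> poly_alg coords"
    "q1 \<in> poly_alg coords" "q2 \<in> poly_alg coords" and
    **: "\<And>a1 a2 U. has_rat_deriv (\<lambda>t. p (t, a2, U)) a1 (p1 (a1, a2, U))"
    "\<And>a1 a2 U. has_rat_deriv (\<lambda>t. p (a1, t, U)) a2 (p2 (a1, a2, U))"
    "\<And>a1 a2 U. has_rat_deriv (\<lambda>t. q (t, a2, U)) a1 (q1 (a1, a2, U))"
    "\<And>a1 a2 U. has_rat_deriv (\<lambda>t. q (a1, t, U)) a2 (q2 (a1, a2, U))"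
    by blast
  have ***: "has_rat_deriv (\<lambda>t. p (t, a2, U) + q (t, a2, U)) a1 (p1 (a1, a2, U) + q1 (a1, a2, U))" 
    "has_rat_deriv (\<lambda>t. p (a1, t, U) + q (a1, t, U)) a2 (p2 (a1, a2, U) + q2 (a1, a2, U))" for a1 a2 U
    using has_rat_deriv_add[OF **(1)[of a2 U a1] **(3)[of a2 U a1]]
      has_rat_deriv_add[OF **(2)[of a1 U a2] **(4)[of a1 U a2]] by simp_all
  show ?case
    by (rule bexI[of _ "\<lambda>v. p1 v + q1 v"], rule bexI[of _ "\<lambda>v. p2 v + q2 v"])
      (simp_all only: *** poly_alg_intros * simp_thms)
next
  case (mult p q)
  then obtain p1 p2 q1 q2 where *: "p1 \<in> poly_alg coords" "p2 \<in> poly_alg coords"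
    "q1 \<in> poly_alg coords" "q2 \<in> poly_alg coords" and
    **: "\<And>a1 a2 U. has_rat_deriv (\<lambda>t. p (t, a2, U)) a1 (p1 (a1, a2, U))"
    "\<And>a1 a2 U. has_rat_deriv (\<lambda>t. p (a1, t, U)) a2 (p2 (a1, a2, U))"
    "\<And>a1 a2 U. has_rat_deriv (\<lambda>t. q (t, a2, U)) a1 (q1 (a1, a2, U))"
    "\<And>a1 a2 U. has_rat_deriv (\<lambda>t. q (a1, t, U)) a2 (q2 (a1, a2, U))"
    by blast
  have ***: "has_rat_deriv (\<lambda>t. p (t, a2, U) * q (t, a2, U)) a1 (p1 (a1, a2, U) * q (a1, a2, U) + p (a1, a2, U) * q1 (a1, a2, U))" 
    "has_rat_deriv (\<lambda>t. p (a1, t, U) * q (a1, t, U)) a2 (p2 (a1, a2, U) * q (a1, a2, U) + p (a1, a2, U) * q2 (a1, a2, U))" for a1 a2 U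
    using has_rat_deriv_mult[OF **(1)[of a2 U a1] **(3)[of a2 U a1]]
      has_rat_deriv_mult[OF **(2)[of a1 U a2] **(4)[of a1 U a2]] by simp_all
  show ?case
    by (rule bexI[of _ "\<lambda>v. p1 v * q v + p v * q1 v"], rule bexI[of _ "\<lambda>v. p2 v * q v + p v * q2 v"])
      (simp_all only: *** poly_alg_intros * mult.hyps simp_thms)
qed

definition mat_line :: "'k::field mat3 \<Rightarrow> 'k mat3 \<Rightarrow> 'k \<Rightarrow> 'k mat3" where
  "mat_line g h t = (\<chi> i j. (1 - t) * g $ i $ j + t * h $ i $ j)"

definition coords_line :: "'k::field coords8 \<Rightarrow> 'k coords8 \<Rightarrow> 'k \<Rightarrow> 'k coords8" where
  "coords_line v w t = ((1 - t) * fst v + t * fst w, (1 - t) * fst (snd v) + t * fst (snd w),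
     mat_line (snd (snd v)) (snd (snd w)) t)"

lemma affine_poly: "\<exists>u. \<forall>t. (1 - t) * a + t * b = poly u (t::'k::field)"
  by (intro exI[of _ "[:a, b - a:]"]) (simp add: algebra_simps)

lemma common_nonzero_entries:
  fixes p q :: "'k::field_char_0 mat3 \<Rightarrow> 'k"
  assumes "p \<in> poly_alg entries" "q \<in> poly_alg entries" "p g \<noteq> 0" "q h \<noteq> 0"
  shows "\<exists>g. p g \<noteq> 0 \<and> q g \<noteq> 0"
proof -
  have "\<exists>t. p (mat_line g h t) \<noteq> 0 \<and> q (mat_line g h t) \<noteq> 0"
  proof (rule common_nonzero[OF assms(1,2)])
    show "\<exists>u. \<forall>t. c (mat_line g h t) = poly u t" if "c \<in> entries" for c
      using that by (auto simp: entries_def mat_line_def affine_poly)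
  qed (use assms in \<open>auto simp: mat_line_def\<close>)
  then show ?thesis by blast
qed

text \<open>Two points are joined by a line, and the line stays in the hyperplane \<open>\<alpha>\<^sub>2 = 0\<close> if both points
  belong to it. Thus the statement covers density in affine space and density in the hyperplane.\<close>

lemma common_nonzero_coords:
  fixes p q :: "'k::field_char_0 coords8 \<Rightarrow> 'k"
  assumes "p \<in> poly_alg coords" "q \<in> poly_alg coords" "p v \<noteq> 0" "q w \<noteq> 0"
    "v \<in> affine8" "w \<in> affine8"
  shows "\<exists>x\<in>affine8. p x \<noteq> 0 \<and> q x \<noteq> 0 \<and>
    (fst (snd v) = 0 \<longrightarrow> fst (snd w) = 0 \<longrightarrow> fst (snd x) = 0)"
proof -
  have "\<exists>t. p (coords_line v w t) \<noteq> 0 \<and> q (coords_line v w t) \<noteq> 0"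
  proof (rule common_nonzero[OF assms(1,2)])
    show "\<exists>u. \<forall>t. c (coords_line v w t) = poly u t" if "c \<in> coords" for c
      using that by (cases rule: coords_cases) (auto simp: coords_line_def mat_line_def affine_poly)
    show "p (coords_line v w 0) \<noteq> 0" "q (coords_line v w 1) \<noteq> 0"
      using assms by (auto simp: coords_line_def mat_line_def)
  qed
  moreover have "coords_line v w t \<in> affine8" for t
    using assms(5,6) by (auto simp: affine8_def coords_line_def mat_line_def)
  moreover have "fst (snd v) = 0 \<longrightarrow> fst (snd w) = 0 \<longrightarrow> fst (snd (coords_line v w t)) = 0" for t
    by (simp add: coords_line_def)
  ultimately show ?thesis by blast
qed

lemma coords_density:
  fixes p q b :: "'k::field_char_0 coords8 \<Rightarrow> 'k"
  assumes "p \<in> poly_alg coords" "q \<in> poly_alg coords" "b \<in> poly_alg coords"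
    and "w \<in> affine8" "b w \<noteq> 0"
    and "\<And>v. v \<in> affine8 \<Longrightarrow> b v \<noteq> 0 \<Longrightarrow> p v = q v" and "v \<in> affine8"
  shows "p v = q v"
proof (rule ccontr)
  assume "p v \<noteq> q v"
  then have "\<exists>x\<in>affine8. p x - q x \<noteq> 0 \<and> b x \<noteq> 0 \<and>
      (fst (snd v) = 0 \<longrightarrow> fst (snd w) = 0 \<longrightarrow> fst (snd x) = 0)"
    by (intro common_nonzero_coords poly_alg_intros assms) auto
  then show False using assms(6) by auto
qed

text \<open>Division with remainder by \<open>\<alpha>\<^sub>2\<close>; in particular a polynomial that vanishes on the hyperplane
  \<open>\<alpha>\<^sub>2 = 0\<close> is divisible by \<open>\<alpha>\<^sub>2\<close>.\<close>

lemma divide_alpha2: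
  assumes "r \<in> poly_alg coords"
  shows "\<exists>s\<in>poly_alg coords. \<forall>a1 a2 U. r (a1, a2, U) = r (a1, 0, U) + a2 * s (a1, a2, U)"
  using assms
proof induction
  case (gen c)
  then show ?case
  proof (cases rule: coords_cases)
    case alpha1
    show ?thesis unfolding alpha1 by (rule bexI[of _ "\<lambda>v. 0"]) (auto intro: poly_alg_intros)
  next
    case alpha2
    show ?thesis unfolding alpha2 by (rule bexI[of _ "\<lambda>v. 1"]) (auto intro: poly_alg_intros)
  next
    case (U i j)
    show ?thesis unfolding U by (rule bexI[of _ "\<lambda>v. 0"]) (auto intro: poly_alg_intros)
  qed
next
  case (const c)
  show ?case by (rule bexI[of _ "\<lambda>v. 0"]) (auto intro: poly_alg_intros)
next
  case (add p q)
  then obtain s t where *: "s \<in> poly_alg coords" "t \<in> poly_alg coords"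
    and **: "\<And>a1 a2 U. p (a1, a2, U) = p (a1, 0, U) + a2 * s (a1, a2, U)"
      "\<And>a1 a2 U. q (a1, a2, U) = q (a1, 0, U) + a2 * t (a1, a2, U)" by blast
  have "p (a1, a2, U) + q (a1, a2, U)
      = p (a1, 0, U) + q (a1, 0, U) + a2 * (s (a1, a2, U) + t (a1, a2, U))" for a1 a2 U
    unfolding **(1)[of a1 a2 U] **(2)[of a1 a2 U] by (simp add: algebra_simps)
  then show ?case by (intro bexI[OF _ poly_alg.add[OF *]] allI)
next
  case (mult p q)
  then obtain s t where *: "s \<in> poly_alg coords" "t \<in> poly_alg coords"
    and **: "\<And>a1 a2 U. p (a1, a2, U) = p (a1, 0, U) + a2 * s (a1, a2, U)"
      "\<And>a1 a2 U. q (a1, a2, U) = q (a1, 0, U) + a2 * t (a1, a2, U)" by blast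
  have "p (a1, a2, U) * q (a1, a2, U) = p (a1, 0, U) * q (a1, 0, U)
      + a2 * (p (a1, a2, U) * t (a1, a2, U) + s (a1, a2, U) * (q (a1, a2, U) - a2 * t (a1, a2, U)))"
    for a1 a2 U
  proof -
    have "p (a1, 0, U) = p (a1, a2, U) - a2 * s (a1, a2, U)"
      "q (a1, 0, U) = q (a1, a2, U) - a2 * t (a1, a2, U)"
      using **[of a1 a2 U] by (simp_all add: algebra_simps)
    note e = this
    show ?thesis unfolding e by (simp add: algebra_simps)
  qed
  moreover have "(\<lambda>v. p v * t v + s v * (q v - fst (snd v) * t v)) \<in> poly_alg coords"
    by (auto intro!: poly_alg_intros coords_in * mult.hyps)
  ultimately show ?case
    by (intro bexI[where x = "\<lambda>v. p v * t v + s v * (q v - fst (snd v) * t v)"] allI)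
      (unfold fst_conv snd_conv, assumption+)
qed

text \<open>The form of Hartogs' principle that is used: if \<open>r / \<alpha>\<^sub>2\<^sup>k\<close> equals \<open>p / q\<close> and is therefore
  regular at one point of the hyperplane \<open>\<alpha>\<^sub>2 = 0\<close>, then it is a polynomial. Indeed \<open>r q\<close> vanishes on the
  hyperplane and \<open>q\<close> does not vanish identically there, so \<open>r\<close> vanishes there and a factor \<open>\<alpha>\<^sub>2\<close> can be
  cancelled.\<close>

lemma hartogs_alpha2:
  fixes r :: "'k::field_char_0 coords8 \<Rightarrow> 'k"
  assumes "r \<in> poly_alg coords" "p \<in> poly_alg coords" "q \<in> poly_alg coords"
    and y: "y \<in> affine8" "fst (snd y) = 0" "q y \<noteq> 0"
    and eq: "\<And>v. v \<in> affine8 \<Longrightarrow> r v * q v = p v * fst (snd v) ^ k"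
  shows "\<exists>s\<in>poly_alg coords. \<forall>v\<in>affine8. r v = fst (snd v) ^ k * s v"
  using assms(1) eq
proof (induction k arbitrary: r)
  case 0
  then show ?case by auto
next
  case (Suc k)
  obtain s where s: "s \<in> poly_alg coords"
    "\<And>a1 a2 U. r (a1, a2, U) = r (a1, 0, U) + a2 * s (a1, a2, U)"
    using divide_alpha2[OF Suc.prems(1)] by blast
  define r0 :: "'k coords8 \<Rightarrow> 'k" where "r0 = (\<lambda>v. r (fst v, 0, snd (snd v)))"
  have r0: "r0 \<in> poly_alg coords" unfolding r0_def
    by (rule poly_alg_comp[OF Suc.prems(1)]) (erule coords_cases; auto intro: poly_alg.const coords_in)
  have z: "r0 v = 0" if v: "v \<in> affine8" for v
  proof (rule ccontr)
    assume nz: "r0 v \<noteq> 0"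
    obtain a1 a2 U where v': "v = (a1, a2, U)" by (cases v)
    define v0 where "v0 = (a1, 0::'k, U)"
    have "v0 \<in> affine8" "r0 v0 \<noteq> 0" using v nz by (auto simp: v' v0_def affine8_def r0_def)
    then obtain x where x: "x \<in> affine8" "r0 x \<noteq> 0" "q x \<noteq> 0" "fst (snd x) = 0"
      using common_nonzero_coords[OF r0 assms(3), of v0 y] y by (auto simp: v0_def)
    then have "r x = r0 x" by (cases x) (auto simp: r0_def)
    then show False using Suc.prems(2)[OF x(1)] x by simp
  qed
  have rs: "r v = fst (snd v) * s v" if "v \<in> affine8" for v
    using s(2)[of "fst v" "fst (snd v)" "snd (snd v)"] z[OF that] by (simp add: r0_def)
  have "s v * q v = p v * fst (snd v) ^ k" if v: "v \<in> affine8" for v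
  proof (rule coords_density[where b = "\<lambda>v. fst (snd v)" and w = "(1, 1, 0)"])
    show "s v * q v = p v * fst (snd v) ^ k" if "v \<in> affine8" "fst (snd v) \<noteq> 0" for v
      using Suc.prems(2)[OF that(1)] that by (simp add: rs)
  qed (use v in \<open>auto intro!: poly_alg_intros coords_in assms s simp: affine8_def\<close>)
  from Suc.IH[OF s(1) this] obtain s' where "s' \<in> poly_alg coords"
    "\<forall>v\<in>affine8. s v = fst (snd v) ^ k * s' v" by blast
  then show ?case using rs by (intro bexI[of _ s']) auto
qed


section \<open>Bihomogeneous polynomials and the Zariski topology\<close>

abbreviation mscale :: "'k::field \<Rightarrow> 'k mat3 \<Rightarrow> 'k mat3" where
  "mscale c g \<equiv> map_matrix ((*) c) g"

abbreviation point :: "'k::field mat3 \<Rightarrow> 'k mat3 \<Rightarrow> 'k proj2" where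
  "point g g' \<equiv> (proj_class g, proj_class g')"

lemma mscale_1 [simp]: "mscale 1 g = g"
  by (simp add: vec_eq_iff)

lemma mscale_mscale [simp]: "mscale a (mscale b g) = mscale (a * b) g"
  by (simp add: vec_eq_iff mult.assoc)

lemma mscale_eq_0_iff: "mscale c g = 0 \<longleftrightarrow> c = 0 \<or> g = 0"
  by (auto simp: vec_eq_iff)

lemma proj_class_self [simp]: "g \<in> proj_class g"
  unfolding proj_class_def by (auto intro!: exI[of _ 1])

lemma proj_class_mscale: "c \<noteq> 0 \<Longrightarrow> proj_class (mscale c g) = proj_class g"
proof -
  assume c: "c \<noteq> 0"
  have "\<exists>e. mscale d g = mscale e (mscale c g) \<and> e \<noteq> 0" if "d \<noteq> 0" for d
    using c that by (intro exI[of _ "d / c"]) simp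
  moreover have "\<exists>e. mscale d (mscale c g) = mscale e g \<and> e \<noteq> 0" if "d \<noteq> 0" for d
    using c that by (intro exI[of _ "d * c"]) simp
  ultimately show ?thesis unfolding proj_class_def by blast
qed

lemma proj_class_eq_iff: "proj_class g = proj_class h \<longleftrightarrow> (\<exists>c. c \<noteq> 0 \<and> g = mscale c h)"
proof
  assume "proj_class g = proj_class h"
  then have "g \<in> proj_class h" using proj_class_self by blast
  then show "\<exists>c. c \<noteq> 0 \<and> g = mscale c h" by (auto simp: proj_class_def)
qed (auto simp: proj_class_mscale)

lemma poly_fun_sub:
  assumes "poly_fun P" "\<And>i j. poly_fun (\<lambda>g g'. A g g' $ i $ j)" "\<And>i j. poly_fun (\<lambda>g g'. B g g' $ i $ j)"
  shows "poly_fun (\<lambda>g g'. P (A g g') (B g g'))"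
  using assms(1) by induction (auto intro: poly_fun.intros assms)

lemma poly_fun_alg:
  assumes "poly_fun P" "\<And>i j. (\<lambda>x. A x $ i $ j) \<in> poly_alg G" "\<And>i j. (\<lambda>x. B x $ i $ j) \<in> poly_alg G"
  shows "(\<lambda>x. P (A x) (B x)) \<in> poly_alg G"
  using assms(1) by induction (auto intro: poly_alg.intros assms)

lemma bihomI:
  assumes "poly_fun P" "\<And>s t g g'. P (mscale s g) (mscale t g') = s ^ d * t ^ e * P g g'"
  shows "bihom d e P"
  using assms by (auto simp: bihom_def)

lemma bihomD:
  assumes "bihom d e P"
  shows "poly_fun P" "P (mscale s g) (mscale t g') = s ^ d * t ^ e * P g g'"
  using assms by (auto simp: bihom_def)

lemma bihom_const: "bihom 0 0 (\<lambda>g g'. c)"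
  by (rule bihomI) (auto intro: poly_fun.intros)

lemma bihom_fst: "bihom 1 0 (\<lambda>g g'. g $ i $ j)"
  by (rule bihomI) (auto intro: poly_fun.intros)

lemma bihom_snd: "bihom 0 1 (\<lambda>g g'. g' $ i $ j)"
  by (rule bihomI) (auto intro: poly_fun.intros)

lemma bihom_add:
  assumes "bihom d e P" "bihom d e Q"
  shows "bihom d e (\<lambda>g g'. P g g' + Q g g')"
  by (rule bihomI)
    (auto intro!: poly_fun.intros bihomD(1)[OF assms(1)] bihomD(1)[OF assms(2)]
      simp: bihomD(2)[OF assms(1)] bihomD(2)[OF assms(2)] algebra_simps)

lemma bihom_mult:
  assumes "bihom d e P" "bihom d' e' Q"
  shows "bihom (d + d') (e + e') (\<lambda>g g'. P g g' * Q g g')"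
  by (rule bihomI)
    (auto intro!: poly_fun.intros bihomD(1)[OF assms(1)] bihomD(1)[OF assms(2)]
      simp: bihomD(2)[OF assms(1)] bihomD(2)[OF assms(2)] power_add)

lemma bihom_cmult: "bihom d e P \<Longrightarrow> bihom d e (\<lambda>g g'. c * P g g')"
  using bihom_mult[OF bihom_const] by fastforce

lemma bihom_diff:
  assumes "bihom d e P" "bihom d e Q"
  shows "bihom d e (\<lambda>g g'. P g g' - Q g g')"
  using bihom_add[OF assms(1) bihom_cmult[OF assms(2), of "- 1"]] by simp

lemma bihom_power: "bihom d e P \<Longrightarrow> bihom (n * d) (n * e) (\<lambda>g g'. P g g' ^ n)"
proof (induction n)
  case 0
  show ?case using bihom_const[of 1] by simp
next
  case (Suc n)
  show ?case using bihom_mult[OF Suc.prems Suc.IH[OF Suc.prems]] by (simp add: add.commute)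
qed

lemma nonvanishing_iff:
  assumes "bihom d e P"
  shows "point g g' \<in> nonvanishing P \<longleftrightarrow> g \<noteq> 0 \<and> g' \<noteq> 0 \<and> P g g' \<noteq> 0"
proof -
  have "point g g' \<in> proj2_space \<longleftrightarrow> g \<noteq> 0 \<and> g' \<noteq> 0"
  proof
    show "point g g' \<in> proj2_space \<Longrightarrow> g \<noteq> 0 \<and> g' \<noteq> 0"
      by (auto simp: proj2_space_def proj_class_eq_iff mscale_eq_0_iff)
  qed (auto simp: proj2_space_def)
  moreover have "(\<forall>h\<in>proj_class g. \<forall>h'\<in>proj_class g'. P h h' \<noteq> 0) \<longleftrightarrow> P g g' \<noteq> 0"
  proof
    assume "P g g' \<noteq> 0"
    then show "\<forall>h\<in>proj_class g. \<forall>h'\<in>proj_class g'. P h h' \<noteq> 0"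
      using bihomD(2)[OF assms] by (auto simp: proj_class_def)
  qed auto
  ultimately show ?thesis by (simp add: nonvanishing_def)
qed

lemma proj2_cases:
  assumes "x \<in> proj2_space"
  obtains g g' where "x = point g g'" "g \<noteq> 0" "g' \<noteq> 0"
  using assms by (auto simp: proj2_space_def)

lemma nonvanishing_const: "nonvanishing (\<lambda>g g'. 1) = proj2_space"
  by (auto simp: nonvanishing_def)

lemma topspace_zariski: "topspace zariski = proj2_space"
proof -
  have "nonvanishing P \<subseteq> proj2_space" for P :: "'a mat3 \<Rightarrow> 'a mat3 \<Rightarrow> 'a"
    by (auto simp: nonvanishing_def)
  moreover have "proj2_space \<in> {nonvanishing P | P d e. bihom d e P}"
    using nonvanishing_const bihom_const by blast
  ultimately show ?thesis unfolding zariski_def by auto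
qed

text \<open>The nonvanishing loci form a base, not only a subbase, because the product of two
  bihomogeneous polynomials is bihomogeneous.\<close>

lemma openin_zariski_base:
  assumes "openin zariski S" "point g g' \<in> S"
  shows "\<exists>d e B. bihom d e B \<and> B g g' \<noteq> 0 \<and> nonvanishing B \<subseteq> S"
proof -
  have "generate_topology_on {nonvanishing P | P d e. bihom d e P} S"
    using assms(1) unfolding zariski_def by (rule openin_topology_generated_by)
  then show ?thesis using assms(2)
  proof induction
    case (Int S T)
    obtain d e B where B: "bihom d e B" "B g g' \<noteq> 0" "nonvanishing B \<subseteq> S" using Int by blast
    obtain d' e' C where C: "bihom d' e' C" "C g g' \<noteq> 0" "nonvanishing C \<subseteq> T" using Int by blast
    have "nonvanishing (\<lambda>g g'. B g g' * C g g') \<subseteq> S \<inter> T"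
      using B(3) C(3) unfolding nonvanishing_def by fastforce
    moreover have "B g g' * C g g' \<noteq> 0" using B C by simp
    ultimately show ?case using bihom_mult[OF B(1) C(1)]
      by (intro exI[where x = "d + d'"] exI[where x = "e + e'"] exI[where x = "\<lambda>g g'. B g g' * C g g'"] conjI)
  next
    case (Basis S)
    then obtain P d e where P: "S = nonvanishing P" "bihom d e P" by auto
    then have "P g g' \<noteq> 0" using Basis nonvanishing_iff[OF P(2)] by simp
    then show ?case using P by blast
  next
    case (UN K)
    then obtain k where "k \<in> K" "point g g' \<in> k" by blast
    then show ?case using UN.IH[of k] by blast
  qed simp
qed


section \<open>Points and open subsets of the compactification\<close>

lemma det_nonzero_Com:
  assumes "det (g :: 'k::field mat3) \<noteq> 0"
  shows "g \<noteq> 0" "Com g \<noteq> 0"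
proof -
  have nz: "(g ** transpose (Com g)) $ 1 $ 1 \<noteq> 0"
    using assms by (simp add: mult_transpose_Com mat_def)
  show "g \<noteq> 0" using nz by (intro notI) (simp add: matrix_matrix_mult_def)
  show "Com g \<noteq> 0" using nz by (intro notI) (simp add: matrix_matrix_mult_def transpose_def)
qed

text \<open>Membership in the closure has to be tested on the base of nonvanishing loci only.\<close>

lemma wonderful_iff:
  fixes g g' :: "'k::field mat3"
  shows "point g g' \<in> wonderful \<longleftrightarrow> g \<noteq> 0 \<and> g' \<noteq> 0 \<and>
    (\<forall>d e P. bihom d e P \<longrightarrow> P g g' \<noteq> 0 \<longrightarrow> (\<exists>h. det h \<noteq> 0 \<and> P h (Com h) \<noteq> 0))"
    (is "_ \<longleftrightarrow> ?R")
proof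
  assume *: "point g g' \<in> wonderful"
  then have "point g g' \<in> proj2_space"
    unfolding wonderful_def in_closure_of topspace_zariski by (rule conjunct1)
  then have nz: "g \<noteq> 0" "g' \<noteq> 0"
    using nonvanishing_iff[OF bihom_const[of 1], of g g'] nonvanishing_const by auto
  have "\<exists>h. det h \<noteq> 0 \<and> P h (Com h) \<noteq> 0" if P: "bihom d e P" "P g g' \<noteq> 0" for d e P
  proof -
    have "openin zariski (nonvanishing P)" unfolding zariski_def
      using P(1) by (intro topology_generated_by_Basis) blast
    moreover have "point g g' \<in> nonvanishing P" using nonvanishing_iff[OF P(1)] nz P(2) by blast
    ultimately obtain y where "y \<in> group_points" "y \<in> nonvanishing P"
      using * unfolding wonderful_def in_closure_of by blast
    then show ?thesis
      using nonvanishing_iff[OF P(1)] by (auto simp: group_points_def emb_def)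
  qed
  then show ?R using nz by blast
next
  assume R: ?R
  have "point g g' \<in> proj2_space"
    using R nonvanishing_iff[OF bihom_const[of 1], of g g'] nonvanishing_const by auto
  moreover have "\<exists>y. y \<in> group_points \<and> y \<in> T" if T: "point g g' \<in> T" "openin zariski T" for T
  proof -
    obtain d e B where B: "bihom d e B" "B g g' \<noteq> 0" "nonvanishing B \<subseteq> T"
      using openin_zariski_base[OF T(2,1)] by blast
    then obtain h where "det h \<noteq> 0" "B h (Com h) \<noteq> 0" using R by blast
    then have "emb h \<in> nonvanishing B" "emb h \<in> group_points"
      using nonvanishing_iff[OF B(1)] det_nonzero_Com by (auto simp: emb_def group_points_def)
    then show ?thesis using B(3) by blast
  qed
  ultimately show "point g g' \<in> wonderful"
    unfolding wonderful_def in_closure_of topspace_zariski by blast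
qed

lemma wonderful_cases:
  assumes "x \<in> wonderful"
  obtains g g' where "x = point g g'" "point g g' \<in> wonderful" "g \<noteq> 0" "g' \<noteq> 0"
proof -
  have "x \<in> proj2_space"
    using assms unfolding wonderful_def in_closure_of topspace_zariski by (rule conjunct1)
  then show ?thesis using that assms by (auto elim: proj2_cases)
qed

lemma group_wonderful: "det h \<noteq> 0 \<Longrightarrow> point h (Com h) \<in> wonderful"
  using det_nonzero_Com[of h] by (auto simp: wonderful_iff)

lemma wonderful_relation:
  assumes "point g g' \<in> wonderful" "bihom d e P" "\<And>h. P h (Com h) = 0"
  shows "P g g' = 0"
  using assms wonderful_iff by blast

lemma zopen_iff:
  fixes V :: "'k::field proj2 set"
  shows "zopen V \<longleftrightarrow> V \<subseteq> wonderful \<and> (\<forall>g g'. point g g' \<in> V \<longrightarrow>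
    (\<exists>d e B. bihom d e B \<and> B g g' \<noteq> 0 \<and> (\<forall>h h'. point h h' \<in> wonderful \<longrightarrow> B h h' \<noteq> 0 \<longrightarrow> point h h' \<in> V)))"
    (is "_ \<longleftrightarrow> ?R")
proof
  assume "zopen V"
  then obtain S where S: "openin zariski S" "V = S \<inter> wonderful"
    by (auto simp: zopen_def openin_subtopology)
  have "\<exists>d e B. bihom d e B \<and> B g g' \<noteq> 0 \<and> (\<forall>h h'. point h h' \<in> wonderful \<longrightarrow> B h h' \<noteq> 0 \<longrightarrow> point h h' \<in> V)"
    if V: "point g g' \<in> V" for g g'
  proof -
    obtain d e B where B: "bihom d e B" "B g g' \<noteq> 0" "nonvanishing B \<subseteq> S"
      using openin_zariski_base[OF S(1)] V S(2) by blast
    have "point h h' \<in> V" if "point h h' \<in> wonderful" "B h h' \<noteq> 0" for h h'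
      using that B(3) S(2) nonvanishing_iff[OF B(1)] wonderful_iff by blast
    then show ?thesis using B by blast
  qed
  then show ?R using S by blast
next
  assume R: ?R
  define S where "S = \<Union>{nonvanishing B | d e B. bihom d e B \<and> nonvanishing B \<inter> wonderful \<subseteq> V}"
  have "openin zariski S" unfolding S_def zariski_def
    by (intro openin_Union) (auto intro!: topology_generated_by_Basis)
  moreover have "V = S \<inter> wonderful"
  proof
    show "V \<subseteq> S \<inter> wonderful"
    proof
      fix x assume x: "x \<in> V"
      then have "x \<in> wonderful" using R by blast
      then obtain g g' where g: "x = point g g'" "g \<noteq> 0" "g' \<noteq> 0" by (rule wonderful_cases)
      then obtain d e B where B: "bihom d e B" "B g g' \<noteq> 0"
        "\<And>h h'. point h h' \<in> wonderful \<Longrightarrow> B h h' \<noteq> 0 \<Longrightarrow> point h h' \<in> V"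
        using R x by blast
      have "y \<in> V" if y: "y \<in> nonvanishing B" "y \<in> wonderful" for y
      proof -
        obtain h h' where h: "y = point h h'" "point h h' \<in> wonderful"
          using y(2) by (rule wonderful_cases)
        then have "B h h' \<noteq> 0" using y(1) nonvanishing_iff[OF B(1)] by simp
        then show ?thesis using B(3)[OF h(2)] h(1) by simp
      qed
      then have "nonvanishing B \<inter> wonderful \<subseteq> V" by blast
      then have "nonvanishing B \<subseteq> S" using B(1) unfolding S_def by blast
      moreover have "x \<in> nonvanishing B" using nonvanishing_iff[OF B(1)] g B(2) by simp
      ultimately show "x \<in> S \<inter> wonderful" using R x by blast
    qed
  qed (auto simp: S_def)
  ultimately show "zopen V" by (auto simp: zopen_def openin_subtopology)
qed

lemma zopen_subset: "zopen V \<Longrightarrow> V \<subseteq> wonderful"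
  by (simp add: zopen_iff)

lemma zopenE:
  assumes "zopen V" "point g g' \<in> V"
  obtains d e B where "bihom d e B" "B g g' \<noteq> 0"
    "\<And>h h'. point h h' \<in> wonderful \<Longrightarrow> B h h' \<noteq> 0 \<Longrightarrow> point h h' \<in> V"
proof -
  have "\<exists>d e B. bihom d e B \<and> B g g' \<noteq> 0 \<and>
      (\<forall>h h'. point h h' \<in> wonderful \<longrightarrow> B h h' \<noteq> 0 \<longrightarrow> point h h' \<in> V)"
    using assms(1)[unfolded zopen_iff] assms(2) by (elim conjE allE impE)
  then show ?thesis using that by (elim exE conjE) simp
qed

lemma zopen_Int: "zopen V \<Longrightarrow> zopen W \<Longrightarrow> zopen (V \<inter> W)"
  by (simp add: zopen_def openin_Int)

lemma zopen_nonvanishing: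
  assumes "bihom d e B"
  shows "zopen {x \<in> wonderful. x \<in> nonvanishing B}"
  unfolding zopen_iff using assms nonvanishing_iff[OF assms] wonderful_iff by blast

lemma big_cell_iff:
  "point g g' \<in> big_cell \<longleftrightarrow> point g g' \<in> wonderful \<and> g $ 3 $ 3 \<noteq> 0 \<and> g' $ 1 $ 1 \<noteq> 0"
proof -
  have "(\<forall>h\<in>proj_class g. \<forall>h'\<in>proj_class g'. h $ 3 $ 3 * h' $ 1 $ 1 \<noteq> 0)
      \<longleftrightarrow> g $ 3 $ 3 \<noteq> 0 \<and> g' $ 1 $ 1 \<noteq> 0"
  proof
    assume "\<forall>h\<in>proj_class g. \<forall>h'\<in>proj_class g'. h $ 3 $ 3 * h' $ 1 $ 1 \<noteq> 0"
    then have "g $ 3 $ 3 * g' $ 1 $ 1 \<noteq> 0" by (meson proj_class_self)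
    then show "g $ 3 $ 3 \<noteq> 0 \<and> g' $ 1 $ 1 \<noteq> 0" by auto
  qed (auto simp: proj_class_def)
  then show ?thesis unfolding big_cell_def by simp
qed

lemma big_cell_subset: "big_cell \<subseteq> wonderful"
  by (auto simp: big_cell_def)

lemma bihom_corner: "bihom 1 1 (\<lambda>g g'. g $ 3 $ 3 * g' $ 1 $ 1)"
  using bihom_mult[OF bihom_fst bihom_snd] by simp

lemma zopen_big_cell: "zopen big_cell"
  unfolding zopen_iff
proof (intro conjI allI impI)
  fix g g' :: "'a mat3" assume "point g g' \<in> big_cell"
  then show "\<exists>d e B. bihom d e B \<and> B g g' \<noteq> 0 \<and>
      (\<forall>h h'. point h h' \<in> wonderful \<longrightarrow> B h h' \<noteq> 0 \<longrightarrow> point h h' \<in> big_cell)"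
    by (intro exI[where x = "1 :: nat"] exI[where x = "\<lambda>g g'. g $ 3 $ 3 * g' $ 1 $ 1"] conjI bihom_corner)
      (auto simp: big_cell_iff)
qed (rule big_cell_subset)


section \<open>Regular functions as local fractions\<close>

definition is_fraction ::
    "'k::field proj2 set \<Rightarrow> ('k proj2 \<Rightarrow> 'k) \<Rightarrow> ('k mat3 \<Rightarrow> 'k mat3 \<Rightarrow> 'k) \<Rightarrow> ('k mat3 \<Rightarrow> 'k mat3 \<Rightarrow> 'k) \<Rightarrow> bool" where
  "is_fraction V f P Q \<longleftrightarrow> (\<exists>d e. bihom d e P \<and> bihom d e Q) \<and>
     (\<forall>g g'. point g g' \<in> wonderful \<longrightarrow> Q g g' \<noteq> 0 \<longrightarrow>
        point g g' \<in> V \<and> f (point g g') = P g g' / Q g g')"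

text \<open>Multiplying numerator and denominator by a polynomial that defines a neighbourhood makes
  the nonvanishing of the denominator alone the domain of validity of a local fraction.\<close>

lemma regular_iff:
  assumes V: "zopen V"
  shows "f \<in> regular V \<longleftrightarrow> (\<forall>x. x \<notin> V \<longrightarrow> f x = 0) \<and>
    (\<forall>g g'. point g g' \<in> V \<longrightarrow> (\<exists>P Q. is_fraction V f P Q \<and> Q g g' \<noteq> 0))"
proof
  assume f: "f \<in> regular V"
  have "\<exists>P Q. is_fraction V f P Q \<and> Q g g' \<noteq> 0" if x: "point g g' \<in> V" for g g'
  proof -
    obtain W P Q d e where W: "zopen W" "point g g' \<in> W" "W \<subseteq> V" and PQ: "bihom d e P" "bihom d e Q"
      and eq: "\<forall>(p, p')\<in>W. \<forall>g\<in>p. \<forall>g'\<in>p'. Q g g' \<noteq> 0 \<and> f (p, p') = P g g' / Q g g'"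
      using f x unfolding regular_def by blast
    have eq': "Q h h' \<noteq> 0" "f (point h h') = P h h' / Q h h'" if "point h h' \<in> W" for h h'
      using bspec[OF eq that] proj_class_self[of h] proj_class_self[of h'] by auto
    obtain d' e' B where B: "bihom d' e' B" "B g g' \<noteq> 0"
      "\<And>h h'. point h h' \<in> wonderful \<Longrightarrow> B h h' \<noteq> 0 \<Longrightarrow> point h h' \<in> W"
      by (rule zopenE[OF W(1,2)]) (rule that)
    have "is_fraction V f (\<lambda>g g'. P g g' * B g g') (\<lambda>g g'. Q g g' * B g g')"
      unfolding is_fraction_def
    proof (intro conjI allI impI)
      show "\<exists>d e. bihom d e (\<lambda>g g'. P g g' * B g g') \<and> bihom d e (\<lambda>g g'. Q g g' * B g g')"
        using bihom_mult[OF _ B(1)] PQ by blast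
    next
      fix h h' assume h: "point h h' \<in> wonderful" "Q h h' * B h h' \<noteq> 0"
      then have "point h h' \<in> W" using B(3) by simp
      then show "point h h' \<in> V" "f (point h h') = P h h' * B h h' / (Q h h' * B h h')"
        using W(3) eq' h by auto
    qed
    moreover have "Q g g' * B g g' \<noteq> 0" using eq'(1)[OF W(2)] B(2) by simp
    ultimately show ?thesis
      by (intro exI[where x = "\<lambda>g g'. P g g' * B g g'"] exI[where x = "\<lambda>g g'. Q g g' * B g g'"] conjI)
  qed
  then show "(\<forall>x. x \<notin> V \<longrightarrow> f x = 0) \<and>
    (\<forall>g g'. point g g' \<in> V \<longrightarrow> (\<exists>P Q. is_fraction V f P Q \<and> Q g g' \<noteq> 0))"
    using f unfolding regular_def by blast
next
  assume R: "(\<forall>x. x \<notin> V \<longrightarrow> f x = 0) \<and>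
    (\<forall>g g'. point g g' \<in> V \<longrightarrow> (\<exists>P Q. is_fraction V f P Q \<and> Q g g' \<noteq> 0))"
  have "\<exists>W P Q d e. zopen W \<and> x \<in> W \<and> W \<subseteq> V \<and> bihom d e P \<and> bihom d e Q \<and>
        (\<forall>(p, p')\<in>W. \<forall>g\<in>p. \<forall>g'\<in>p'. Q g g' \<noteq> 0 \<and> f (p, p') = P g g' / Q g g')" if x: "x \<in> V" for x
  proof -
    have "x \<in> wonderful" using x V zopen_subset by blast
    then obtain g g' where g: "x = point g g'" "g \<noteq> 0" "g' \<noteq> 0" by (rule wonderful_cases)
    then obtain P Q where PQ: "is_fraction V f P Q" "Q g g' \<noteq> 0" using R x by blast
    then obtain d e where b: "bihom d e P" "bihom d e Q" by (auto simp: is_fraction_def)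
    define W where "W = {x \<in> wonderful. x \<in> nonvanishing Q}"
    have W: "Q h h' \<noteq> 0 \<and> point h h' \<in> V \<and> f y = P h h' / Q h h'"
      if "y \<in> W" "h \<in> fst y" "h' \<in> snd y" for y h h'
    proof -
      have "y \<in> wonderful" using that by (simp add: W_def)
      then obtain k k' where k: "y = point k k'" by (rule wonderful_cases)
      then have "h \<in> proj_class k" "h' \<in> proj_class k'" using that by auto
      then have y: "y = point h h'" unfolding k
        using proj_class_eq_iff[of h k] proj_class_eq_iff[of h' k'] by (auto simp: proj_class_def[of k] proj_class_def[of k'])
      then have "Q h h' \<noteq> 0" "point h h' \<in> wonderful" using that nonvanishing_iff[OF b(2)] by (auto simp: W_def)
      then show ?thesis using PQ(1) y by (auto simp: is_fraction_def)
    qed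
    have "W \<subseteq> V"
    proof
      fix y assume y: "y \<in> W"
      then have "y \<in> wonderful" by (simp add: W_def)
      then obtain k k' where k: "y = point k k'" by (rule wonderful_cases)
      then show "y \<in> V" using W[OF y, of k k'] by simp
    qed
    moreover have "x \<in> W" using nonvanishing_iff[OF b(2)] g PQ(2) \<open>x \<in> wonderful\<close> by (auto simp: W_def)
    moreover have "zopen W" unfolding W_def by (rule zopen_nonvanishing[OF b(2)])
    moreover have "\<forall>(p, p')\<in>W. \<forall>g\<in>p. \<forall>g'\<in>p'. Q g g' \<noteq> 0 \<and> f (p, p') = P g g' / Q g g'"
      using W by (force simp: g(1))
    ultimately show ?thesis using b
      by (intro exI[where x = W] exI[where x = P] exI[where x = Q] exI[where x = d] exI[where x = e] conjI)
  qed
  then show "f \<in> regular V" unfolding regular_def using R by blast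
qed

lemma regularD:
  assumes "f \<in> regular V" "zopen V"
  shows "x \<notin> V \<Longrightarrow> f x = 0"
    "point g g' \<in> V \<Longrightarrow> \<exists>P Q. is_fraction V f P Q \<and> Q g g' \<noteq> 0"
  using assms regular_iff by blast+

lemma is_fractionD:
  assumes "is_fraction V f P Q" "point g g' \<in> wonderful" "Q g g' \<noteq> 0"
  shows "point g g' \<in> V" "f (point g g') = P g g' / Q g g'"
  using assms by (auto simp: is_fraction_def)


section \<open>Cofactor matrices\<close>

lemma Com_entries:
  "Com g $ 1 $ 1 = g $ 2 $ 2 * g $ 3 $ 3 - g $ 2 $ 3 * g $ 3 $ 2"
  "Com g $ 1 $ 2 = g $ 2 $ 3 * g $ 3 $ 1 - g $ 2 $ 1 * g $ 3 $ 3"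
  "Com g $ 1 $ 3 = g $ 2 $ 1 * g $ 3 $ 2 - g $ 2 $ 2 * g $ 3 $ 1"
  "Com g $ 2 $ 1 = g $ 1 $ 3 * g $ 3 $ 2 - g $ 1 $ 2 * g $ 3 $ 3"
  "Com g $ 2 $ 2 = g $ 1 $ 1 * g $ 3 $ 3 - g $ 1 $ 3 * g $ 3 $ 1"
  "Com g $ 2 $ 3 = g $ 1 $ 2 * g $ 3 $ 1 - g $ 1 $ 1 * g $ 3 $ 2"
  "Com g $ 3 $ 1 = g $ 1 $ 2 * g $ 2 $ 3 - g $ 1 $ 3 * g $ 2 $ 2"
  "Com g $ 3 $ 2 = g $ 1 $ 3 * g $ 2 $ 1 - g $ 1 $ 1 * g $ 2 $ 3"
  "Com g $ 3 $ 3 = g $ 1 $ 1 * g $ 2 $ 2 - g $ 1 $ 2 * g $ 2 $ 1"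
  by (simp_all add: Com_def minor_def skip_def det_2)

lemma minor_Com:
  "minor 1 1 g = Com g $ 1 $ 1" "minor 2 2 g = Com g $ 2 $ 2"
  "minor 1 2 g = - Com g $ 1 $ 2" "minor 2 1 g = - Com g $ 2 $ 1"
  by (simp_all add: Com_def)

lemma mult_entry:
  fixes A B :: "'k::comm_ring_1 mat3"
  shows "(A ** B) $ i $ j = A $ i $ 1 * B $ 1 $ j + A $ i $ 2 * B $ 2 $ j + A $ i $ 3 * B $ 3 $ j"
  by (simp add: matrix_matrix_mult_def sum_3)

lemma Com_mult: "Com (A ** B) = Com A ** Com (B :: 'k::comm_ring_1 mat3)"
  unfolding vec_eq_iff forall_3
  by (intro conjI; simp only: Com_entries mult_entry; simp add: algebra_simps)

lemma Com_Com: "Com (Com g) = mscale (det g) (g :: 'k::field mat3)"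
  unfolding vec_eq_iff forall_3 nth_map_matrix
  by (intro conjI; simp only: Com_entries det_3; simp add: algebra_simps)

lemma Com_mscale: "Com (mscale c g) = mscale (c\<^sup>2) (Com (g :: 'k::field mat3))"
  unfolding vec_eq_iff forall_3 nth_map_matrix
  by (intro conjI; simp only: Com_entries nth_map_matrix; simp add: algebra_simps power2_eq_square)

lemma Com_mat_1: "Com (mat 1) = (mat 1 :: 'k::comm_ring_1 mat3)"
  unfolding vec_eq_iff forall_3 by (simp add: Com_entries mat_def)

lemma mscale_mult:
  "mscale c A ** B = mscale c (A ** B)" "A ** mscale c B = mscale c (A ** B)"
  by (simp_all add: vec_eq_iff mult_entry algebra_simps)

lemma poly_fun_diff:
  assumes "poly_fun P" "poly_fun Q"
  shows "poly_fun (\<lambda>g g'. P g g' - Q g g')"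
proof -
  have "poly_fun (\<lambda>g g'. P g g' + (- 1) * Q g g')" by (intro poly_fun.intros assms)
  then show ?thesis by simp
qed

lemma bihom_Com_fst: "bihom 2 0 (\<lambda>g g'. Com g $ i $ j)"
proof (rule bihomI)
  have "\<forall>i j. poly_fun (\<lambda>g g' :: 'a mat3. Com g $ i $ j)"
    unfolding forall_3 Com_entries
    by (intro conjI poly_fun_diff poly_fun.intros)
  then show "poly_fun (\<lambda>g g' :: 'a mat3. Com g $ i $ j)" by blast
qed (simp add: Com_mscale)

lemma bihom_Com_snd: "bihom 0 2 (\<lambda>g g'. Com g' $ i $ j)"
proof (rule bihomI)
  have "\<forall>i j. poly_fun (\<lambda>g g' :: 'a mat3. Com g' $ i $ j)"
    unfolding forall_3 Com_entries
    by (intro conjI poly_fun_diff poly_fun.intros)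
  then show "poly_fun (\<lambda>g g' :: 'a mat3. Com g' $ i $ j)" by blast
qed (simp add: Com_mscale)

lemma Com_alg:
  assumes "\<And>i j. (\<lambda>x. A x $ i $ j) \<in> poly_alg G"
  shows "(\<lambda>x. Com (A x) $ i $ j) \<in> poly_alg G"
  using poly_fun_alg[OF bihomD(1)[OF bihom_Com_fst] assms assms] .

lemma det_alg: "det \<in> poly_alg entries"
  unfolding det_3 by (intro poly_alg_intros entry_in)

text \<open>On the closure \<open>Com g\<close> is proportional to \<open>g'\<close>, and \<open>Com g'\<close> to \<open>g\<close>, because
  \<open>Com (Com g) = det g * g\<close>. Either factor of proportionality may be zero.\<close>

lemma wonderful_Com:
  fixes g g' :: "'k::field mat3"
  assumes "point g g' \<in> wonderful"
  shows "Com g $ i $ j * g' $ k $ l = Com g $ k $ l * g' $ i $ j"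
    "Com g' $ i $ j * g $ k $ l = Com g' $ k $ l * g $ i $ j"
proof -
  have "Com g $ i $ j * g' $ k $ l - Com g $ k $ l * g' $ i $ j = 0"
    by (rule wonderful_relation[OF assms bihom_diff[OF bihom_mult[OF bihom_Com_fst bihom_snd]
      bihom_mult[OF bihom_Com_fst bihom_snd]]]) simp
  then show "Com g $ i $ j * g' $ k $ l = Com g $ k $ l * g' $ i $ j" by simp
  have "Com g' $ i $ j * g $ k $ l - Com g' $ k $ l * g $ i $ j = 0"
    by (rule wonderful_relation[OF assms bihom_diff[OF bihom_mult[OF bihom_Com_snd bihom_fst]
      bihom_mult[OF bihom_Com_snd bihom_fst]]]) (simp add: Com_Com)
  then show "Com g' $ i $ j * g $ k $ l = Com g' $ k $ l * g $ i $ j" by simp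
qed


section \<open>Density\<close>

lemma poly_fun_Com_alg: "poly_fun P \<Longrightarrow> (\<lambda>h. P h (Com h)) \<in> poly_alg entries"
  by (rule poly_fun_alg) (auto intro: entry_in Com_alg)

text \<open>The compactification is irreducible: open subsets meet the group, on which the polynomials that
  define them become polynomials in the entries of one matrix.\<close>

lemma wonderful_irreducible:
  fixes g g' k k' :: "'k::field_char_0 mat3"
  assumes "point g g' \<in> wonderful" "bihom d e B" "B g g' \<noteq> 0"
    and "point k k' \<in> wonderful" "bihom d' e' C" "C k k' \<noteq> 0"
  shows "\<exists>h. det h \<noteq> 0 \<and> B h (Com h) \<noteq> 0 \<and> C h (Com h) \<noteq> 0"
proof -
  obtain h where h: "det h \<noteq> 0" "B h (Com h) \<noteq> 0" using assms(1-3) wonderful_iff by blast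
  obtain l where l: "det l \<noteq> 0" "C l (Com l) \<noteq> 0" using assms(4-6) wonderful_iff by blast
  have "\<exists>g. det g * B g (Com g) \<noteq> 0 \<and> C g (Com g) \<noteq> 0"
    using h l by (intro common_nonzero_entries[where g = h and h = l] poly_alg_intros det_alg
      poly_fun_Com_alg bihomD(1)[OF assms(2)] bihomD(1)[OF assms(5)]) auto
  then show ?thesis by auto
qed

lemma big_cell_dense:
  fixes g g' :: "'k::field_char_0 mat3"
  assumes "point g g' \<in> wonderful" "bihom d e B" "B g g' \<noteq> 0"
  shows "\<exists>h. det h \<noteq> 0 \<and> B h (Com h) \<noteq> 0 \<and> point h (Com h) \<in> big_cell"
proof -
  have "point (mat 1) (Com (mat 1)) \<in> (wonderful :: 'k proj2 set)"
    by (rule group_wonderful) simp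
  moreover have "(mat 1 :: 'k mat3) $ 3 $ 3 * Com (mat 1 :: 'k mat3) $ 1 $ 1 \<noteq> 0"
    unfolding Com_mat_1 by (simp add: mat_def)
  ultimately have "\<exists>h :: 'k mat3. det h \<noteq> 0 \<and> B h (Com h) \<noteq> 0 \<and> h $ 3 $ 3 * Com h $ 1 $ 1 \<noteq> 0"
    by (rule wonderful_irreducible[OF assms _ bihom_corner])
  then obtain h where "det h \<noteq> 0" "B h (Com h) \<noteq> 0" "h $ 3 $ 3 * Com h $ 1 $ 1 \<noteq> 0" by blast
  then show ?thesis using big_cell_iff group_wonderful[of h] by auto
qed

text \<open>A fraction whose value is prescribed on the big cell only. By density it is determined by
  these values.\<close>

definition fraction_on_cell ::
    "'k::field proj2 set \<Rightarrow> ('k proj2 \<Rightarrow> 'k) \<Rightarrow> ('k mat3 \<Rightarrow> 'k mat3 \<Rightarrow> 'k) \<Rightarrow> ('k mat3 \<Rightarrow> 'k mat3 \<Rightarrow> 'k) \<Rightarrow> bool" where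
  "fraction_on_cell V f P Q \<longleftrightarrow> (\<exists>d e. bihom d e P \<and> bihom d e Q) \<and>
     (\<forall>g g'. point g g' \<in> wonderful \<longrightarrow> Q g g' \<noteq> 0 \<longrightarrow>
        point g g' \<in> V \<and> (point g g' \<in> big_cell \<longrightarrow> f (point g g') = P g g' / Q g g'))"

lemma fraction_on_cell_unique:
  fixes f :: "'k::field_char_0 proj2 \<Rightarrow> 'k"
  assumes PQ: "fraction_on_cell V f P Q" and RS: "fraction_on_cell V f R S"
    and g: "point g g' \<in> wonderful" "Q g g' \<noteq> 0" "S g g' \<noteq> 0"
  shows "P g g' / Q g g' = R g g' / S g g'"
proof -
  obtain d e where b: "bihom d e P" "bihom d e Q" using PQ by (auto simp: fraction_on_cell_def)
  obtain d' e' where b': "bihom d' e' R" "bihom d' e' S" using RS by (auto simp: fraction_on_cell_def)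
  have bd: "bihom (d + d') (e + e') (\<lambda>g g'. P g g' * S g g' - Q g g' * R g g')"
    by (intro bihom_diff bihom_mult b b')
  have "P g g' * S g g' - Q g g' * R g g' = 0"
  proof (rule ccontr)
    assume nz: "P g g' * S g g' - Q g g' * R g g' \<noteq> 0"
    have "(P g g' * S g g' - Q g g' * R g g') * (Q g g' * S g g') \<noteq> 0"
      using nz g by simp
    from big_cell_dense[OF g(1) bihom_mult[OF bd bihom_mult[OF b(2) b'(2)]] this]
    obtain k where k: "point k (Com k) \<in> big_cell" "P k (Com k) * S k (Com k) - Q k (Com k) * R k (Com k) \<noteq> 0"
      "Q k (Com k) \<noteq> 0" "S k (Com k) \<noteq> 0" by auto
    have "point k (Com k) \<in> wonderful" using k(1) big_cell_subset by blast
    then have "f (point k (Com k)) = P k (Com k) / Q k (Com k)" "f (point k (Com k)) = R k (Com k) / S k (Com k)"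
      using PQ RS k(1,3,4) unfolding fraction_on_cell_def by blast+
    then have "P k (Com k) / Q k (Com k) = R k (Com k) / S k (Com k)" by simp
    then show False using k by (simp add: field_simps)
  qed
  then show ?thesis using g by (simp add: field_simps)
qed

lemma regular_unique:
  fixes f h :: "'k::field_char_0 proj2 \<Rightarrow> 'k"
  assumes V: "zopen V" and fh: "f \<in> regular V" "h \<in> regular V"
    and eq: "\<And>x. x \<in> V \<Longrightarrow> x \<in> big_cell \<Longrightarrow> f x = h x"
  shows "f = h"
proof
  fix x show "f x = h x"
  proof (cases "x \<in> V")
    case False
    then show ?thesis using regularD(1)[OF fh(1) V] regularD(1)[OF fh(2) V] by simp
  next
    case True
    then have "x \<in> wonderful" using V zopen_subset by blast
    then obtain g g' where g: "x = point g g'" "point g g' \<in> wonderful" by (rule wonderful_cases)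
    obtain P Q where PQ: "is_fraction V f P Q" "Q g g' \<noteq> 0"
      using regularD(2)[OF fh(1) V] True g by blast
    obtain R S where RS: "is_fraction V h R S" "S g g' \<noteq> 0"
      using regularD(2)[OF fh(2) V] True g by blast
    have fP: "fraction_on_cell V f P Q"
      using PQ(1) by (simp add: is_fraction_def fraction_on_cell_def)
    have fR: "fraction_on_cell V f R S"
      using RS(1) by (auto simp: is_fraction_def fraction_on_cell_def eq)
    from fraction_on_cell_unique[OF fP fR g(2) PQ(2) RS(2)] show ?thesis
      unfolding g(1) is_fractionD(2)[OF PQ(1) g(2) PQ(2)] is_fractionD(2)[OF RS(1) g(2) RS(2)] .
  qed
qed


section \<open>The big cell is affine 8-space\<close>

definition cell_mat :: "'k::field coords8 \<Rightarrow> 'k mat3" where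
  "cell_mat = (\<lambda>(a1, a2, U). upper_uni U ** diag3 (a1 * a2) a2 1 ** lower_uni U)"

definition cell_mat' :: "'k::field coords8 \<Rightarrow> 'k mat3" where
  "cell_mat' = (\<lambda>(a1, a2, U). Com (upper_uni U) ** diag3 1 a1 (a1 * a2) ** Com (lower_uni U))"

lemma cell_point_eq: "cell_point v = point (cell_mat v) (cell_mat' v)"
  by (simp add: cell_point_def cell_mat_def cell_mat'_def case_prod_beta)

lemmas cell_factors = upper_uni_def lower_uni_def diag3_def vector_3

lemma cell_mat_entries:
  "cell_mat (a1, a2, U) $ 1 $ 1 = a1 * a2 + a2 * U $ 1 $ 2 * U $ 2 $ 1 + U $ 1 $ 3 * U $ 3 $ 1"
  "cell_mat (a1, a2, U) $ 1 $ 2 = a2 * U $ 1 $ 2 + U $ 1 $ 3 * U $ 3 $ 2"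
  "cell_mat (a1, a2, U) $ 1 $ 3 = U $ 1 $ 3"
  "cell_mat (a1, a2, U) $ 2 $ 1 = a2 * U $ 2 $ 1 + U $ 2 $ 3 * U $ 3 $ 1"
  "cell_mat (a1, a2, U) $ 2 $ 2 = a2 + U $ 2 $ 3 * U $ 3 $ 2"
  "cell_mat (a1, a2, U) $ 2 $ 3 = U $ 2 $ 3"
  "cell_mat (a1, a2, U) $ 3 $ 1 = U $ 3 $ 1"
  "cell_mat (a1, a2, U) $ 3 $ 2 = U $ 3 $ 2"
  "cell_mat (a1, a2, U) $ 3 $ 3 = 1"
  by (simp_all add: cell_mat_def mult_entry cell_factors)

lemma cell_mat'_entries:
  "cell_mat' (a1, a2, U) $ 1 $ 1 = 1"
  "cell_mat' (a1, a2, U) $ 1 $ 2 = - U $ 2 $ 1"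
  "cell_mat' (a1, a2, U) $ 1 $ 3 = U $ 2 $ 1 * U $ 3 $ 2 - U $ 3 $ 1"
  "cell_mat' (a1, a2, U) $ 2 $ 1 = - U $ 1 $ 2"
  "cell_mat' (a1, a2, U) $ 2 $ 2 = a1 + U $ 1 $ 2 * U $ 2 $ 1"
  "cell_mat' (a1, a2, U) $ 2 $ 3 = - U $ 1 $ 2 * (U $ 2 $ 1 * U $ 3 $ 2 - U $ 3 $ 1) - a1 * U $ 3 $ 2"
  "cell_mat' (a1, a2, U) $ 3 $ 1 = U $ 1 $ 2 * U $ 2 $ 3 - U $ 1 $ 3"
  "cell_mat' (a1, a2, U) $ 3 $ 2 = - (U $ 1 $ 2 * U $ 2 $ 3 - U $ 1 $ 3) * U $ 2 $ 1 - a1 * U $ 2 $ 3"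
  "cell_mat' (a1, a2, U) $ 3 $ 3 = a1 * a2 + a1 * U $ 2 $ 3 * U $ 3 $ 2
     + (U $ 1 $ 2 * U $ 2 $ 3 - U $ 1 $ 3) * (U $ 2 $ 1 * U $ 3 $ 2 - U $ 3 $ 1)"
  by (simp_all add: cell_mat'_def mult_entry Com_entries cell_factors) (simp_all add: algebra_simps)

lemma Com_cell_mat: "Com (cell_mat v) = mscale (fst (snd v)) (cell_mat' v)"
proof -
  obtain a1 a2 U where v: "v = (a1, a2, U)" by (cases v)
  show ?thesis unfolding v vec_eq_iff forall_3 nth_map_matrix
    by (intro conjI; simp only: Com_entries cell_mat_entries cell_mat'_entries fst_conv snd_conv;
      simp add: algebra_simps)
qed

lemma det_cell_mat: "det (cell_mat v) = fst v * (fst (snd v))\<^sup>2"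
proof -
  obtain a1 a2 U where v: "v = (a1, a2, U)" by (cases v)
  show ?thesis unfolding v det_3 cell_mat_entries by (simp add: algebra_simps power2_eq_square)
qed

lemma cell_mat_alg:
  "(\<lambda>v :: 'k::field coords8. cell_mat v $ i $ j) \<in> poly_alg coords"
  "(\<lambda>v :: 'k::field coords8. cell_mat' v $ i $ j) \<in> poly_alg coords"
proof -
  have "\<forall>i j. (\<lambda>v :: 'k coords8. cell_mat (fst v, fst (snd v), snd (snd v)) $ i $ j) \<in> poly_alg coords"
    unfolding forall_3 cell_mat_entries by (intro conjI poly_alg_intros coords_in)
  then show "(\<lambda>v :: 'k coords8. cell_mat v $ i $ j) \<in> poly_alg coords" by simp
  have "\<forall>i j. (\<lambda>v :: 'k coords8. cell_mat' (fst v, fst (snd v), snd (snd v)) $ i $ j) \<in> poly_alg coords"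
    unfolding forall_3 cell_mat'_entries by (intro conjI poly_alg_intros coords_in)
  then show "(\<lambda>v :: 'k coords8. cell_mat' v $ i $ j) \<in> poly_alg coords" by simp
qed

text \<open>The coordinates of a point of the big cell: the last row and column of \<open>g\<close> and the first row and
  column of \<open>g'\<close> give the entries of \<open>u\<close> and \<open>u'\<close>, and \<open>\<alpha>\<^sub>2\<close> and \<open>\<alpha>\<^sub>1\<close> are the corner minors of \<open>g\<close> and
  \<open>g'\<close>.\<close>

definition coords_of :: "'k::field mat3 \<Rightarrow> 'k mat3 \<Rightarrow> 'k coords8" where
  "coords_of g g' = (Com g' $ 3 $ 3 / (g' $ 1 $ 1)\<^sup>2, Com g $ 1 $ 1 / (g $ 3 $ 3)\<^sup>2,
     vector [vector [0, - g' $ 2 $ 1 / g' $ 1 $ 1, g $ 1 $ 3 / g $ 3 $ 3],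
             vector [- g' $ 1 $ 2 / g' $ 1 $ 1, 0, g $ 2 $ 3 / g $ 3 $ 3],
             vector [g $ 3 $ 1 / g $ 3 $ 3, g $ 3 $ 2 / g $ 3 $ 3, 0]])"

lemma coords_of_affine8: "coords_of g g' \<in> affine8"
  by (simp add: coords_of_def affine8_def forall_3 vector_3)

lemma coords_of_mscale:
  "s \<noteq> 0 \<Longrightarrow> t \<noteq> 0 \<Longrightarrow> coords_of (mscale s g) (mscale t g') = coords_of g g'"
  by (simp add: coords_of_def Com_mscale power_mult_distrib)

lemma coords_of_cell:
  assumes "v \<in> affine8"
  shows "coords_of (cell_mat v) (cell_mat' v) = v"
proof -
  obtain a1 a2 U where v: "v = (a1, a2, U)" by (cases v)
  have "U $ i $ i = 0" for i using assms by (simp add: v affine8_def)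
  then show ?thesis unfolding v
    by (simp add: coords_of_def Com_entries cell_mat_entries cell_mat'_entries vec_eq_iff forall_3 vector_3)
qed

text \<open>The relations \<open>Com g = t g'\<close> and \<open>Com g' = s g\<close>, together with the orthogonality of the last row
  (column) of \<open>g\<close> to the first row (column) of \<open>g'\<close>, express all entries of \<open>g\<close> and \<open>g'\<close> by the eight
  coordinates.\<close>

lemma cell_coords_of:
  assumes "point g g' \<in> big_cell"
  shows "g = mscale (g $ 3 $ 3) (cell_mat (coords_of g g'))"
    "g' = mscale (g' $ 1 $ 1) (cell_mat' (coords_of g g'))"
proof -
  note w = assms[unfolded big_cell_iff]
  define a b where "a = g $ 3 $ 3" "b = g' $ 1 $ 1"
  note ab = this
  have nz: "a \<noteq> 0" "b \<noteq> 0" using w ab by auto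
  define t s where "t = Com g $ 1 $ 1 / b" "s = Com g' $ 3 $ 3 / a"
  note ts = this
  have C: "Com g $ k $ l = t * g' $ k $ l" for k l
    unfolding ts using wonderful_Com(1)[OF conjunct1[OF w], of 1 1 k l] nz(2) ab(2)
    by (simp add: nonzero_eq_divide_eq)
  have C': "Com g' $ k $ l = s * g $ k $ l" for k l
    unfolding ts using wonderful_Com(2)[OF conjunct1[OF w], of 3 3 k l] nz(1) ab(1)
    by (simp add: nonzero_eq_divide_eq)
  have r1: "g $ 1 $ 3 * g' $ 1 $ 1 + g $ 2 $ 3 * g' $ 2 $ 1 + g $ 3 $ 3 * g' $ 3 $ 1 = 0"
  proof (rule wonderful_relation[OF conjunct1[OF w], where d = 1 and e = 1])
    show "bihom 1 1 (\<lambda>g g'. g $ 1 $ 3 * g' $ 1 $ 1 + g $ 2 $ 3 * g' $ 2 $ 1 + g $ 3 $ 3 * g' $ 3 $ 1)"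
      by (rule bihomI) (auto intro!: poly_fun.intros simp: algebra_simps)
  qed (simp add: Com_entries algebra_simps)
  have r2: "g $ 3 $ 1 * g' $ 1 $ 1 + g $ 3 $ 2 * g' $ 1 $ 2 + g $ 3 $ 3 * g' $ 1 $ 3 = 0"
  proof (rule wonderful_relation[OF conjunct1[OF w], where d = 1 and e = 1])
    show "bihom 1 1 (\<lambda>g g'. g $ 3 $ 1 * g' $ 1 $ 1 + g $ 3 $ 2 * g' $ 1 $ 2 + g $ 3 $ 3 * g' $ 1 $ 3)"
      by (rule bihomI) (auto intro!: poly_fun.intros simp: algebra_simps)
  qed (simp add: Com_entries algebra_simps)
  define x where "x = (\<lambda>i j. g $ i $ j)"
  define y where "y = (\<lambda>i j. g' $ i $ j)"
  have xy: "g $ i $ j = x i j" "g' $ i $ j = y i j" for i j by (simp_all add: x_def y_def)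
  have xa: "x 3 3 = a" "y 1 1 = b" by (simp_all add: x_def y_def ab)
  have y13: "y 3 1 = - (x 1 3 * b + x 2 3 * y 2 1) / a" "y 1 3 = - (x 3 1 * b + x 3 2 * y 1 2) / a"
    using r1 r2 nz unfolding xy xa by (simp_all add: field_simps add_eq_0_iff)
  have y2: "y 2 2 = (s * a + y 1 2 * y 2 1) / b"
    using C'[of 3 3] nz unfolding Com_entries xy xa by (simp add: field_simps)
  have x2: "x 2 2 = (t * b + x 2 3 * x 3 2) / a" "x 2 1 = (x 2 3 * x 3 1 - t * y 1 2) / a"
    "x 1 2 = (x 1 3 * x 3 2 - t * y 2 1) / a" "x 1 1 = (t * y 2 2 + x 1 3 * x 3 1) / a"
    using C[of 1 1] C[of 1 2] C[of 2 1] C[of 2 2] nz unfolding Com_entries xy xa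
    by (simp_all add: field_simps)
  have y3: "y 3 2 = (y 1 2 * y 3 1 - s * x 2 3) / b" "y 2 3 = (y 1 3 * y 2 1 - s * x 3 2) / b"
    "y 3 3 = (s * x 2 2 + y 1 3 * y 3 1) / b"
    using C'[of 2 3] C'[of 3 2] C'[of 2 2] nz unfolding Com_entries xy xa
    by (simp_all add: field_simps)
  have co: "coords_of g g' = (s * a / b\<^sup>2, t * b / a\<^sup>2,
     vector [vector [0, - y 2 1 / b, x 1 3 / a], vector [- y 1 2 / b, 0, x 2 3 / a],
             vector [x 3 1 / a, x 3 2 / a, 0]])"
    unfolding coords_of_def C C' unfolding xy xa ..
  show "g = mscale (g $ 3 $ 3) (cell_mat (coords_of g g'))"
    unfolding vec_eq_iff forall_3 nth_map_matrix co cell_mat_entries vector_3 xy xa x2 y2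
    using nz by (intro conjI; simp add: field_simps power2_eq_square)
  show "g' = mscale (g' $ 1 $ 1) (cell_mat' (coords_of g g'))"
    unfolding vec_eq_iff forall_3 nth_map_matrix co cell_mat'_entries vector_3 xy xa y3 y2 y13 x2
    using nz by (intro conjI; simp add: field_simps power2_eq_square)
qed

lemma coords_of_fraction:
  fixes r :: "'k::field coords8 \<Rightarrow> 'k"
  assumes "r \<in> poly_alg coords"
  shows "\<exists>m n R. bihom m n R \<and> (\<forall>g g'. g $ 3 $ 3 \<noteq> 0 \<longrightarrow> g' $ 1 $ 1 \<noteq> 0 \<longrightarrow>
    r (coords_of g g') = R g g' / ((g $ 3 $ 3) ^ m * (g' $ 1 $ 1) ^ n))"
  using assms
proof induction
  case (gen c)
  then show ?case
  proof (cases rule: coords_cases)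
    case alpha1
    show ?thesis unfolding alpha1
      by (intro exI[where x = 0] exI[where x = 2] exI[where x = "\<lambda>g g'. Com g' $ 3 $ 3"] conjI bihom_Com_snd)
        (simp add: coords_of_def)
  next
    case alpha2
    show ?thesis unfolding alpha2
      by (rule exI[where x = 2], rule exI[where x = 0], rule exI[where x = "\<lambda>g g'. Com g $ 1 $ 1"])
        (simp add: coords_of_def bihom_Com_fst)
  next
    case (U i j)
    let ?C = "\<lambda>c m n R. bihom m n R \<and> (\<forall>g g' :: 'k mat3. g $ 3 $ 3 \<noteq> 0 \<longrightarrow> g' $ 1 $ 1 \<noteq> 0 \<longrightarrow>
      c (coords_of g g') = R g g' / ((g $ 3 $ 3) ^ m * (g' $ 1 $ 1) ^ n))"
    have z: "?C (\<lambda>v. (snd (snd v) :: 'k mat3) $ i $ i) 0 0 (\<lambda>g g'. 0)" for i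
      using coords_of_affine8 by (auto simp: affine8_def bihom_const case_prod_beta)
    have f: "?C (\<lambda>v. (snd (snd v) :: 'k mat3) $ i $ j) 1 0 (\<lambda>g g'. g $ i $ j)"
      if "(i, j) \<in> {(1, 3), (2, 3), (3, 1), (3, 2)}" for i j
      using that by (auto simp: bihom_fst coords_of_def vector_3 simp del: One_nat_def)
    have s: "?C (\<lambda>v. (snd (snd v) :: 'k mat3) $ i $ j) 0 1 (\<lambda>g g'. - 1 * g' $ j $ i)"
      if "(i, j) \<in> {(1, 2), (2, 1)}" for i j
      using that bihom_cmult[OF bihom_snd, of "- 1 :: 'k"] by (auto simp: coords_of_def vector_3 simp del: One_nat_def)
    let ?E = "\<lambda>i j. \<exists>m n R. ?C (\<lambda>v. (snd (snd v) :: 'k mat3) $ i $ j) m n R"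
    have z': "?E i i" for i using z by blast
    have f': "?E i j" if "(i, j) \<in> {(1, 3), (2, 3), (3, 1), (3, 2)}" for i j using f[OF that] by blast
    have s': "?E i j" if "(i, j) \<in> {(1, 2), (2, 1)}" for i j using s[OF that] by blast
    have "\<forall>i j. ?E i j"
      unfolding forall_3
      by (intro conjI z' f'[of 1 3] f'[of 2 3] f'[of 3 1] f'[of 3 2] s'[of 1 2] s'[of 2 1]; simp)
    then show ?thesis unfolding U by (elim allE)
  qed
next
  case (const c)
  show ?case by (rule exI[where x = 0], rule exI[where x = 0], rule exI[where x = "\<lambda>g g'. c"])
    (simp add: bihom_const)
next
  case (add p q)
  then obtain m n R m' n' S where R: "bihom m n R"
      "\<And>g g'. g $ 3 $ 3 \<noteq> 0 \<Longrightarrow> g' $ 1 $ 1 \<noteq> 0 \<Longrightarrow>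
        p (coords_of g g') = R g g' / ((g $ 3 $ 3) ^ m * (g' $ 1 $ 1) ^ n)"
    and S: "bihom m' n' S" "\<And>g g'. g $ 3 $ 3 \<noteq> 0 \<Longrightarrow> g' $ 1 $ 1 \<noteq> 0 \<Longrightarrow>
        q (coords_of g g') = S g g' / ((g $ 3 $ 3) ^ m' * (g' $ 1 $ 1) ^ n')"
    by blast
  have c: "bihom k l (\<lambda>g g' :: 'k mat3. g $ 3 $ 3 ^ k * g' $ 1 $ 1 ^ l)" for k l
    using bihom_mult[OF bihom_power[OF bihom_fst] bihom_power[OF bihom_snd]] by fastforce
  have "bihom (m + m') (n + n') (\<lambda>g g'. R g g' * (g $ 3 $ 3 ^ m' * g' $ 1 $ 1 ^ n'))"
    by (rule bihom_mult[OF R(1) c])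
  moreover have "bihom (m + m') (n + n') (\<lambda>g g'. S g g' * (g $ 3 $ 3 ^ m * g' $ 1 $ 1 ^ n))"
    using bihom_mult[OF S(1) c, of m n] by (simp add: add.commute)
  ultimately have b: "bihom (m + m') (n + n') (\<lambda>g g'. R g g' * (g $ 3 $ 3 ^ m' * g' $ 1 $ 1 ^ n')
      + S g g' * (g $ 3 $ 3 ^ m * g' $ 1 $ 1 ^ n))"
    by (rule bihom_add)
  show ?case
    by (intro exI conjI, rule b) (simp add: R(2) S(2) power_add field_simps)
next
  case (mult p q)
  then obtain m n R m' n' S where R: "bihom m n R"
      "\<And>g g'. g $ 3 $ 3 \<noteq> 0 \<Longrightarrow> g' $ 1 $ 1 \<noteq> 0 \<Longrightarrow>
        p (coords_of g g') = R g g' / ((g $ 3 $ 3) ^ m * (g' $ 1 $ 1) ^ n)"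
    and S: "bihom m' n' S" "\<And>g g'. g $ 3 $ 3 \<noteq> 0 \<Longrightarrow> g' $ 1 $ 1 \<noteq> 0 \<Longrightarrow>
        q (coords_of g g') = S g g' / ((g $ 3 $ 3) ^ m' * (g' $ 1 $ 1) ^ n')"
    by blast
  show ?case
    by (intro exI conjI, rule bihom_mult[OF R(1) S(1)]) (simp add: R(2) S(2) power_add field_simps)
qed


section \<open>Translated charts\<close>

lemma inverse_mat:
  fixes A :: "'k::field mat3"
  assumes "det A \<noteq> 0"
  obtains A1 where "A ** A1 = mat 1" "A1 ** A = mat 1" "det A1 \<noteq> 0"
    "Com A ** Com A1 = mat 1" "Com A1 ** Com A = mat 1"
proof -
  have "invertible A" using assms by (simp add: invertible_det_nz)
  then obtain A1 where A1: "A ** A1 = mat 1" "A1 ** A = mat 1" unfolding invertible_def by blast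
  have "det (A ** A1) \<noteq> 0" by (simp add: A1)
  then have "det A1 \<noteq> 0" by (simp add: det_mul)
  moreover have "Com A ** Com A1 = mat 1" "Com A1 ** Com A = mat 1"
    unfolding Com_mult[symmetric] A1 Com_mat_1 by simp_all
  ultimately show ?thesis by (rule that[OF A1])
qed

lemma mult_inverse:
  fixes A :: "'k::field mat3"
  assumes "A1 ** A = mat 1" "B ** B1 = mat 1"
  shows "A1 ** (A ** g ** B) ** B1 = g"
proof -
  have "A1 ** (A ** g ** B) ** B1 = (A1 ** A) ** g ** (B ** B1)"
    by (simp add: matrix_mul_assoc)
  then show ?thesis by (simp add: assms)
qed

lemma translate_nonzero:
  fixes A :: "'k::field mat3"
  assumes "A1 ** A = mat 1" "B ** B1 = mat 1" "g \<noteq> 0"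
  shows "A ** g ** B \<noteq> 0"
proof
  assume z: "A ** g ** B = 0"
  have "g = A1 ** (A ** g ** B) ** B1" using mult_inverse[OF assms(1,2)] by simp
  also have "\<dots> = 0" unfolding z by (simp add: vec_eq_iff mult_entry)
  finally show False using assms(3) by simp
qed

lemma bihom_translate:
  assumes "bihom d e P"
  shows "bihom d e (\<lambda>g g'. P (A ** g ** B) (C ** g' ** D))"
proof (rule bihomI)
  show "poly_fun (\<lambda>g g'. P (A ** g ** B) (C ** g' ** D))"
    by (rule poly_fun_sub[OF bihomD(1)[OF assms]])
      (unfold mult_entry, (intro poly_fun.intros)+)
qed (simp add: mscale_mult bihomD(2)[OF assms])

text \<open>The closure is stable under the action of pairs of invertible matrices on both sides, since \<open>Com\<close>
  is multiplicative.\<close>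

lemma wonderful_translate:
  fixes A B g g' :: "'k::field mat3"
  assumes "det A \<noteq> 0" "det B \<noteq> 0" "point g g' \<in> wonderful"
  shows "point (A ** g ** B) (Com A ** g' ** Com B) \<in> wonderful"
proof -
  obtain A1 where A1: "A1 ** A = mat 1" "Com A1 ** Com A = mat 1" using inverse_mat[OF assms(1)] by metis
  obtain B1 where B1: "B ** B1 = mat 1" "Com B ** Com B1 = mat 1" using inverse_mat[OF assms(2)] by metis
  have nz: "g \<noteq> 0" "g' \<noteq> 0" using assms(3) by (simp_all add: wonderful_iff)
  have "\<exists>h. det h \<noteq> 0 \<and> P h (Com h) \<noteq> 0"
    if P: "bihom d e P" "P (A ** g ** B) (Com A ** g' ** Com B) \<noteq> 0" for d e P
  proof -
    obtain h where h: "det h \<noteq> 0" "P (A ** h ** B) (Com A ** Com h ** Com B) \<noteq> 0"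
      using assms(3)[unfolded wonderful_iff] bihom_translate[OF P(1), of A B "Com A" "Com B"] P(2) by blast
    then have "det (A ** h ** B) \<noteq> 0" "P (A ** h ** B) (Com (A ** h ** B)) \<noteq> 0"
      using assms(1,2) by (simp_all add: det_mul Com_mult)
    then show ?thesis by blast
  qed
  then show ?thesis unfolding wonderful_iff
    using translate_nonzero[OF A1(1) B1(1) nz(1)] translate_nonzero[OF A1(2) B1(2) nz(2)] by blast
qed

lemma cell_nonzero: "cell_mat v \<noteq> 0" "cell_mat' v \<noteq> 0"
proof -
  obtain a1 a2 U where v: "v = (a1, a2, U)" by (cases v)
  have "cell_mat v $ 3 $ 3 \<noteq> 0" "cell_mat' v $ 1 $ 1 \<noteq> 0"
    by (simp_all add: v cell_mat_entries cell_mat'_entries)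
  then show "cell_mat v \<noteq> 0" "cell_mat' v \<noteq> 0" by auto
qed

text \<open>The points of the cell with \<open>\<alpha>\<^sub>1 \<alpha>\<^sub>2 \<noteq> 0\<close> lie in the group, and they are dense in the cell.\<close>

lemma cell_wonderful:
  fixes v :: "'k::field_char_0 coords8"
  assumes "v \<in> affine8"
  shows "cell_point v \<in> wonderful"
proof -
  have "\<exists>h. det h \<noteq> 0 \<and> P h (Com h) \<noteq> 0"
    if P: "bihom d e P" "P (cell_mat v) (cell_mat' v) \<noteq> 0" for d e P
  proof -
    have "(\<lambda>v. P (cell_mat v) (cell_mat' v)) \<in> poly_alg coords"
      by (intro poly_fun_alg[OF bihomD(1)[OF P(1)]] cell_mat_alg)
    moreover have "(\<lambda>v :: 'k coords8. fst v * fst (snd v)) \<in> poly_alg coords"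
      by (intro poly_alg_intros coords_in)
    ultimately obtain x where x: "P (cell_mat x) (cell_mat' x) \<noteq> 0" "fst x * fst (snd x) \<noteq> 0"
      using common_nonzero_coords[of "\<lambda>v. P (cell_mat v) (cell_mat' v)" "\<lambda>v. fst v * fst (snd v)" v "(1, 1, 0)"]
        P(2) assms by (auto simp: affine8_def)
    have "P (cell_mat x) (Com (cell_mat x)) = fst (snd x) ^ e * P (cell_mat x) (cell_mat' x)"
      using bihomD(2)[OF P(1), of 1 "cell_mat x" "fst (snd x)" "cell_mat' x"] by (simp add: Com_cell_mat)
    then have "P (cell_mat x) (Com (cell_mat x)) \<noteq> 0" using x by simp
    moreover have "det (cell_mat x) \<noteq> 0" using x by (simp add: det_cell_mat)
    ultimately show ?thesis by blast
  qed
  then show ?thesis unfolding cell_point_eq wonderful_iff using cell_nonzero by blast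
qed

lemma point_mscale:
  "s \<noteq> 0 \<Longrightarrow> t \<noteq> 0 \<Longrightarrow> point (mscale s g) (mscale t g') = point g g'"
  by (simp add: proj_class_mscale)

lemma big_cell_cell_point:
  assumes "point g g' \<in> big_cell"
  shows "point g g' = cell_point (coords_of g g')"
proof -
  have nz: "g $ 3 $ 3 \<noteq> 0" "g' $ 1 $ 1 \<noteq> 0" using assms by (simp_all add: big_cell_iff)
  have "point g g' = point (mscale (g $ 3 $ 3) (cell_mat (coords_of g g')))
      (mscale (g' $ 1 $ 1) (cell_mat' (coords_of g g')))"
    using cell_coords_of[OF assms] by simp
  also have "\<dots> = cell_point (coords_of g g')" unfolding cell_point_eq by (rule point_mscale[OF nz])
  finally show ?thesis .
qed

lemma big_cell_cases:
  assumes "x \<in> big_cell"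
  obtains v where "v \<in> affine8" "x = cell_point v"
proof -
  have "x \<in> wonderful" using assms big_cell_subset by blast
  then obtain g g' where "x = point g g'" by (rule wonderful_cases)
  then show ?thesis using that big_cell_cell_point assms coords_of_affine8 by metis
qed

lemma inj_cell_point: "inj_on cell_point affine8"
proof (rule inj_onI)
  fix v w :: "'a coords8" assume vw: "v \<in> affine8" "w \<in> affine8" "cell_point v = cell_point w"
  then obtain s t where "s \<noteq> 0" "t \<noteq> 0" "cell_mat v = mscale s (cell_mat w)" "cell_mat' v = mscale t (cell_mat' w)"
    unfolding cell_point_eq by (auto simp: proj_class_eq_iff)
  then have "coords_of (cell_mat v) (cell_mat' v) = coords_of (cell_mat w) (cell_mat' w)"
    by (simp add: coords_of_mscale)
  then show "v = w" using coords_of_cell vw by metis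
qed

lemma cell_coords_cell_point: "v \<in> affine8 \<Longrightarrow> cell_coords (cell_point v) = v"
  unfolding cell_coords_def by (rule inv_into_f_f[OF inj_cell_point])

definition chart :: "'k::field mat3 \<Rightarrow> 'k mat3 \<Rightarrow> 'k coords8 \<Rightarrow> 'k proj2" where
  "chart A B v = point (A ** cell_mat v ** B) (Com A ** cell_mat' v ** Com B)"

lemma chart_1: "chart (mat 1) (mat 1) = cell_point"
  by (simp add: fun_eq_iff chart_def cell_point_eq Com_mat_1)

lemma chart_wonderful:
  fixes v :: "'k::field_char_0 coords8"
  assumes "det A \<noteq> 0" "det B \<noteq> 0" "v \<in> affine8"
  shows "chart A B v \<in> wonderful"
  using wonderful_translate[OF assms(1,2)] cell_wonderful[OF assms(3)]
  unfolding cell_point_eq chart_def by blast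

text \<open>A fraction of polynomials in the coordinates of a chart is a bihomogeneous fraction, whose
  denominator can be chosen to vanish outside the chart.\<close>

lemma chart_fraction:
  fixes r s :: "'k::field_char_0 coords8 \<Rightarrow> 'k"
  assumes A: "det A \<noteq> 0" and B: "det B \<noteq> 0" and rs: "r \<in> poly_alg coords" "s \<in> poly_alg coords"
    and v: "v \<in> affine8" "s v \<noteq> 0" "chart A B v = point k k'"
  shows "\<exists>P Q d e. bihom d e P \<and> bihom d e Q \<and> Q k k' \<noteq> 0 \<and>
    (\<forall>g g'. point g g' \<in> wonderful \<longrightarrow> Q g g' \<noteq> 0 \<longrightarrow>
      (\<exists>w\<in>affine8. s w \<noteq> 0 \<and> point g g' = chart A B w \<and> P g g' / Q g g' = r w / s w))"
proof -
  obtain A1 where A1: "A ** A1 = mat 1" "A1 ** A = mat 1" "det A1 \<noteq> 0"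
    "Com A ** Com A1 = mat 1" "Com A1 ** Com A = mat 1" using inverse_mat[OF A] by metis
  obtain B1 where B1: "B ** B1 = mat 1" "B1 ** B = mat 1" "det B1 \<noteq> 0"
    "Com B ** Com B1 = mat 1" "Com B1 ** Com B = mat 1" using inverse_mat[OF B] by metis
  obtain m n R where R: "bihom m n R" "\<And>g g'. g $ 3 $ 3 \<noteq> 0 \<Longrightarrow> g' $ 1 $ 1 \<noteq> 0 \<Longrightarrow>
    r (coords_of g g') = R g g' / ((g $ 3 $ 3) ^ m * (g' $ 1 $ 1) ^ n)"
    using coords_of_fraction[OF rs(1)] by blast
  obtain m' n' S where S: "bihom m' n' S" "\<And>g g'. g $ 3 $ 3 \<noteq> 0 \<Longrightarrow> g' $ 1 $ 1 \<noteq> 0 \<Longrightarrow>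
    s (coords_of g g') = S g g' / ((g $ 3 $ 3) ^ m' * (g' $ 1 $ 1) ^ n')"
    using coords_of_fraction[OF rs(2)] by blast
  have c: "bihom k l (\<lambda>g g' :: 'k mat3. g $ 3 $ 3 ^ k * g' $ 1 $ 1 ^ l)" for k l
    using bihom_mult[OF bihom_power[OF bihom_fst] bihom_power[OF bihom_snd]] by fastforce
  \<comment> \<open>The surplus factor in the exponents \<open>Suc\<close> makes the denominator vanish outside the chart.\<close>
  define P0 where "P0 = (\<lambda>g g'. R g g' * (g $ 3 $ 3 ^ Suc m' * g' $ 1 $ 1 ^ Suc n'))"
  define Q0 where "Q0 = (\<lambda>g g'. S g g' * (g $ 3 $ 3 ^ Suc m * g' $ 1 $ 1 ^ Suc n))"
  have b0: "bihom (Suc (m + m')) (Suc (n + n')) P0" "bihom (Suc (m + m')) (Suc (n + n')) Q0"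
    using bihom_mult[OF R(1) c, of "Suc m'" "Suc n'"] bihom_mult[OF S(1) c, of "Suc m" "Suc n"]
    by (simp_all add: P0_def Q0_def add.commute)
  define P where "P = (\<lambda>g g'. P0 (A1 ** g ** B1) (Com A1 ** g' ** Com B1))"
  define Q where "Q = (\<lambda>g g'. Q0 (A1 ** g ** B1) (Com A1 ** g' ** Com B1))"
  have b: "bihom (Suc (m + m')) (Suc (n + n')) P" "bihom (Suc (m + m')) (Suc (n + n')) Q"
    unfolding P_def Q_def by (intro bihom_translate b0)+
  have "Q k k' \<noteq> 0"
  proof -
    obtain a b where ab: "a \<noteq> 0" "b \<noteq> 0" "k = mscale a (A ** cell_mat v ** B)" "k' = mscale b (Com A ** cell_mat' v ** Com B)"
      using v(3)[symmetric] by (auto simp: chart_def proj_class_eq_iff)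
    have "Q (A ** cell_mat v ** B) (Com A ** cell_mat' v ** Com B) = Q0 (cell_mat v) (cell_mat' v)"
      unfolding Q_def mult_inverse[OF A1(2) B1(1)] mult_inverse[OF A1(5) B1(4)] ..
    moreover have "cell_mat v $ 3 $ 3 = 1" "cell_mat' v $ 1 $ 1 = 1"
      by (cases v; simp add: cell_mat_entries cell_mat'_entries)+
    then have "Q0 (cell_mat v) (cell_mat' v) = s v"
      using S(2)[of "cell_mat v" "cell_mat' v"] by (simp add: Q0_def coords_of_cell[OF v(1)])
    ultimately show ?thesis using bihomD(2)[OF b(2)] ab v(2) by simp
  qed
  moreover have "\<exists>w\<in>affine8. s w \<noteq> 0 \<and> point g g' = chart A B w \<and> P g g' / Q g g' = r w / s w"
    if g: "point g g' \<in> wonderful" "Q g g' \<noteq> 0" for g g'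
  proof -
    define h h' where "h = A1 ** g ** B1" "h' = Com A1 ** g' ** Com B1"
    note h = this
    have Q0: "Q0 h h' \<noteq> 0" using g(2) by (simp add: Q_def h)
    then have nz: "h $ 3 $ 3 \<noteq> 0" "h' $ 1 $ 1 \<noteq> 0" "S h h' \<noteq> 0" by (simp_all add: Q0_def)
    have "point h h' \<in> wonderful" unfolding h by (rule wonderful_translate[OF A1(3) B1(3) g(1)])
    then have hc: "point h h' \<in> big_cell" using nz by (simp add: big_cell_iff)
    define w where "w = coords_of h h'"
    have e: "h = mscale (h $ 3 $ 3) (cell_mat w)" "h' = mscale (h' $ 1 $ 1) (cell_mat' w)"
      using cell_coords_of[OF hc] unfolding w_def .
    have "g = A ** h ** B" "g' = Com A ** h' ** Com B"
      unfolding h mult_inverse[OF A1(1) B1(2)] mult_inverse[OF A1(4) B1(5)] by simp_all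
    then have "g = mscale (h $ 3 $ 3) (A ** cell_mat w ** B)"
      "g' = mscale (h' $ 1 $ 1) (Com A ** cell_mat' w ** Com B)"
      using e by (metis mscale_mult)+
    then have "point g g' = chart A B w"
      unfolding chart_def using point_mscale[OF nz(1,2)] by metis
    moreover have "r w = R h h' / ((h $ 3 $ 3) ^ m * (h' $ 1 $ 1) ^ n)"
      "s w = S h h' / ((h $ 3 $ 3) ^ m' * (h' $ 1 $ 1) ^ n')"
      unfolding w_def using R(2) S(2) nz by simp_all
    moreover have "P g g' = P0 h h'" "Q g g' = Q0 h h'" by (simp_all add: P_def Q_def h)
    ultimately show ?thesis using nz
      by (intro bexI[of _ w]) (simp_all add: P0_def Q0_def w_def coords_of_affine8)
  qed
  ultimately show ?thesis using b by blast
qed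


section \<open>Regular functions and derivations on the big cell\<close>

definition cell_fraction ::
    "'k::field proj2 set \<Rightarrow> ('k proj2 \<Rightarrow> 'k) \<Rightarrow> ('k coords8 \<Rightarrow> 'k) \<Rightarrow> ('k coords8 \<Rightarrow> 'k) \<Rightarrow> bool" where
  "cell_fraction V f r s \<longleftrightarrow> r \<in> poly_alg coords \<and> s \<in> poly_alg coords \<and>
     (\<forall>v\<in>affine8. s v \<noteq> 0 \<longrightarrow> cell_point v \<in> V \<and> f (cell_point v) = r v / s v)"

lemma regular_cell_iff:
  fixes f :: "'k::field_char_0 proj2 \<Rightarrow> 'k"
  assumes V: "zopen V" "V \<subseteq> big_cell"
  shows "f \<in> regular V \<longleftrightarrow> (\<forall>x. x \<notin> V \<longrightarrow> f x = 0) \<and>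
    (\<forall>v\<in>affine8. cell_point v \<in> V \<longrightarrow> (\<exists>r s. cell_fraction V f r s \<and> s v \<noteq> 0))"
proof
  assume f: "f \<in> regular V"
  have "\<exists>r s. cell_fraction V f r s \<and> s v \<noteq> 0" if v: "v \<in> affine8" "cell_point v \<in> V" for v
  proof -
    obtain P Q where PQ: "is_fraction V f P Q" "Q (cell_mat v) (cell_mat' v) \<noteq> 0"
      using regularD(2)[OF f V(1)] v(2) unfolding cell_point_eq by blast
    then obtain d e where b: "bihom d e P" "bihom d e Q" by (auto simp: is_fraction_def)
    have "cell_fraction V f (\<lambda>v. P (cell_mat v) (cell_mat' v)) (\<lambda>v. Q (cell_mat v) (cell_mat' v))"
      unfolding cell_fraction_def
    proof (intro conjI ballI impI)
      show "(\<lambda>v. P (cell_mat v) (cell_mat' v)) \<in> poly_alg coords"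
        "(\<lambda>v. Q (cell_mat v) (cell_mat' v)) \<in> poly_alg coords"
        by (intro poly_fun_alg[OF bihomD(1)[OF b(1)]] poly_fun_alg[OF bihomD(1)[OF b(2)]] cell_mat_alg)+
      fix w :: "'k coords8" assume w: "w \<in> affine8" "Q (cell_mat w) (cell_mat' w) \<noteq> 0"
      show "cell_point w \<in> V" "f (cell_point w) = P (cell_mat w) (cell_mat' w) / Q (cell_mat w) (cell_mat' w)"
        using is_fractionD[OF PQ(1) _ w(2)] cell_wonderful[OF w(1)] unfolding cell_point_eq by blast+
    qed
    then show ?thesis using PQ(2) by (intro exI conjI)
  qed
  then show "(\<forall>x. x \<notin> V \<longrightarrow> f x = 0) \<and>
    (\<forall>v\<in>affine8. cell_point v \<in> V \<longrightarrow> (\<exists>r s. cell_fraction V f r s \<and> s v \<noteq> 0))"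
    using regularD(1)[OF f V(1)] by blast
next
  assume R: "(\<forall>x. x \<notin> V \<longrightarrow> f x = 0) \<and>
    (\<forall>v\<in>affine8. cell_point v \<in> V \<longrightarrow> (\<exists>r s. cell_fraction V f r s \<and> s v \<noteq> 0))"
  have "\<exists>P Q. is_fraction V f P Q \<and> Q g g' \<noteq> 0" if g: "point g g' \<in> V" for g g'
  proof -
    obtain v where v: "v \<in> affine8" "point g g' = cell_point v" using V(2) g by (blast elim: big_cell_cases)
    then obtain r s where rs: "cell_fraction V f r s" "s v \<noteq> 0" using R g by auto
    then have "r \<in> poly_alg coords" "s \<in> poly_alg coords" by (auto simp: cell_fraction_def)
    from chart_fraction[OF _ _ this v(1) rs(2), of "mat 1" "mat 1" g g'] v(2)
    obtain P Q d e where PQ: "bihom d e P" "bihom d e Q" "Q g g' \<noteq> 0"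
      and w: "\<And>h h'. point h h' \<in> wonderful \<Longrightarrow> Q h h' \<noteq> 0 \<Longrightarrow>
        \<exists>w\<in>affine8. s w \<noteq> 0 \<and> point h h' = cell_point w \<and> P h h' / Q h h' = r w / s w"
      unfolding chart_1 by auto
    have "is_fraction V f P Q" unfolding is_fraction_def
    proof (intro conjI allI impI)
      show "\<exists>d e. bihom d e P \<and> bihom d e Q" using PQ by blast
      fix h h' assume "point h h' \<in> wonderful" "Q h h' \<noteq> 0"
      then obtain w where w: "w \<in> affine8" "s w \<noteq> 0" "point h h' = cell_point w" "P h h' / Q h h' = r w / s w"
        using w by blast
      then show "point h h' \<in> V" "f (point h h') = P h h' / Q h h'"
        using rs(1) unfolding cell_fraction_def by auto
    qed
    then show ?thesis using PQ(3) by blast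
  qed
  then show "f \<in> regular V" unfolding regular_iff[OF V(1)] using R by blast
qed


section \<open>Operations on regular functions\<close>

lemma is_fraction_bihom:
  assumes "is_fraction V f P Q"
  obtains d e where "bihom d e P" "bihom d e Q"
  using assms by (auto simp: is_fraction_def)

lemma is_fraction_add:
  assumes "is_fraction V f P Q" "is_fraction V h R S"
  shows "is_fraction V (\<lambda>x. f x + h x) (\<lambda>g g'. P g g' * S g g' + Q g g' * R g g') (\<lambda>g g'. Q g g' * S g g')"
proof -
  obtain d e where b: "bihom d e P" "bihom d e Q" using is_fraction_bihom[OF assms(1)] .
  obtain d' e' where b': "bihom d' e' R" "bihom d' e' S" using is_fraction_bihom[OF assms(2)] .
  have "bihom (d + d') (e + e') (\<lambda>g g'. P g g' * S g g' + Q g g' * R g g')"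
    "bihom (d + d') (e + e') (\<lambda>g g'. Q g g' * S g g')"
    by (intro bihom_add bihom_mult b b')+
  then show ?thesis unfolding is_fraction_def
    using is_fractionD[OF assms(1)] is_fractionD[OF assms(2)] by (auto simp: field_simps)
qed

lemma is_fraction_mult:
  assumes "is_fraction V f P Q" "is_fraction V h R S"
  shows "is_fraction V (\<lambda>x. f x * h x) (\<lambda>g g'. P g g' * R g g') (\<lambda>g g'. Q g g' * S g g')"
proof -
  obtain d e where b: "bihom d e P" "bihom d e Q" using is_fraction_bihom[OF assms(1)] .
  obtain d' e' where b': "bihom d' e' R" "bihom d' e' S" using is_fraction_bihom[OF assms(2)] .
  have "bihom (d + d') (e + e') (\<lambda>g g'. P g g' * R g g')"
    "bihom (d + d') (e + e') (\<lambda>g g'. Q g g' * S g g')"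
    by (intro bihom_mult b b')+
  then show ?thesis unfolding is_fraction_def
    using is_fractionD[OF assms(1)] is_fractionD[OF assms(2)] by auto
qed

lemma is_fraction_cmult:
  assumes "is_fraction V f P Q"
  shows "is_fraction V (\<lambda>x. c * f x) (\<lambda>g g'. c * P g g') Q"
proof -
  obtain d e where b: "bihom d e P" "bihom d e Q" using is_fraction_bihom[OF assms] .
  then show ?thesis unfolding is_fraction_def
    using is_fractionD[OF assms] bihom_cmult[OF b(1), of c] by auto
qed

lemma regular_add:
  assumes "zopen V" "f \<in> regular V" "h \<in> regular V"
  shows "(\<lambda>x. f x + h x) \<in> regular V"
  unfolding regular_iff[OF assms(1)]
proof (intro conjI allI impI)
  fix g g' assume "point g g' \<in> V"
  then obtain P Q R S where *: "is_fraction V f P Q" "Q g g' \<noteq> 0" "is_fraction V h R S" "S g g' \<noteq> 0"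
    using regularD(2)[OF assms(2,1)] regularD(2)[OF assms(3,1)] by meson
  have "Q g g' * S g g' \<noteq> 0" using * by simp
  with is_fraction_add[OF *(1,3)]
  show "\<exists>P Q. is_fraction V (\<lambda>x. f x + h x) P Q \<and> Q g g' \<noteq> 0" by (intro exI conjI)
qed (use regularD(1)[OF assms(2,1)] regularD(1)[OF assms(3,1)] in simp)

lemma regular_mult:
  assumes "zopen V" "f \<in> regular V" "h \<in> regular V"
  shows "(\<lambda>x. f x * h x) \<in> regular V"
  unfolding regular_iff[OF assms(1)]
proof (intro conjI allI impI)
  fix g g' assume "point g g' \<in> V"
  then obtain P Q R S where *: "is_fraction V f P Q" "Q g g' \<noteq> 0" "is_fraction V h R S" "S g g' \<noteq> 0"
    using regularD(2)[OF assms(2,1)] regularD(2)[OF assms(3,1)] by meson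
  have "Q g g' * S g g' \<noteq> 0" using * by simp
  with is_fraction_mult[OF *(1,3)]
  show "\<exists>P Q. is_fraction V (\<lambda>x. f x * h x) P Q \<and> Q g g' \<noteq> 0" by (intro exI conjI)
qed (use regularD(1)[OF assms(2,1)] in simp)

lemma regular_cmult:
  assumes "zopen V" "f \<in> regular V"
  shows "(\<lambda>x. c * f x) \<in> regular V"
  unfolding regular_iff[OF assms(1)]
  using regularD(1)[OF assms(2,1)] regularD(2)[OF assms(2,1)] is_fraction_cmult by fastforce

lemma regular_restr:
  assumes "zopen V" "zopen W" "W \<subseteq> V" "f \<in> regular V"
  shows "restr W f \<in> regular W"
  unfolding regular_iff[OF assms(2)]
proof (intro conjI allI impI)
  fix g g' assume g: "point g g' \<in> W"
  then obtain P Q where PQ: "is_fraction V f P Q" "Q g g' \<noteq> 0"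
    using regularD(2)[OF assms(4,1)] assms(3) by blast
  obtain d e B where B: "bihom d e B" "B g g' \<noteq> 0"
      "\<And>h h'. point h h' \<in> wonderful \<Longrightarrow> B h h' \<noteq> 0 \<Longrightarrow> point h h' \<in> W"
    by (rule zopenE[OF assms(2) g]) (rule that)
  obtain d' e' where b: "bihom d' e' P" "bihom d' e' Q" using is_fraction_bihom[OF PQ(1)] .
  have "is_fraction W (restr W f) (\<lambda>g g'. P g g' * B g g') (\<lambda>g g'. Q g g' * B g g')"
    unfolding is_fraction_def
    using bihom_mult[OF b(1) B(1)] bihom_mult[OF b(2) B(1)] B(3) is_fractionD[OF PQ(1)]
    by (auto simp: restr_def)
  moreover have "Q g g' * B g g' \<noteq> 0" using PQ B by simp
  ultimately show "\<exists>P Q. is_fraction W (restr W f) P Q \<and> Q g g' \<noteq> 0" by (intro exI conjI)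
qed (simp add: restr_def)


section \<open>The coordinate derivations of the big cell\<close>

text \<open>The truth value selects the coordinate: \<open>\<alpha>\<^sub>1\<close> if true, \<open>\<alpha>\<^sub>2\<close> if false. Both derivations are treated
  at once.\<close>

definition upd :: "bool \<Rightarrow> 'k coords8 \<Rightarrow> 'k \<Rightarrow> 'k coords8" where
  "upd b v t = (if b then (t, snd v) else (fst v, t, snd (snd v)))"

definition sel :: "bool \<Rightarrow> 'k coords8 \<Rightarrow> 'k" where
  "sel b v = (if b then fst v else fst (snd v))"

definition cell_deriv :: "bool \<Rightarrow> 'k::field sheaf_op" where
  "cell_deriv b V f = restr V (\<lambda>x.
     rat_deriv (\<lambda>t. f (cell_point (upd b (cell_coords x) t))) (sel b (cell_coords x)))"

lemma d_alpha_cell_deriv: "d_alpha1 = cell_deriv True" "d_alpha2 = cell_deriv False"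
  by (simp_all add: fun_eq_iff d_alpha1_def d_alpha2_def cell_deriv_def upd_def sel_def case_prod_beta)

lemma upd_sel [simp]: "upd b v (sel b v) = v"
  by (simp add: upd_def sel_def)

lemma upd_affine8: "v \<in> affine8 \<Longrightarrow> upd b v t \<in> affine8"
  by (auto simp: upd_def affine8_def)

lemma upd_partial:
  assumes "r \<in> poly_alg coords"
  shows "\<exists>r'\<in>poly_alg coords. \<forall>v. has_rat_deriv (\<lambda>t. r (upd b v t)) (sel b v) (r' v)"
proof -
  obtain r1 r2 where r: "r1 \<in> poly_alg coords" "r2 \<in> poly_alg coords"
    "\<And>a1 a2 U. has_rat_deriv (\<lambda>t. r (t, a2, U)) a1 (r1 (a1, a2, U))"
    "\<And>a1 a2 U. has_rat_deriv (\<lambda>t. r (a1, t, U)) a2 (r2 (a1, a2, U))"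
    using partial_coords[OF assms] by blast
  show ?thesis
  proof (cases b)
    case True
    then show ?thesis using r(1) r(3)[of "fst (snd v)" "snd (snd v)" "fst v" for v]
      by (intro bexI[of _ r1]) (simp_all add: upd_def sel_def)
  next
    case False
    then show ?thesis using r(2) r(4)[of "fst v" "snd (snd v)" "fst (snd v)" for v]
      by (intro bexI[of _ r2]) (simp_all add: upd_def sel_def)
  qed
qed

lemma upd_curve:
  assumes "s \<in> poly_alg coords"
  shows "\<exists>u. \<forall>t. s (upd b v t) = poly u t"
proof (rule poly_alg_curve[OF assms])
  have l: "\<exists>u. \<forall>t. (t :: 'a) = poly u t" by (rule exI[of _ "[:0, 1:]"]) simp
  have k: "\<exists>u. \<forall>t :: 'a. c = poly u t" for c by (rule exI[of _ "[:c:]"]) simp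
  show "\<exists>u. \<forall>t. c (upd b v t) = poly u t" if "c \<in> coords" for c
    using that by (cases rule: coords_cases; cases b) (simp_all add: upd_def l k)
qed

lemma cell_fraction_deriv:
  assumes "cell_fraction V f r s"
  shows "\<exists>r'\<in>poly_alg coords. \<forall>v\<in>affine8. s v \<noteq> 0 \<longrightarrow>
    has_rat_deriv (\<lambda>t. f (cell_point (upd b v t))) (sel b v) (r' v / (s v)\<^sup>2)"
proof -
  have rs: "r \<in> poly_alg coords" "s \<in> poly_alg coords"
    and f: "\<And>v. v \<in> affine8 \<Longrightarrow> s v \<noteq> 0 \<Longrightarrow> f (cell_point v) = r v / s v"
    using assms by (auto simp: cell_fraction_def)
  obtain rd where rd: "rd \<in> poly_alg coords" "\<And>v. has_rat_deriv (\<lambda>t. r (upd b v t)) (sel b v) (rd v)"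
    using upd_partial[OF rs(1)] by blast
  obtain sd where sd: "sd \<in> poly_alg coords" "\<And>v. has_rat_deriv (\<lambda>t. s (upd b v t)) (sel b v) (sd v)"
    using upd_partial[OF rs(2)] by blast
  show ?thesis
  proof (intro bexI[of _ "\<lambda>v. rd v * s v - r v * sd v"] ballI impI)
    fix v :: "'a coords8" assume v: "v \<in> affine8" "s v \<noteq> 0"
    obtain u where u: "\<And>t. s (upd b v t) = poly u t" using upd_curve[OF rs(2)] by blast
    have "has_rat_deriv (\<lambda>t. r (upd b v t) / s (upd b v t)) (sel b v) ((rd v * s v - r v * sd v) / (s v)\<^sup>2)"
      using has_rat_deriv_divide[OF rd(2) sd(2)] v(2) by simp
    then show "has_rat_deriv (\<lambda>t. f (cell_point (upd b v t))) (sel b v) ((rd v * s v - r v * sd v) / (s v)\<^sup>2)"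
    proof (rule has_rat_deriv_local)
      show "poly u (sel b v) \<noteq> 0" using u[of "sel b v"] v(2) by simp
      show "f (cell_point (upd b v t)) = r (upd b v t) / s (upd b v t)" if "poly u t \<noteq> 0" for t
        using f[OF upd_affine8[OF v(1)]] that u by simp
    qed
  qed (intro poly_alg_intros rs rd sd)
qed

lemma cell_deriv_eq:
  fixes f :: "'k::field_char_0 proj2 \<Rightarrow> 'k"
  assumes "v \<in> affine8" "cell_point v \<in> V"
    "has_rat_deriv (\<lambda>t. f (cell_point (upd b v t))) (sel b v) d"
  shows "cell_deriv b V f (cell_point v) = d"
  using assms(2) rat_deriv_eq[OF assms(3)]
  by (simp add: cell_deriv_def restr_def cell_coords_cell_point[OF assms(1)])

context
  fixes V :: "'k::field_char_0 proj2 set"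
  assumes V: "zopen V" "V \<subseteq> big_cell"
begin

lemma cell_deriv_outside: "x \<notin> V \<Longrightarrow> cell_deriv b V f x = 0"
  by (simp add: cell_deriv_def restr_def)

lemma has_cell_deriv:
  assumes "f \<in> regular V" "v \<in> affine8" "cell_point v \<in> V"
  shows "has_rat_deriv (\<lambda>t. f (cell_point (upd b v t))) (sel b v) (cell_deriv b V f (cell_point v))"
proof -
  obtain r s where "cell_fraction V f r s" "s v \<noteq> 0"
    using assms unfolding regular_cell_iff[OF V] by blast
  then obtain d where "has_rat_deriv (\<lambda>t. f (cell_point (upd b v t))) (sel b v) d"
    using cell_fraction_deriv assms(2) by blast
  then show ?thesis using cell_deriv_eq[OF assms(2,3)] by simp
qed

lemma cell_deriv_regular:
  assumes "f \<in> regular V"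
  shows "cell_deriv b V f \<in> regular V"
  unfolding regular_cell_iff[OF V]
proof (intro conjI allI impI ballI)
  fix v :: "'k coords8" assume v: "v \<in> affine8" "cell_point v \<in> V"
  then obtain r s where rs: "cell_fraction V f r s" "s v \<noteq> 0"
    using assms unfolding regular_cell_iff[OF V] by blast
  obtain r' where r': "r' \<in> poly_alg coords" "\<And>v. v \<in> affine8 \<Longrightarrow> s v \<noteq> 0 \<Longrightarrow>
    has_rat_deriv (\<lambda>t. f (cell_point (upd b v t))) (sel b v) (r' v / (s v)\<^sup>2)"
    using cell_fraction_deriv[OF rs(1)] by blast
  have "cell_fraction V (cell_deriv b V f) r' (\<lambda>v. (s v)\<^sup>2)"
    using rs(1) cell_deriv_eq[OF _ _ r'(2)] r'(1) unfolding cell_fraction_def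
    by (auto intro: poly_alg_power)
  then show "\<exists>r s. cell_fraction V (cell_deriv b V f) r s \<and> s v \<noteq> 0" using rs(2)
    by (intro exI[of _ r'] exI[of _ "\<lambda>v. (s v)\<^sup>2"]) simp
qed (rule cell_deriv_outside)

lemma cell_deriv_ext:
  assumes "\<And>x. x \<notin> V \<Longrightarrow> h x = 0"
    and "\<And>v. v \<in> affine8 \<Longrightarrow> cell_point v \<in> V \<Longrightarrow>
      has_rat_deriv (\<lambda>t. f (cell_point (upd b v t))) (sel b v) (h (cell_point v))"
  shows "cell_deriv b V f = h"
proof
  fix x show "cell_deriv b V f x = h x"
  proof (cases "x \<in> V")
    case True
    then obtain v where "v \<in> affine8" "x = cell_point v" using V(2) big_cell_cases by blast
    then show ?thesis using True cell_deriv_eq assms(2) by metis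
  qed (simp add: assms(1) cell_deriv_outside)
qed

lemma cell_deriv_add:
  assumes "f \<in> regular V" "h \<in> regular V"
  shows "cell_deriv b V (\<lambda>x. f x + h x) = (\<lambda>x. cell_deriv b V f x + cell_deriv b V h x)"
  by (rule cell_deriv_ext)
    (simp_all add: cell_deriv_outside has_rat_deriv_add has_cell_deriv assms)

lemma cell_deriv_mult:
  assumes "f \<in> regular V" "h \<in> regular V"
  shows "cell_deriv b V (\<lambda>x. f x * h x) = (\<lambda>x. cell_deriv b V f x * h x + f x * cell_deriv b V h x)"
proof (rule cell_deriv_ext)
  fix v :: "'k coords8" assume v: "v \<in> affine8" "cell_point v \<in> V"
  show "has_rat_deriv (\<lambda>t. f (cell_point (upd b v t)) * h (cell_point (upd b v t))) (sel b v)
      (cell_deriv b V f (cell_point v) * h (cell_point v) + f (cell_point v) * cell_deriv b V h (cell_point v))"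
    using has_rat_deriv_mult[OF has_cell_deriv[OF assms(1) v] has_cell_deriv[OF assms(2) v]] by simp
qed (simp add: cell_deriv_outside regularD(1)[OF assms(1) V(1)])

lemma cell_deriv_cmult:
  assumes "f \<in> regular V"
  shows "cell_deriv b V (\<lambda>x. c * f x) = (\<lambda>x. c * cell_deriv b V f x)"
proof (rule cell_deriv_ext)
  fix v :: "'k coords8" assume v: "v \<in> affine8" "cell_point v \<in> V"
  show "has_rat_deriv (\<lambda>t. c * f (cell_point (upd b v t))) (sel b v) (c * cell_deriv b V f (cell_point v))"
    using has_rat_deriv_mult[OF has_rat_deriv_const has_cell_deriv[OF assms(1) v]] by simp
qed (simp add: cell_deriv_outside)

lemma cell_deriv_restr:
  assumes "zopen W" "W \<subseteq> V" "f \<in> regular V"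
  shows "cell_deriv b W (restr W f) = restr W (cell_deriv b V f)"
proof
  fix x show "cell_deriv b W (restr W f) x = restr W (cell_deriv b V f) x"
  proof (cases "x \<in> W")
    case True
    then obtain v where v: "v \<in> affine8" "x = cell_point v" using V(2) assms(2) big_cell_cases by blast
    have W: "W \<subseteq> big_cell" using V(2) assms(2) by blast
    obtain r s where rs: "cell_fraction W (restr W f) r s" "s v \<noteq> 0"
      using regular_restr[OF V(1) assms(1-3)] v True unfolding regular_cell_iff[OF assms(1) W] by blast
    obtain u where u: "\<And>t. s (upd b v t) = poly u t"
      using upd_curve rs(1) unfolding cell_fraction_def by metis
    have "has_rat_deriv (\<lambda>t. restr W f (cell_point (upd b v t))) (sel b v) (cell_deriv b V f x)"
    proof (rule has_rat_deriv_local)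
      show "has_rat_deriv (\<lambda>t. f (cell_point (upd b v t))) (sel b v) (cell_deriv b V f x)"
        using has_cell_deriv[OF assms(3) v(1)] v(2) True assms(2) by blast
      show "poly u (sel b v) \<noteq> 0" using u[of "sel b v"] rs(2) by simp
      show "restr W f (cell_point (upd b v t)) = f (cell_point (upd b v t))" if "poly u t \<noteq> 0" for t
        using rs(1) upd_affine8[OF v(1)] that u unfolding cell_fraction_def restr_def by metis
    qed
    then show ?thesis using cell_deriv_eq[OF v(1), of W] True v(2) by (simp add: restr_def)
  qed (simp add: cell_deriv_def restr_def)
qed

end

lemma D0_cell_deriv: "D0 V f = cell_deriv True V (cell_deriv False V f)"
  by (simp add: D0_def d_alpha_cell_deriv)

text \<open>The commutator of a product \<open>d\<^sub>1 d\<^sub>2\<close> of derivations with a function is a first-order operator,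
  whose commutators are functions.\<close>

lemma order_le_two_derivations:
  fixes d1 d2 :: "('p \<Rightarrow> 'k::field) \<Rightarrow> 'p \<Rightarrow> 'k"
  assumes R: "\<And>f h. f \<in> R \<Longrightarrow> h \<in> R \<Longrightarrow> (\<lambda>x. f x * h x) \<in> R"
    and d: "\<And>f. f \<in> R \<Longrightarrow> d2 f \<in> R"
    and add: "\<And>f h. f \<in> R \<Longrightarrow> h \<in> R \<Longrightarrow> d1 (\<lambda>x. f x + h x) = (\<lambda>x. d1 f x + d1 h x)"
    and d1: "\<And>f h. f \<in> R \<Longrightarrow> h \<in> R \<Longrightarrow> d1 (\<lambda>x. f x * h x) = (\<lambda>x. d1 f x * h x + f x * d1 h x)"
    and d2: "\<And>f h. f \<in> R \<Longrightarrow> h \<in> R \<Longrightarrow> d2 (\<lambda>x. f x * h x) = (\<lambda>x. d2 f x * h x + f x * d2 h x)"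
    and T: "\<And>f. f \<in> R \<Longrightarrow> T f = d1 (d2 f)"
  shows "order_le 2 R T"
proof -
  have 1: "commutator a T h = (\<lambda>x. d1 a x * d2 h x + d2 a x * d1 h x + T a x * h x)"
    if "a \<in> R" "h \<in> R" for a h
  proof -
    have "T (\<lambda>x. a x * h x) = d1 (\<lambda>x. d2 a x * h x + a x * d2 h x)"
      using that by (simp add: T R d2)
    also have "\<dots> = (\<lambda>x. (d1 (d2 a) x * h x + d2 a x * d1 h x) + (d1 a x * d2 h x + a x * d1 (d2 h) x))"
      using that by (simp add: add R d d1)
    finally show ?thesis using that by (simp add: commutator_def T fun_eq_iff algebra_simps)
  qed
  have 2: "commutator b (commutator a T) h = (\<lambda>x. (d1 a x * d2 b x + d2 a x * d1 b x) * h x)"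
    if "a \<in> R" "b \<in> R" "h \<in> R" for a b h
    using that unfolding commutator_def[of b]
    by (simp add: 1 R d1 d2 fun_eq_iff algebra_simps)
  have "commutator c (commutator b (commutator a T)) h = (\<lambda>x. 0)"
    if "a \<in> R" "b \<in> R" "c \<in> R" "h \<in> R" for a b c h
    using that unfolding commutator_def[of c] by (simp add: 2 R fun_eq_iff algebra_simps)
  then show ?thesis by (simp add: numeral_2_eq_2)
qed

context
  fixes V :: "'k::field_char_0 proj2 set"
  assumes V: "zopen V" "V \<subseteq> big_cell"
begin

lemma D0_linear: "linear_op (regular V) (D0 V)"
  unfolding linear_op_def D0_cell_deriv
  by (auto simp: cell_deriv_regular[OF V] cell_deriv_add[OF V] cell_deriv_cmult[OF V])

lemma D0_restr:
  "zopen W \<Longrightarrow> W \<subseteq> V \<Longrightarrow> f \<in> regular V \<Longrightarrow> D0 W (restr W f) = restr W (D0 V f)"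
  unfolding D0_cell_deriv by (simp add: cell_deriv_restr[OF V] cell_deriv_regular[OF V])

lemma D0_order: "order_le 2 (regular V) (D0 V)"
  by (rule order_le_two_derivations[where ?d1.0 = "cell_deriv True V" and ?d2.0 = "cell_deriv False V"])
    (simp_all add: regular_mult[OF V(1)] cell_deriv_regular[OF V] cell_deriv_add[OF V]
      cell_deriv_mult[OF V] D0_cell_deriv)

end

lemma D0_diff_op: "(D0 :: 'k::field_char_0 sheaf_op) \<in> diff_ops big_cell"
  unfolding diff_ops_def using D0_linear D0_restr D0_order by blast


section \<open>The operator in the matrix entries\<close>

lemma matrix_line_curve:
  assumes "b \<in> poly_alg entries" "\<And>i j t. \<gamma> t $ i $ j = K i j + L i j * t"
  shows "\<exists>u. \<forall>t. b (\<gamma> t) = poly u t"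
proof (rule poly_alg_curve[OF assms(1)])
  show "\<exists>u. \<forall>t. c (\<gamma> t) = poly u t" if "c \<in> entries" for c
  proof -
    obtain i j where c: "c = (\<lambda>g. g $ i $ j)" using \<open>c \<in> entries\<close> by (auto simp: entries_def)
    show ?thesis unfolding c
      by (intro exI[of _ "[:K i j, L i j:]"]) (simp add: assms(2) mult.commute)
  qed
qed

lemma has_rat_deriv_matrix_line:
  assumes p: "is_gradient p pd" and q: "is_gradient q qd" and b: "b \<in> poly_alg entries"
    and \<gamma>: "\<And>i j t. \<gamma> t $ i $ j = K i j + L i j * t"
    and nz: "b (\<gamma> a) \<noteq> 0" "q (\<gamma> a) \<noteq> 0"
    and h: "\<And>t. b (\<gamma> t) \<noteq> 0 \<Longrightarrow> h t = p (\<gamma> t) / q (\<gamma> t)"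
  shows "has_rat_deriv h a
    (((\<Sum>i\<in>UNIV. \<Sum>j\<in>UNIV. pd i j (\<gamma> a) * L i j) * q (\<gamma> a)
      - p (\<gamma> a) * (\<Sum>i\<in>UNIV. \<Sum>j\<in>UNIV. qd i j (\<gamma> a) * L i j)) / (q (\<gamma> a))\<^sup>2)"
proof -
  obtain u where u: "\<And>t. b (\<gamma> t) = poly u t" using matrix_line_curve[of b \<gamma> K L] b \<gamma> by blast
  have e: "has_rat_deriv (\<lambda>t. \<gamma> t $ i $ j) a (L i j)" for i j
    unfolding \<gamma> by (rule has_rat_deriv_affine)
  show ?thesis
    by (rule has_rat_deriv_local[OF has_rat_deriv_divide[OF is_gradientD[OF p e] is_gradientD[OF q e] nz(2)]])
      (use u nz h in auto)
qed

lemma set_entry_curve: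
  "set_entry k l g t $ i $ j = (if i = k \<and> j = l then 0 else g $ i $ j) + (if i = k \<and> j = l then 1 else 0) * t"
  for g :: "'k::field mat3"
  by (auto simp: set_entry_def)

lemma set_entry_self [simp]: "set_entry k l g (g $ k $ l) = g"
  by (simp add: vec_eq_iff set_entry_def)

lemma sum_unit_entry:
  "(\<Sum>i\<in>UNIV. \<Sum>j\<in>UNIV. f i j * (if i = k \<and> j = l then 1 else 0)) = f k l"
  for f :: "3 \<Rightarrow> 3 \<Rightarrow> 'k::field"
proof -
  have "(\<Sum>j\<in>UNIV. f i j * (if i = k \<and> j = l then 1 else 0)) = (if i = k then f i l else 0)" for i
    by (cases "i = k") (simp_all add: sum.delta' if_distrib[of "\<lambda>x. _ * x"] cong: if_cong)
  then show ?thesis by (simp add: sum.delta')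
qed

lemma d_entry_fraction:
  fixes F :: "'k::field_char_0 mat3 \<Rightarrow> 'k"
  assumes "is_gradient p pd" "is_gradient q qd" "b \<in> poly_alg entries" "b g \<noteq> 0" "q g \<noteq> 0"
    and "\<And>h. b h \<noteq> 0 \<Longrightarrow> F h = p h / q h"
  shows "d_entry k l F g = (pd k l g * q g - p g * qd k l g) / (q g)\<^sup>2"
  unfolding d_entry_def
  using rat_deriv_eq[OF has_rat_deriv_matrix_line[OF assms(1-3), where \<gamma> = "set_entry k l g" and a = "g $ k $ l"
    and h = "\<lambda>t. F (set_entry k l g t)", OF set_entry_curve]] assms(4-6)
  by (simp add: sum_unit_entry)

text \<open>Along a line in which only \<open>\<alpha>\<^sub>2\<close> varies, a representing matrix \<open>c M\<close> moves in its upper left block,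
  and the velocity consists of the minors in the formula divided by \<open>c \<alpha>\<^sub>2\<close>. Along a line in which only
  \<open>\<alpha>\<^sub>1\<close> varies, the entry (1, 1) alone moves, with velocity \<open>c \<alpha>\<^sub>2\<close>. The constant factors cancel, and
  both operators become the same polynomial expression over the fourth power of the denominator.
  The numerator \<open>R\<close> depends on \<open>P\<close> and \<open>Q\<close> only, so the formula can be used in every chart.\<close>

lemma D0_fraction:
  fixes P Q :: "'k::field_char_0 mat3 \<Rightarrow> 'k mat3 \<Rightarrow> 'k"
  assumes PQ: "poly_fun P" "poly_fun Q"
  shows "\<exists>R\<in>poly_alg entries. \<forall>V f g.
    (\<forall>h. det h \<noteq> 0 \<longrightarrow> Q h (Com h) \<noteq> 0 \<longrightarrow> emb h \<in> big_cell \<longrightarrow>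
       emb h \<in> V \<and> f (emb h) = P h (Com h) / Q h (Com h)) \<longrightarrow>
    det g \<noteq> 0 \<longrightarrow> Q g (Com g) \<noteq> 0 \<longrightarrow> emb g \<in> big_cell \<longrightarrow>
    D0 V f (emb g) = R g / (Q g (Com g)) ^ 4 \<and>
    D0_entries (\<lambda>h. f (emb h)) g = R g / (Q g (Com g)) ^ 4"
proof -
  define p q where "p = (\<lambda>h. P h (Com h))" "q = (\<lambda>h. Q h (Com h))"
  note pq = this
  have alg: "p \<in> poly_alg entries" "q \<in> poly_alg entries"
    unfolding pq by (intro poly_fun_Com_alg PQ)+
  obtain pd where pd: "\<And>i j. pd i j \<in> poly_alg entries" "is_gradient p pd" using gradient[OF alg(1)] by blast
  obtain qd where qd: "\<And>i j. qd i j \<in> poly_alg entries" "is_gradient q qd" using gradient[OF alg(2)] by blast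
  define F where "F = (\<lambda>i j h. pd i j h * q h - p h * qd i j h)"
  define A where "A = (\<lambda>h. minor 2 2 h * F 1 1 h + minor 1 1 h * F 2 2 h + minor 2 1 h * F 1 2 h + minor 1 2 h * F 2 1 h)"
  define q2 where "q2 = (\<lambda>h. (q h)\<^sup>2)"
  have Falg: "F i j \<in> poly_alg entries" for i j unfolding F_def by (intro poly_alg_intros pd qd alg)
  have Aalg: "A \<in> poly_alg entries"
    unfolding A_def minor_Com by (intro poly_alg_intros Falg Com_alg entry_in)
  have q2alg: "q2 \<in> poly_alg entries" unfolding q2_def by (intro poly_alg_intros alg)
  obtain Ad where Ad: "\<And>i j. Ad i j \<in> poly_alg entries" "is_gradient A Ad" using gradient[OF Aalg] by blast
  obtain sd where sd: "\<And>i j. sd i j \<in> poly_alg entries" "is_gradient q2 sd" using gradient[OF q2alg] by blast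
  define R where "R = (\<lambda>h. Ad 1 1 h * q2 h - A h * sd 1 1 h)"
  have R: "R \<in> poly_alg entries" unfolding R_def by (intro poly_alg_intros Ad sd Aalg q2alg)
  \<comment> \<open>The locus of the matrices over which the fraction represents the function.\<close>
  define b where "b = (\<lambda>h :: 'k mat3. det h * q h * (h $ 3 $ 3 * Com h $ 1 $ 1))"
  have balg: "b \<in> poly_alg entries"
    unfolding b_def by (intro poly_alg_intros det_alg alg entry_in Com_alg)
  have b: "b h \<noteq> 0 \<longleftrightarrow> det h \<noteq> 0 \<and> q h \<noteq> 0 \<and> emb h \<in> big_cell" for h
    using group_wonderful[of h] by (auto simp: b_def emb_def big_cell_iff)
  have *: "D0 V f (emb g) = R g / (q g) ^ 4 \<and> D0_entries (\<lambda>h. f (emb h)) g = R g / (q g) ^ 4"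
    if f: "\<And>h. b h \<noteq> 0 \<Longrightarrow> emb h \<in> V \<and> f (emb h) = p h / q h" and bg: "b g \<noteq> 0" for V f g
  proof
    have q0: "q h \<noteq> 0" "q2 h \<noteq> 0" if "b h \<noteq> 0" for h using that by (simp_all add: b q2_def)
    have q4: "(q2 h)\<^sup>2 = (q h) ^ 4" for h by (simp add: q2_def flip: power_mult)
    have d: "d_entry i j (\<lambda>h. f (emb h)) h = F i j h / q2 h" if "b h \<noteq> 0" for i j h
      unfolding F_def q2_def using that f q0
      by (intro d_entry_fraction[OF pd(2) qd(2) balg]) auto
    show "D0_entries (\<lambda>h. f (emb h)) g = R g / (q g) ^ 4"
      unfolding D0_entries_def R_def q4[symmetric]
    proof (rule d_entry_fraction[OF Ad(2) sd(2) balg bg q0(2)[OF bg]])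
      fix h assume h: "b h \<noteq> 0"
      show "minor 2 2 h * d_entry 1 1 (\<lambda>h. f (emb h)) h + minor 1 1 h * d_entry 2 2 (\<lambda>h. f (emb h)) h
          + minor 2 1 h * d_entry 1 2 (\<lambda>h. f (emb h)) h + minor 1 2 h * d_entry 2 1 (\<lambda>h. f (emb h)) h = A h / q2 h"
        using q0[OF h] by (simp add: d[OF h] A_def add_divide_distrib)
    qed
    obtain v where v: "v \<in> affine8" "emb g = cell_point v" using bg b big_cell_cases by metis
    then obtain c where c: "c \<noteq> 0" "g = mscale c (cell_mat v)"
      by (auto simp: emb_def cell_point_eq proj_class_eq_iff)
    have emb: "emb (mscale c (cell_mat w)) = cell_point w" if "b (mscale c (cell_mat w)) \<noteq> 0" for w
    proof -
      have "det (mscale c (cell_mat w)) \<noteq> 0" using that b by blast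
      then have "Com (mscale c (cell_mat w)) \<noteq> 0" by (rule det_nonzero_Com)
      then have "fst (snd w) \<noteq> 0"
        by (auto simp: Com_mscale Com_cell_mat mscale_eq_0_iff)
      then show ?thesis using c(1)
        by (simp add: emb_def cell_point_eq Com_mscale Com_cell_mat proj_class_mscale)
    qed
    have fw: "cell_point w \<in> V \<and> f (cell_point w) = p (mscale c (cell_mat w)) / q (mscale c (cell_mat w))"
      if "b (mscale c (cell_mat w)) \<noteq> 0" for w
      using f[OF that] emb[OF that] by simp
    have d2: "cell_deriv False V f (cell_point w) = A (mscale c (cell_mat w)) / (c * fst (snd w) * q2 (mscale c (cell_mat w)))"
      if w: "w \<in> affine8" "b (mscale c (cell_mat w)) \<noteq> 0" for w
    proof -
      obtain a1 a2 U where w': "w = (a1, a2, U)" by (cases w)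
      define h where "h = mscale c (cell_mat w)"
      have "det h \<noteq> 0" using w(2) b h_def by blast
      then have "Com h \<noteq> 0" by (rule det_nonzero_Com)
      then have a2: "a2 \<noteq> 0" by (auto simp: h_def Com_mscale Com_cell_mat mscale_eq_0_iff w')
      define L :: "3 \<Rightarrow> 3 \<Rightarrow> 'k" where "L i j = c * (vector [vector [a1 + U $ 1 $ 2 * U $ 2 $ 1, U $ 1 $ 2, 0],
        vector [U $ 2 $ 1, 1, 0], vector [0, 0, 0]] :: 'k mat3) $ i $ j" for i j
      have L: "L 1 1 = minor 2 2 h / (c * a2)" "L 2 2 = minor 1 1 h / (c * a2)"
        "L 1 2 = minor 2 1 h / (c * a2)" "L 2 1 = minor 1 2 h / (c * a2)"
        "L 1 3 = 0" "L 2 3 = 0" "L 3 1 = 0" "L 3 2 = 0" "L 3 3 = 0"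
        using c(1) a2
        by (simp_all add: L_def h_def w' minor_Com Com_mscale Com_cell_mat cell_mat'_entries vector_3 power2_eq_square)
      have \<gamma>: "mscale c (cell_mat (upd False w t)) $ i $ j = mscale c (cell_mat (a1, 0, U)) $ i $ j + L i j * t" for i j t
      proof -
        have "\<forall>i j. mscale c (cell_mat (a1, t, U)) $ i $ j = mscale c (cell_mat (a1, 0, U)) $ i $ j + L i j * t"
          unfolding forall_3 L_def nth_map_matrix cell_mat_entries vector_3
          by (simp add: algebra_simps)
        then show ?thesis by (simp add: upd_def w')
      qed
      have s: "mscale c (cell_mat (upd False w (sel False w))) = h" by (simp add: h_def)
      have "has_rat_deriv (\<lambda>t. f (cell_point (upd False w t))) (sel False w)
        (((\<Sum>i\<in>UNIV. \<Sum>j\<in>UNIV. pd i j h * L i j) * q h - p h * (\<Sum>i\<in>UNIV. \<Sum>j\<in>UNIV. qd i j h * L i j)) / (q h)\<^sup>2)"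
        using has_rat_deriv_matrix_line[OF pd(2) qd(2) balg, of "\<lambda>t. mscale c (cell_mat (upd False w t))", OF \<gamma>,
          of "sel False w" "\<lambda>t. f (cell_point (upd False w t))"] w(2) fw q0 unfolding s h_def[symmetric] by blast
      from cell_deriv_eq[OF w(1) _ this, of V] fw[OF w(2)]
      have "cell_deriv False V f (cell_point w) = ((\<Sum>i\<in>UNIV. \<Sum>j\<in>UNIV. pd i j h * L i j) * q h
        - p h * (\<Sum>i\<in>UNIV. \<Sum>j\<in>UNIV. qd i j h * L i j)) / (q h)\<^sup>2" by blast
      also have "\<dots> = A h / (c * a2 * q2 h)"
      proof -
        have "(\<Sum>i\<in>UNIV. \<Sum>j\<in>UNIV. pd i j h * L i j) * q h - p h * (\<Sum>i\<in>UNIV. \<Sum>j\<in>UNIV. qd i j h * L i j)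
            = A h / (c * a2)"
          unfolding sum_3 L A_def F_def using c(1) a2 by (simp add: field_simps)
        then show ?thesis by (simp add: q2_def)
      qed
      finally show ?thesis by (simp add: h_def w')
    qed
    obtain a1 a2 U where v': "v = (a1, a2, U)" by (cases v)
    have "Com g \<noteq> 0" using bg b det_nonzero_Com by blast
    then have a2: "a2 \<noteq> 0" by (auto simp: c(2) Com_mscale Com_cell_mat mscale_eq_0_iff v')
    define L :: "3 \<Rightarrow> 3 \<Rightarrow> 'k" where "L i j = (if i = 1 \<and> j = 1 then c * a2 else 0)" for i j
    have \<gamma>: "mscale c (cell_mat (upd True v t)) $ i $ j = mscale c (cell_mat (0, a2, U)) $ i $ j + L i j * t" for i j t
    proof -
      have "\<forall>i j. mscale c (cell_mat (t, a2, U)) $ i $ j = mscale c (cell_mat (0, a2, U)) $ i $ j + L i j * t"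
        unfolding forall_3 L_def nth_map_matrix cell_mat_entries
        by (simp add: algebra_simps)
      then show ?thesis by (simp add: upd_def v')
    qed
    have s: "mscale c (cell_mat (upd True v (sel True v))) = g" by (simp add: c(2))
    have "has_rat_deriv (\<lambda>t. c * a2 * cell_deriv False V f (cell_point (upd True v t))) (sel True v)
        (((\<Sum>i\<in>UNIV. \<Sum>j\<in>UNIV. Ad i j g * L i j) * q2 g - A g * (\<Sum>i\<in>UNIV. \<Sum>j\<in>UNIV. sd i j g * L i j)) / (q2 g)\<^sup>2)"
    proof -
      have "c * a2 * cell_deriv False V f (cell_point (upd True v t))
          = A (mscale c (cell_mat (upd True v t))) / q2 (mscale c (cell_mat (upd True v t)))"
        if t: "b (mscale c (cell_mat (upd True v t))) \<noteq> 0" for t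
        using d2[OF upd_affine8[OF v(1)] t] c(1) a2 by (simp add: v' upd_def)
      then show ?thesis
        using has_rat_deriv_matrix_line[OF Ad(2) sd(2) balg, of "\<lambda>t. mscale c (cell_mat (upd True v t))", OF \<gamma>,
          of "sel True v" "\<lambda>t. c * a2 * cell_deriv False V f (cell_point (upd True v t))"] bg q0 unfolding s by blast
    qed
    moreover have "(\<Sum>i\<in>UNIV. \<Sum>j\<in>UNIV. Ad i j g * L i j) * q2 g - A g * (\<Sum>i\<in>UNIV. \<Sum>j\<in>UNIV. sd i j g * L i j)
        = c * a2 * R g"
      unfolding sum_3 L_def R_def by (simp add: algebra_simps)
    ultimately have "has_rat_deriv (\<lambda>t. 1 / (c * a2) * (c * a2 * cell_deriv False V f (cell_point (upd True v t)))) (sel True v)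
        (1 / (c * a2) * (c * a2 * R g / (q2 g)\<^sup>2))"
      using has_rat_deriv_mult[OF has_rat_deriv_const[of "1 / (c * a2)"]] by fastforce
    then have "has_rat_deriv (\<lambda>t. cell_deriv False V f (cell_point (upd True v t))) (sel True v) (R g / (q2 g)\<^sup>2)"
      using c(1) a2 by simp
    from cell_deriv_eq[OF v(1) _ this, of V] f[OF bg]
    show "D0 V f (emb g) = R g / (q g) ^ 4" unfolding D0_cell_deriv v(2) q4 by simp
  qed
  show ?thesis
  proof (intro bexI[OF _ R] allI impI)
    fix V f g
    assume H: "\<forall>h. det h \<noteq> 0 \<longrightarrow> Q h (Com h) \<noteq> 0 \<longrightarrow> emb h \<in> big_cell \<longrightarrow>
       emb h \<in> V \<and> f (emb h) = P h (Com h) / Q h (Com h)"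
      and g: "det g \<noteq> 0" "Q g (Com g) \<noteq> 0" "emb g \<in> big_cell"
    have "b g \<noteq> 0" using g by (simp add: b pq)
    moreover have "emb h \<in> V \<and> f (emb h) = p h / q h" if "b h \<noteq> 0" for h
      using H that by (simp add: b pq)
    ultimately show "D0 V f (emb g) = R g / (Q g (Com g)) ^ 4 \<and>
        D0_entries (\<lambda>h. f (emb h)) g = R g / (Q g (Com g)) ^ 4"
      using *[of V f g] unfolding pq by blast
  qed
qed


section \<open>Every point lies in a translate of the big cell\<close>

lemma Com_transpose: "Com (transpose A) = transpose (Com (A :: 'k::comm_ring_1 mat3))"
  unfolding vec_eq_iff forall_3 transpose_def vec_lambda_beta Com_entries
  by (simp add: algebra_simps)

text \<open>A generic invertible matrix moves a vector off a coordinate hyperplane, and its cofactor matrix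
  does the same with another vector.\<close>

lemma generic_matrix:
  fixes x y :: "3 \<Rightarrow> 'k::field_char_0"
  assumes "x i \<noteq> 0" "y l \<noteq> 0"
  shows "\<exists>A. det A * (A $ 1 $ 1 * Com A $ 3 $ 3) \<noteq> 0 \<and>
    (\<Sum>m\<in>UNIV. A $ 3 $ m * x m) \<noteq> 0 \<and> (\<Sum>m\<in>UNIV. Com A $ 1 $ m * y m) \<noteq> 0"
proof -
  define p q r where "p = (\<lambda>A :: 'k mat3. \<Sum>m\<in>UNIV. A $ 3 $ m * x m)"
    "q = (\<lambda>A :: 'k mat3. \<Sum>m\<in>UNIV. Com A $ 1 $ m * y m)"
    "r = (\<lambda>A :: 'k mat3. det A * (A $ 1 $ 1 * Com A $ 3 $ 3))"
  note pqr = this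
  have alg: "p \<in> poly_alg entries" "q \<in> poly_alg entries" "r \<in> poly_alg entries"
    unfolding pqr by (intro poly_alg_intros entry_in Com_alg det_alg)+
  have "p (\<chi> a b. if b = i then 1 else 0) \<noteq> 0"
    using assms(1) by (simp add: pqr sum.delta' if_distrib[of "\<lambda>z. z * _"] cong: if_cong)
  moreover have "\<exists>A. q A \<noteq> 0"
  proof -
    have "\<forall>l. \<exists>A :: 'k mat3. \<forall>m. Com A $ 1 $ m = (if m = l then 1 else 0)"
      unfolding forall_3
    proof (intro conjI)
      show "\<exists>A :: 'k mat3. Com A $ 1 $ 1 = (if (1::3) = 1 then 1 else 0) \<and>
          Com A $ 1 $ 2 = (if (2::3) = 1 then 1 else 0) \<and> Com A $ 1 $ 3 = (if (3::3) = 1 then 1 else 0)"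
        by (rule exI[of _ "vector [vector [0, 0, 0], vector [0, 1, 0], vector [0, 0, 1]]"])
          (simp add: Com_entries vector_3)
      show "\<exists>A :: 'k mat3. Com A $ 1 $ 1 = (if (1::3) = 2 then 1 else 0) \<and>
          Com A $ 1 $ 2 = (if (2::3) = 2 then 1 else 0) \<and> Com A $ 1 $ 3 = (if (3::3) = 2 then 1 else 0)"
        by (rule exI[of _ "vector [vector [0, 0, 0], vector [0, 0, 1], vector [1, 0, 0]]"])
          (simp add: Com_entries vector_3)
      show "\<exists>A :: 'k mat3. Com A $ 1 $ 1 = (if (1::3) = 3 then 1 else 0) \<and>
          Com A $ 1 $ 2 = (if (2::3) = 3 then 1 else 0) \<and> Com A $ 1 $ 3 = (if (3::3) = 3 then 1 else 0)"
        by (rule exI[of _ "vector [vector [0, 0, 0], vector [1, 0, 0], vector [0, 1, 0]]"])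
          (simp add: Com_entries vector_3)
    qed
    then obtain A :: "'k mat3" where "\<And>m. Com A $ 1 $ m = (if m = l then 1 else 0)" by metis
    then have "q A = y l"
      by (simp add: pqr sum.delta' if_distrib[of "\<lambda>z. z * _"] cong: if_cong)
    then show ?thesis using assms(2) by metis
  qed
  ultimately obtain A where A: "p A * q A \<noteq> 0"
    using common_nonzero_entries[OF alg(1,2)] by fastforce
  have "r (mat 1) \<noteq> 0" by (simp add: pqr Com_mat_1) (simp add: mat_def)
  then obtain B where "p B * q B \<noteq> 0" "r B \<noteq> 0"
    using common_nonzero_entries[OF poly_alg.mult[OF alg(1,2)] alg(3) A] by blast
  then show ?thesis unfolding pqr by (intro exI[of _ B]) simp
qed

lemma inverse_corners:
  fixes A A1 :: "'k::field mat3"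
  assumes "A ** A1 = mat 1" "det A1 \<noteq> 0" "A1 $ 1 $ 1 \<noteq> 0" "Com A1 $ 3 $ 3 \<noteq> 0"
  shows "A $ 3 $ 3 \<noteq> 0" "Com A $ 1 $ 1 \<noteq> 0"
proof -
  have inv: "mscale (det C) B = transpose (Com C)" if "B ** C = mat 1" for B C :: "'k mat3"
  proof -
    have "B ** (C ** transpose (Com C)) = transpose (Com C)"
      using that by (simp add: matrix_mul_assoc)
    moreover have "B ** mat (det C) = mscale (det C) B"
      unfolding vec_eq_iff forall_3 mult_entry by (simp add: mat_def)
    ultimately show ?thesis by (simp add: mult_transpose_Com)
  qed
  have "det A1 * A $ 3 $ 3 = Com A1 $ 3 $ 3"
    using arg_cong[OF inv[OF assms(1)], of "\<lambda>M. M $ 3 $ 3"] by (simp add: transpose_def)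
  then show "A $ 3 $ 3 \<noteq> 0" using assms by auto
  have "Com A ** Com A1 = mat 1" using assms(1) by (metis Com_mult Com_mat_1)
  from arg_cong[OF inv[OF this], of "\<lambda>M. M $ 1 $ 1"]
  have "det (Com A1) * Com A $ 1 $ 1 = det A1 * A1 $ 1 $ 1" by (simp add: transpose_def Com_Com)
  then show "Com A $ 1 $ 1 \<noteq> 0" using assms by auto
qed

text \<open>The inequality for the corner entries says that the point with all coordinates zero, which lies on
  the hyperplane \<open>\<alpha>\<^sub>2 = 0\<close> of the translated cell, belongs to the big cell itself.\<close>

lemma exists_chart:
  fixes k k' :: "'k::field_char_0 mat3"
  assumes "point k k' \<in> wonderful"
  shows "\<exists>A B. \<exists>v\<in>affine8. det A \<noteq> 0 \<and> det B \<noteq> 0 \<and> point k k' = chart A B v \<and>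
    A $ 3 $ 3 * B $ 3 $ 3 * (Com A $ 1 $ 1 * Com B $ 1 $ 1) \<noteq> 0"
proof -
  have "k \<noteq> 0" "k' \<noteq> 0" using assms by (simp_all add: wonderful_iff)
  then obtain i j l m where ij: "k $ i $ j \<noteq> 0" "k' $ l $ m \<noteq> 0"
    by (auto simp: vec_eq_iff)
  obtain A1 where A1: "det A1 \<noteq> 0" "A1 $ 1 $ 1 \<noteq> 0" "Com A1 $ 3 $ 3 \<noteq> 0"
    "(\<Sum>a\<in>UNIV. A1 $ 3 $ a * k $ a $ j) \<noteq> 0" "(\<Sum>a\<in>UNIV. Com A1 $ 1 $ a * k' $ a $ m) \<noteq> 0"
    using generic_matrix[of "\<lambda>a. k $ a $ j" i "\<lambda>a. k' $ a $ m" l] ij by auto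
  define h h' where "h = A1 ** k" "h' = Com A1 ** k'"
  note h = this
  have "h $ 3 $ j \<noteq> 0" "h' $ 1 $ m \<noteq> 0" using A1 by (simp_all add: h matrix_matrix_mult_def)
  then obtain C where C: "det C \<noteq> 0" "C $ 1 $ 1 \<noteq> 0" "Com C $ 3 $ 3 \<noteq> 0"
    "(\<Sum>a\<in>UNIV. C $ 3 $ a * h $ 3 $ a) \<noteq> 0" "(\<Sum>a\<in>UNIV. Com C $ 1 $ a * h' $ 1 $ a) \<noteq> 0"
    using generic_matrix[of "\<lambda>a. h $ 3 $ a" j "\<lambda>a. h' $ 1 $ a" m] by auto
  define B1 where "B1 = transpose C"
  have B1: "det B1 \<noteq> 0" "B1 $ 1 $ 1 \<noteq> 0" "Com B1 $ 3 $ 3 \<noteq> 0"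
    using C by (simp_all add: B1_def det_transpose Com_transpose) (simp_all add: transpose_def)
  have nz: "(h ** B1) $ 3 $ 3 \<noteq> 0" "(h' ** Com B1) $ 1 $ 1 \<noteq> 0"
    using C(4,5) unfolding B1_def Com_transpose
    by (simp_all add: matrix_matrix_mult_def transpose_def mult.commute)
  obtain A where A: "A ** A1 = mat 1" "Com A ** Com A1 = mat 1" "det A \<noteq> 0"
    using inverse_mat[OF A1(1)] by metis
  obtain B where B: "B ** B1 = mat 1" "B1 ** B = mat 1" "Com B1 ** Com B = mat 1" "det B \<noteq> 0"
    using inverse_mat[OF B1(1)] by metis
  have cell: "point (h ** B1) (h' ** Com B1) \<in> big_cell"
    using wonderful_translate[OF A1(1) B1(1) assms] nz unfolding h big_cell_iff by blast
  define v where "v = coords_of (h ** B1) (h' ** Com B1)"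
  note e = cell_coords_of[OF cell, folded v_def]
  have "k = A ** (h ** B1) ** B" "k' = Com A ** (h' ** Com B1) ** Com B"
    unfolding h using mult_inverse[OF A(1) B(2)] mult_inverse[OF A(2) B(3)] by simp_all
  then have "k = mscale ((h ** B1) $ 3 $ 3) (A ** cell_mat v ** B)"
    "k' = mscale ((h' ** Com B1) $ 1 $ 1) (Com A ** cell_mat' v ** Com B)"
    using e by (metis mscale_mult)+
  then have "point k k' = chart A B v"
    unfolding chart_def using point_mscale[OF nz] by metis
  moreover have "A $ 3 $ 3 * B $ 3 $ 3 * (Com A $ 1 $ 1 * Com B $ 1 $ 1) \<noteq> 0"
    using inverse_corners[OF A(1) A1(1-3)] inverse_corners[OF B(1) B1] by simp
  ultimately show ?thesis using A(3) B(4) coords_of_affine8[of "h ** B1" "h' ** Com B1"]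
    unfolding v_def by blast
qed


section \<open>Extension of the operator\<close>

text \<open>The Hartogs argument. In a translated chart, the entry formula gives a fraction with
  denominator a power of \<open>\<alpha>\<^sub>2\<close> times a power of the denominator \<open>q\<close> of the function; generic points of the
  hyperplane \<open>\<alpha>\<^sub>2 = 0\<close> belong to the big cell, where the operator is regular, and so the power of
  \<open>\<alpha>\<^sub>2\<close> cancels.\<close>

lemma D0_extends_locally:
  fixes f :: "'k::field_char_0 proj2 \<Rightarrow> 'k"
  assumes V: "zopen V" and f: "f \<in> regular V" and k: "point k k' \<in> V"
  shows "\<exists>P Q. fraction_on_cell V (D0 (V \<inter> big_cell) (restr (V \<inter> big_cell) f)) P Q \<and> Q k k' \<noteq> 0"
proof -
  define W where "W = V \<inter> big_cell"
  define E where "E = D0 W (restr W f)"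
  have W: "zopen W" "W \<subseteq> big_cell" unfolding W_def using V zopen_big_cell by (auto intro: zopen_Int)
  have rW: "restr W f \<in> regular W" using regular_restr[OF V W(1) _ f] by (simp add: W_def)
  have E: "E \<in> regular W"
    unfolding E_def D0_cell_deriv by (intro cell_deriv_regular W rW)
  obtain P Q where PQ: "is_fraction V f P Q" "Q k k' \<noteq> 0" using regularD(2)[OF f V k] by blast
  obtain d e where b: "bihom d e P" "bihom d e Q" using is_fraction_bihom[OF PQ(1)] .
  obtain R where R: "R \<in> poly_alg entries" "\<And>V f g.
    (\<forall>h. det h \<noteq> 0 \<longrightarrow> Q h (Com h) \<noteq> 0 \<longrightarrow> emb h \<in> big_cell \<longrightarrow>
       emb h \<in> V \<and> f (emb h) = P h (Com h) / Q h (Com h)) \<Longrightarrow>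
    det g \<noteq> 0 \<Longrightarrow> Q g (Com g) \<noteq> 0 \<Longrightarrow> emb g \<in> big_cell \<Longrightarrow> D0 V f (emb g) = R g / (Q g (Com g)) ^ 4"
    using D0_fraction[OF bihomD(1)[OF b(1)] bihomD(1)[OF b(2)]] by blast
  have kw: "point k k' \<in> wonderful" using k V zopen_subset by blast
  obtain A B v where AB: "det A \<noteq> 0" "det B \<noteq> 0" and v: "v \<in> affine8" "point k k' = chart A B v"
    and corner: "A $ 3 $ 3 * B $ 3 $ 3 * (Com A $ 1 $ 1 * Com B $ 1 $ 1) \<noteq> 0"
    using exists_chart[OF kw] by blast
  define N where "N = (\<lambda>w. A ** cell_mat w ** B)"
  define N' where "N' = (\<lambda>w. Com A ** cell_mat' w ** Com B)"
  have chart: "chart A B w = point (N w) (N' w)" for w by (simp add: chart_def N_def N'_def)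
  have Nalg: "(\<lambda>w. N w $ i $ j) \<in> poly_alg coords" "(\<lambda>w. N' w $ i $ j) \<in> poly_alg coords" for i j
    unfolding N_def N'_def mult_entry by (intro poly_alg_intros cell_mat_alg)+
  have sub: "(\<lambda>w. P (N w) (N' w)) \<in> poly_alg coords" if "bihom d e P" for d e P
    by (rule poly_fun_alg[OF bihomD(1)[OF that] Nalg])
  define q where "q = (\<lambda>w. Q (N w) (N' w))"
  define c where "c = (\<lambda>w. N w $ 3 $ 3 * N' w $ 1 $ 1)"
  define a where "a = (\<lambda>w :: 'k coords8. fst w * fst (snd w))"
  define r0 where "r0 = (\<lambda>w. R (N w))"
  have alg: "q \<in> poly_alg coords" "c \<in> poly_alg coords" "a \<in> poly_alg coords" "r0 \<in> poly_alg coords"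
    "(\<lambda>w. fst (snd w)) \<in> poly_alg coords"
    unfolding q_def c_def a_def r0_def
    by (intro sub[OF b(2)] poly_alg_intros Nalg coords_in poly_alg_comp[OF R(1)];
        auto simp: entries_def Nalg)+
  have a1: "a (1, 1, 0) \<noteq> 0" "(1, 1, 0) \<in> affine8" by (simp_all add: a_def affine8_def)
  have qv: "q v \<noteq> 0"
  proof -
    obtain s t where "s \<noteq> 0" "t \<noteq> 0" "k = mscale s (N v)" "k' = mscale t (N' v)"
      using v(2) unfolding chart by (auto simp: proj_class_eq_iff)
    then show ?thesis using PQ(2) bihomD(2)[OF b(2)] by (simp add: q_def)
  qed
  \<comment> \<open>\<open>q\<close> is the denominator of the function in the chart, \<open>c \<noteq> 0\<close> defines the big cell there and
    \<open>a \<noteq> 0\<close> the group.\<close>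
  have inV: "chart A B w \<in> V" if "w \<in> affine8" "q w \<noteq> 0" for w
    using is_fractionD(1)[OF PQ(1)] chart_wonderful[OF AB that(1)] that(2) unfolding chart q_def by blast
  have inC: "chart A B w \<in> big_cell \<longleftrightarrow> c w \<noteq> 0" if "w \<in> affine8" for w
    using chart_wonderful[OF AB that] unfolding chart big_cell_iff c_def by auto
  have E0: "E (chart A B w) = r0 w / (fst (snd w) ^ (e * 4) * q w ^ 4)"
    if w: "w \<in> affine8" "a w \<noteq> 0" "q w \<noteq> 0" "c w \<noteq> 0" for w
  proof -
    have a2: "fst (snd w) \<noteq> 0" using w(2) by (simp add: a_def)
    have det: "det (N w) \<noteq> 0" using w(2) AB by (simp add: N_def det_mul det_cell_mat a_def)
    have Com: "Com (N w) = mscale (fst (snd w)) (N' w)"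
      by (simp add: N_def N'_def Com_mult Com_cell_mat mscale_mult)
    have emb: "emb (N w) = chart A B w" using a2 by (simp add: emb_def chart Com proj_class_mscale)
    have Q: "Q (N w) (Com (N w)) = fst (snd w) ^ e * q w"
      using bihomD(2)[OF b(2), of 1 "N w" "fst (snd w)" "N' w"] by (simp add: Com q_def)
    have "D0 W (restr W f) (emb (N w)) = R (N w) / (Q (N w) (Com (N w))) ^ 4"
    proof (rule R(2))
      show "\<forall>h. det h \<noteq> 0 \<longrightarrow> Q h (Com h) \<noteq> 0 \<longrightarrow> emb h \<in> big_cell \<longrightarrow>
          emb h \<in> W \<and> restr W f (emb h) = P h (Com h) / Q h (Com h)"
        using is_fractionD[OF PQ(1) group_wonderful] by (simp add: W_def restr_def emb_def)
      show "Q (N w) (Com (N w)) \<noteq> 0" using Q a2 w by simp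
      show "emb (N w) \<in> big_cell" using emb inC w by simp
    qed (rule det)
    then show ?thesis unfolding E_def[symmetric] emb Q r0_def by (simp add: power_mult_distrib power_mult)
  qed
  \<comment> \<open>Points of the chart that lie in the big cell, including those with \<open>\<alpha>\<^sub>1 \<alpha>\<^sub>2 = 0\<close>: there the operator
    is a fraction because it is regular on the cell.\<close>
  have extend: "\<exists>p2 q2. p2 \<in> poly_alg coords \<and> q2 \<in> poly_alg coords \<and> q2 y \<noteq> 0 \<and>
      E (chart A B y) = p2 y / q2 y \<and> (\<forall>w\<in>affine8. q w * c w * q2 w \<noteq> 0 \<longrightarrow> E (chart A B w) = p2 w / q2 w)"
    if y: "y \<in> affine8" "q y \<noteq> 0" "c y \<noteq> 0" for y
  proof -
    have "point (N y) (N' y) \<in> W" using inV inC y by (simp add: W_def chart)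
    then obtain P2 Q2 where 2: "is_fraction W E P2 Q2" "Q2 (N y) (N' y) \<noteq> 0"
      using regularD(2)[OF E W(1)] by blast
    obtain d e where b2: "bihom d e P2" "bihom d e Q2" using is_fraction_bihom[OF 2(1)] .
    have "E (chart A B w) = P2 (N w) (N' w) / Q2 (N w) (N' w)" if "w \<in> affine8" "Q2 (N w) (N' w) \<noteq> 0" for w
      using is_fractionD(2)[OF 2(1)] chart_wonderful[OF AB that(1)] that(2) unfolding chart by blast
    then show ?thesis using sub[OF b2(1)] sub[OF b2(2)] 2(2) y(1)
      by (intro exI[where x = "\<lambda>w. P2 (N w) (N' w)"] exI[where x = "\<lambda>w. Q2 (N w) (N' w)"]) simp
  qed
  have "\<exists>r s. r \<in> poly_alg coords \<and> s \<in> poly_alg coords \<and> s v \<noteq> 0 \<and>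
    (\<forall>w\<in>affine8. a w \<noteq> 0 \<longrightarrow> q w \<noteq> 0 \<longrightarrow> c w \<noteq> 0 \<longrightarrow> E (chart A B w) = r w / s w)"
  proof (cases "fst (snd v) = 0")
    case False
    have "(\<lambda>w. fst (snd w) ^ (e * 4) * q w ^ 4) \<in> poly_alg coords" by (intro poly_alg_intros alg)
    then show ?thesis using alg(4) E0 False qv
      by (intro exI[of _ r0] exI[of _ "\<lambda>w. fst (snd w) ^ (e * 4) * q w ^ 4"]) simp
  next
    case True
    have z: "(0, 0, 0) \<in> affine8" "c (0, 0, 0) \<noteq> 0"
      using corner by (simp_all add: affine8_def c_def N_def N'_def mult_entry cell_mat_entries cell_mat'_entries)
    \<comment> \<open>A point of the hyperplane in the big cell at which the function is regular.\<close>
    obtain y where y: "y \<in> affine8" "q y \<noteq> 0" "c y \<noteq> 0" "fst (snd y) = 0"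
      using common_nonzero_coords[OF alg(1,2) qv z(2) v(1) z(1)] True by auto
    obtain p2 q2 where pq2: "p2 \<in> poly_alg coords" "q2 \<in> poly_alg coords" "q2 y \<noteq> 0"
      "\<And>w. w \<in> affine8 \<Longrightarrow> q w * c w * q2 w \<noteq> 0 \<Longrightarrow> E (chart A B w) = p2 w / q2 w"
      using extend[OF y(1-3)] by blast
    have "q y * c y * q2 y \<noteq> 0" using y pq2 by simp
    then obtain x where x: "x \<in> affine8" "a x * (q x * c x * q2 x) \<noteq> 0"
      using common_nonzero_coords[OF alg(3) _ a1(1) _ a1(2) y(1), of "\<lambda>w. q w * c w * q2 w"]
        poly_alg.mult[OF poly_alg.mult[OF alg(1,2)] pq2(2)] by auto
    have eq: "r0 w * q2 w = p2 w * q w ^ 4 * fst (snd w) ^ (e * 4)" if w: "w \<in> affine8" for w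
    proof (rule coords_density[where b = "\<lambda>w. a w * (q w * c w * q2 w)" and w = x])
      fix w :: "'k coords8" assume w: "w \<in> affine8" "a w * (q w * c w * q2 w) \<noteq> 0"
      then have "r0 w / (fst (snd w) ^ (e * 4) * q w ^ 4) = p2 w / q2 w"
        using E0[of w] pq2(4)[of w] by simp
      moreover have "fst (snd w) ^ (e * 4) * q w ^ 4 \<noteq> 0" "q2 w \<noteq> 0" using w(2) by (auto simp: a_def)
      ultimately have "r0 w * q2 w = p2 w * (fst (snd w) ^ (e * 4) * q w ^ 4)" by (simp add: frac_eq_eq)
      then show "r0 w * q2 w = p2 w * q w ^ 4 * fst (snd w) ^ (e * 4)" by (simp add: mult.assoc mult.commute)
    qed (use w x in \<open>auto intro!: poly_alg_intros alg pq2\<close>)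
    have "(\<lambda>w. p2 w * q w ^ 4) \<in> poly_alg coords" by (intro poly_alg_intros alg pq2)
    from hartogs_alpha2[OF alg(4) this pq2(2) y(1,4) pq2(3) eq]
    obtain s where s: "s \<in> poly_alg coords" "\<And>w. w \<in> affine8 \<Longrightarrow> r0 w = fst (snd w) ^ (e * 4) * s w" by blast
    have "E (chart A B w) = s w / q w ^ 4" if "w \<in> affine8" "a w \<noteq> 0" "q w \<noteq> 0" "c w \<noteq> 0" for w
      using E0[OF that] s(2)[OF that(1)] that(2) by (simp add: a_def)
    moreover have "(\<lambda>w. q w ^ 4) \<in> poly_alg coords" by (intro poly_alg_intros alg)
    ultimately show ?thesis using s(1) qv by (intro exI[of _ s] exI[of _ "\<lambda>w. q w ^ 4"]) simp
  qed
  then obtain r s where rs: "r \<in> poly_alg coords" "s \<in> poly_alg coords" "s v \<noteq> 0"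
    "\<And>w. w \<in> affine8 \<Longrightarrow> a w \<noteq> 0 \<Longrightarrow> q w \<noteq> 0 \<Longrightarrow> c w \<noteq> 0 \<Longrightarrow> E (chart A B w) = r w / s w"
    by blast
  \<comment> \<open>The fraction has been compared with the operator on the group only; by density the two agree on
    the boundary of the cell too.\<close>
  have E1: "E (chart A B y) = r y / s y"
    if y: "y \<in> affine8" "s y \<noteq> 0" "q y \<noteq> 0" "c y \<noteq> 0" for y
  proof -
    obtain p2 q2 where pq2: "p2 \<in> poly_alg coords" "q2 \<in> poly_alg coords" "q2 y \<noteq> 0"
      "E (chart A B y) = p2 y / q2 y"
      "\<And>w. w \<in> affine8 \<Longrightarrow> q w * c w * q2 w \<noteq> 0 \<Longrightarrow> E (chart A B w) = p2 w / q2 w"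
      using extend[OF y(1,3,4)] by blast
    define n where "n = (\<lambda>w. q w * c w * q2 w * s w)"
    have nalg: "n \<in> poly_alg coords" unfolding n_def by (intro poly_alg_intros alg pq2 rs)
    have "n y \<noteq> 0" using y pq2 by (simp add: n_def)
    then obtain x where x: "x \<in> affine8" "a x * n x \<noteq> 0"
      using common_nonzero_coords[OF alg(3) nalg a1(1) _ a1(2) y(1)] by auto
    have "r y * q2 y = p2 y * s y"
    proof (rule coords_density[where b = "\<lambda>w. a w * n w" and w = x])
      fix w :: "'k coords8" assume w: "w \<in> affine8" "a w * n w \<noteq> 0"
      then have "r w / s w = p2 w / q2 w"
        using rs(4)[of w] pq2(5)[of w] by (simp add: n_def)
      then show "r w * q2 w = p2 w * s w" using w(2) by (simp add: n_def frac_eq_eq)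
    qed (use y x in \<open>auto intro!: poly_alg_intros alg pq2 rs nalg\<close>)
    then show ?thesis using pq2(3,4) y(2) by (simp add: frac_eq_eq)
  qed
  have "(\<lambda>w. r w * q w) \<in> poly_alg coords" "(\<lambda>w. s w * q w) \<in> poly_alg coords"
    by (intro poly_alg_intros rs alg)+
  from chart_fraction[OF AB this v(1) _ v(2)[symmetric]] rs(3) qv
  obtain P1 Q1 d' e' where 1: "bihom d' e' P1" "bihom d' e' Q1" "Q1 k k' \<noteq> 0"
    "\<And>g g'. point g g' \<in> wonderful \<Longrightarrow> Q1 g g' \<noteq> 0 \<Longrightarrow>
      \<exists>w\<in>affine8. s w * q w \<noteq> 0 \<and> point g g' = chart A B w \<and> P1 g g' / Q1 g g' = r w * q w / (s w * q w)"
    by auto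
  have "fraction_on_cell V E P1 Q1"
    unfolding fraction_on_cell_def
  proof (intro conjI allI impI)
    show "\<exists>d e. bihom d e P1 \<and> bihom d e Q1" using 1 by blast
    fix g g' assume "point g g' \<in> wonderful" "Q1 g g' \<noteq> 0"
    then obtain w where w: "w \<in> affine8" "s w * q w \<noteq> 0" "point g g' = chart A B w"
      "P1 g g' / Q1 g g' = r w * q w / (s w * q w)" using 1(4) by blast
    then show "point g g' \<in> V" using inV by simp
    show "E (point g g') = P1 g g' / Q1 g g'" if "point g g' \<in> big_cell"
      using E1[of w] inC[OF w(1)] that w by simp
  qed
  then show ?thesis using 1(3) unfolding E_def W_def by blast
qed

text \<open>Any two local fractions agree where both are defined, by density, so they glue.\<close>

lemma D0_extends:
  fixes f :: "'k::field_char_0 proj2 \<Rightarrow> 'k"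
  assumes V: "zopen V" and f: "f \<in> regular V"
  shows "\<exists>h\<in>regular V. \<forall>x\<in>V \<inter> big_cell. h x = D0 (V \<inter> big_cell) (restr (V \<inter> big_cell) f) x"
proof -
  define E where "E = D0 (V \<inter> big_cell) (restr (V \<inter> big_cell) f)"
  define val where "val x y \<longleftrightarrow> (\<exists>P Q g g'. fraction_on_cell V E P Q \<and> Q g g' \<noteq> 0 \<and> x = point g g' \<and> y = P g g' / Q g g')" for x y
  have unique: "y = P g g' / Q g g'"
    if g: "point g g' \<in> wonderful" and PQ: "fraction_on_cell V E P Q" "Q g g' \<noteq> 0" and y: "val (point g g') y"
    for g g' P Q y
  proof -
    obtain R S k k' where RS: "fraction_on_cell V E R S" "S k k' \<noteq> 0" "point g g' = point k k'" "y = R k k' / S k k'"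
      using y unfolding val_def by blast
    obtain d e where b: "bihom d e R" "bihom d e S" using RS(1) by (auto simp: fraction_on_cell_def)
    obtain s t where st: "s \<noteq> 0" "t \<noteq> 0" "g = mscale s k" "g' = mscale t k'"
      using RS(3) by (auto simp: proj_class_eq_iff)
    have "S g g' \<noteq> 0" "R g g' / S g g' = R k k' / S k k'"
      using st RS(2) bihomD(2)[OF b(1)] bihomD(2)[OF b(2)] by simp_all
    then show ?thesis using fraction_on_cell_unique[OF PQ(1) RS(1) g PQ(2)] RS(4) by simp
  qed
  have loc: "\<exists>P Q. fraction_on_cell V E P Q \<and> Q g g' \<noteq> 0" if "point g g' \<in> V" for g g'
    using D0_extends_locally[OF V f that] unfolding E_def .
  define h where "h x = (if x \<in> V then SOME y. val x y else 0)" for x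
  have h: "h (point g g') = P g g' / Q g g' \<and> point g g' \<in> V"
    if g: "point g g' \<in> wonderful" and PQ: "fraction_on_cell V E P Q" "Q g g' \<noteq> 0" for g g' P Q
  proof -
    have V: "point g g' \<in> V" using PQ g unfolding fraction_on_cell_def by blast
    have "val (point g g') (P g g' / Q g g')" unfolding val_def using PQ by blast
    then have "(SOME y. val (point g g') y) = P g g' / Q g g'"
      using unique[OF that] by (rule some_equality)
    then show ?thesis using V by (simp add: h_def)
  qed
  have "h \<in> regular V"
    unfolding regular_iff[OF V]
  proof (intro conjI allI impI)
    fix g g' assume "point g g' \<in> V"
    then obtain P Q where PQ: "fraction_on_cell V E P Q" "Q g g' \<noteq> 0" using loc by blast
    have "is_fraction V h P Q"
      using PQ(1) h[OF _ PQ(1)] unfolding is_fraction_def fraction_on_cell_def by blast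
    then show "\<exists>P Q. is_fraction V h P Q \<and> Q g g' \<noteq> 0" using PQ(2) by blast
  qed (simp add: h_def)
  moreover have "h x = E x" if x: "x \<in> V \<inter> big_cell" for x
  proof -
    have "x \<in> wonderful" using x big_cell_subset by blast
    then obtain g g' where g: "x = point g g'" "point g g' \<in> wonderful" by (rule wonderful_cases)
    then obtain P Q where PQ: "fraction_on_cell V E P Q" "Q g g' \<noteq> 0" using loc x by blast
    then have "E (point g g') = P g g' / Q g g'" using g x unfolding fraction_on_cell_def by blast
    then show ?thesis using h[OF g(2) PQ] g(1) by simp
  qed
  ultimately show ?thesis unfolding E_def by blast
qed

definition D0_ext :: "'k::field_char_0 sheaf_op" where
  "D0_ext V f = (THE h. h \<in> regular V \<and>
     (\<forall>x\<in>V \<inter> big_cell. h x = D0 (V \<inter> big_cell) (restr (V \<inter> big_cell) f) x))"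

context
  fixes V :: "'k::field_char_0 proj2 set" and f :: "'k proj2 \<Rightarrow> 'k"
  assumes V: "zopen V" and f: "f \<in> regular V"
begin

lemma D0_ext_eq:
  assumes "h \<in> regular V"
    "\<And>x. x \<in> V \<Longrightarrow> x \<in> big_cell \<Longrightarrow> h x = D0 (V \<inter> big_cell) (restr (V \<inter> big_cell) f) x"
  shows "D0_ext V f = h"
  unfolding D0_ext_def
proof (rule the_equality)
  fix l assume "l \<in> regular V \<and> (\<forall>x\<in>V \<inter> big_cell. l x = D0 (V \<inter> big_cell) (restr (V \<inter> big_cell) f) x)"
  then show "l = h" using regular_unique[OF V, of l h] assms by simp
qed (use assms in blast)

lemma D0_ext:
  shows D0_ext_regular: "D0_ext V f \<in> regular V"
    and D0_ext_on_cell: "x \<in> V \<Longrightarrow> x \<in> big_cell \<Longrightarrow>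
      D0_ext V f x = D0 (V \<inter> big_cell) (restr (V \<inter> big_cell) f) x"
proof -
  obtain h where "h \<in> regular V"
    "\<And>x. x \<in> V \<Longrightarrow> x \<in> big_cell \<Longrightarrow> h x = D0 (V \<inter> big_cell) (restr (V \<inter> big_cell) f) x"
    using D0_extends[OF V f] by blast
  then show "D0_ext V f \<in> regular V" "x \<in> V \<Longrightarrow> x \<in> big_cell \<Longrightarrow>
      D0_ext V f x = D0 (V \<inter> big_cell) (restr (V \<inter> big_cell) f) x"
    using D0_ext_eq by simp_all
qed

end

text \<open>The order of an operator can be read off after restriction \<open>\<rho>\<close> to a dense subset \<open>S\<close>.\<close>

lemma order_le_dense:
  assumes "order_le n R' T'" "\<And>f. f \<in> R \<Longrightarrow> T f \<in> R"
    and "\<And>f x. f \<in> R \<Longrightarrow> x \<in> S \<Longrightarrow> T f x = T' (\<rho> f) x"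
    and \<rho>: "\<And>f. f \<in> R \<Longrightarrow> \<rho> f \<in> R'" "\<And>f h. f \<in> R \<Longrightarrow> h \<in> R \<Longrightarrow> \<rho> (\<lambda>x. f x * h x) = (\<lambda>x. \<rho> f x * \<rho> h x)"
      "\<And>f x. f \<in> R \<Longrightarrow> x \<in> S \<Longrightarrow> \<rho> f x = f x"
    and R: "\<And>f h. f \<in> R \<Longrightarrow> h \<in> R \<Longrightarrow> (\<lambda>x. f x * h x) \<in> R" "\<And>f h. f \<in> R \<Longrightarrow> h \<in> R \<Longrightarrow> (\<lambda>x. f x - h x) \<in> R"
      "\<And>f. f \<in> R \<Longrightarrow> (\<And>x. x \<in> S \<Longrightarrow> f x = 0) \<Longrightarrow> f = (\<lambda>x. 0)"
  shows "order_le n R T"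
  using assms(1-3)
proof (induction n arbitrary: T T')
  case 0
  have "commutator a T f = (\<lambda>x. 0)" if af: "a \<in> R" "f \<in> R" for a f
  proof (rule R(3))
    show "commutator a T f \<in> R" unfolding commutator_def by (intro R 0 af)
    show "commutator a T f x = 0" if x: "x \<in> S" for x
    proof -
      have "commutator a T f x = commutator (\<rho> a) T' (\<rho> f) x"
        using x af by (simp add: commutator_def 0 R \<rho>)
      also have "\<dots> = 0" using 0(1) \<rho>(1)[OF af(1)] \<rho>(1)[OF af(2)] by simp
      finally show ?thesis .
    qed
  qed
  then show ?case by simp
next
  case (Suc n)
  have "order_le n R (commutator a T)" if a: "a \<in> R" for a
  proof (rule Suc.IH)
    show "order_le n R' (commutator (\<rho> a) T')" using Suc.prems(1) \<rho>(1)[OF a] by simp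
    show "commutator a T f \<in> R" if "f \<in> R" for f
      unfolding commutator_def by (intro R Suc.prems a that)
    show "commutator a T f x = commutator (\<rho> a) T' (\<rho> f) x" if "f \<in> R" "x \<in> S" for f x
      using that a by (simp add: commutator_def Suc.prems R \<rho>)
  qed
  then show ?case by simp
qed

lemma D0_ext_diff_op: "(D0_ext :: 'k::field_char_0 sheaf_op) \<in> diff_ops wonderful"
proof -
  have cell: "zopen (V \<inter> big_cell)" "V \<inter> big_cell \<subseteq> big_cell" if "zopen V" for V :: "'k proj2 set"
    using zopen_Int[OF that zopen_big_cell] by auto
  have restr: "restr (V \<inter> big_cell) f \<in> regular (V \<inter> big_cell)" if "zopen V" "f \<in> regular V"
    for V :: "'k proj2 set" and f
    using regular_restr[OF that(1) cell(1)[OF that(1)] _ that(2)] by simp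
  have "linear_op (regular V) (D0_ext V)" if V: "zopen V" for V :: "'k proj2 set"
    unfolding linear_op_def
  proof (intro conjI ballI allI)
    fix f :: "'k proj2 \<Rightarrow> 'k" assume f: "f \<in> regular V"
    note l = D0_linear[OF cell[OF V], unfolded linear_op_def]
    show "D0_ext V f \<in> regular V" by (rule D0_ext_regular[OF V f])
    {
      fix h assume h: "h \<in> regular V"
      show "D0_ext V (\<lambda>x. f x + h x) = (\<lambda>x. D0_ext V f x + D0_ext V h x)"
      proof (rule D0_ext_eq[OF V regular_add[OF V f h]])
        have "restr (V \<inter> big_cell) (\<lambda>x. f x + h x) = (\<lambda>x. restr (V \<inter> big_cell) f x + restr (V \<inter> big_cell) h x)"
          by (simp add: restr_def fun_eq_iff)
        then have "D0 (V \<inter> big_cell) (restr (V \<inter> big_cell) (\<lambda>x. f x + h x))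
            = (\<lambda>x. D0 (V \<inter> big_cell) (restr (V \<inter> big_cell) f) x + D0 (V \<inter> big_cell) (restr (V \<inter> big_cell) h) x)"
          using l restr[OF V f] restr[OF V h] by simp
        then show "D0_ext V f x + D0_ext V h x = D0 (V \<inter> big_cell) (restr (V \<inter> big_cell) (\<lambda>x. f x + h x)) x"
          if "x \<in> V" "x \<in> big_cell" for x
          using that by (simp add: D0_ext_on_cell[OF V f] D0_ext_on_cell[OF V h])
      qed (intro regular_add V D0_ext_regular f h)
    }
    fix c
    show "D0_ext V (\<lambda>x. c * f x) = (\<lambda>x. c * D0_ext V f x)"
    proof (rule D0_ext_eq[OF V regular_cmult[OF V f]])
      have "restr (V \<inter> big_cell) (\<lambda>x. c * f x) = (\<lambda>x. c * restr (V \<inter> big_cell) f x)"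
        by (simp add: restr_def fun_eq_iff)
      then have "D0 (V \<inter> big_cell) (restr (V \<inter> big_cell) (\<lambda>x. c * f x))
          = (\<lambda>x. c * D0 (V \<inter> big_cell) (restr (V \<inter> big_cell) f) x)"
        using l restr[OF V f] by simp
      then show "c * D0_ext V f x = D0 (V \<inter> big_cell) (restr (V \<inter> big_cell) (\<lambda>x. c * f x)) x"
        if "x \<in> V" "x \<in> big_cell" for x
        using that by (simp add: D0_ext_on_cell[OF V f])
    qed (intro regular_cmult V D0_ext_regular f)
  qed
  moreover have "D0_ext W (restr W f) = restr W (D0_ext V f)"
    if VW: "zopen V" "zopen W" "W \<subseteq> V" "f \<in> regular V" for V W :: "'k proj2 set" and f
  proof (rule D0_ext_eq[OF VW(2) regular_restr[OF VW]])
    show "restr W (D0_ext V f) \<in> regular W"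
      by (intro regular_restr[OF VW(1-3)] D0_ext_regular VW)
    have "restr (W \<inter> big_cell) (restr W f) = restr (W \<inter> big_cell) (restr (V \<inter> big_cell) f)"
      using VW(3) by (auto simp: restr_def fun_eq_iff)
    then have D: "D0 (W \<inter> big_cell) (restr (W \<inter> big_cell) (restr W f))
        = restr (W \<inter> big_cell) (D0 (V \<inter> big_cell) (restr (V \<inter> big_cell) f))"
      using D0_restr[OF cell[OF VW(1)] cell(1)[OF VW(2)] _ restr[OF VW(1,4)]] VW(3) by auto
    show "restr W (D0_ext V f) x = D0 (W \<inter> big_cell) (restr (W \<inter> big_cell) (restr W f)) x"
      if x: "x \<in> W" "x \<in> big_cell" for x
    proof -
      have "restr (W \<inter> big_cell) h x = h x" "restr W h x = h x" for h using x by (simp_all add: restr_def)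
      moreover have "x \<in> V" using x VW(3) by blast
      ultimately show ?thesis unfolding D using D0_ext_on_cell[OF VW(1,4) _ x(2)] by simp
    qed
  qed
  moreover have "order_le 2 (regular V) (D0_ext V)" if V: "zopen V" for V :: "'k proj2 set"
  proof (rule order_le_dense[OF D0_order[OF cell[OF V]], where S = "V \<inter> big_cell" and \<rho> = "restr (V \<inter> big_cell)"])
    show "(\<lambda>x. f x - h x) \<in> regular V" if "f \<in> regular V" "h \<in> regular V" for f h
      using regular_add[OF V that(1) regular_cmult[OF V that(2), of "- 1"]] by simp
    show "f = (\<lambda>x. 0)" if f: "f \<in> regular V" "\<And>x. x \<in> V \<inter> big_cell \<Longrightarrow> f x = 0" for f
    proof (rule regular_unique[OF V f(1)])
      show "(\<lambda>x. 0) \<in> regular V" using regular_cmult[OF V f(1), of 0] by simp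
    qed (use f(2) in simp)
    show "restr (V \<inter> big_cell) (\<lambda>x. f x * h x)
        = (\<lambda>x. restr (V \<inter> big_cell) f x * restr (V \<inter> big_cell) h x)" for f h :: "'k proj2 \<Rightarrow> 'k"
      by (simp add: restr_def fun_eq_iff)
    show "restr (V \<inter> big_cell) f x = f x" if "x \<in> V \<inter> big_cell" for f :: "'k proj2 \<Rightarrow> 'k" and x
      using that by (simp add: restr_def)
  qed (use V in \<open>auto simp: D0_ext_regular D0_ext_on_cell restr regular_mult\<close>)
  ultimately show ?thesis unfolding diff_ops_def by blast
qed

theorem mainTheorem1:
  shows "(\<forall>V :: 'k::{alg_closed_field, field_char_0} proj2 set.
            zopen V \<and> V \<subseteq> group_points \<inter> big_cell \<longrightarrow>
            (\<forall>f\<in>regular V. \<forall>g. emb g \<in> V \<longrightarrow>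
               D0 V f (emb g) = D0_entries (\<lambda>h. f (emb h)) g)) \<and>
         (D0 :: 'k sheaf_op) \<in> diff_ops big_cell \<and>
         (\<exists>D \<in> diff_ops (wonderful :: 'k proj2 set).
            \<forall>V. zopen V \<and> V \<subseteq> big_cell \<longrightarrow> (\<forall>f\<in>regular V. D V f = D0 V f))"
proof (intro conjI)
  show "\<forall>V :: 'k proj2 set. zopen V \<and> V \<subseteq> group_points \<inter> big_cell \<longrightarrow>
    (\<forall>f\<in>regular V. \<forall>g. emb g \<in> V \<longrightarrow> D0 V f (emb g) = D0_entries (\<lambda>h. f (emb h)) g)"
  proof (intro allI impI ballI)
    fix V :: "'k proj2 set" and f g
    assume V: "zopen V \<and> V \<subseteq> group_points \<inter> big_cell" and f: "f \<in> regular V" and g: "emb g \<in> V"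
    have "emb g \<in> group_points" using V g by blast
    then obtain h where h: "det h \<noteq> 0" "emb g = emb h" by (auto simp: group_points_def)
    then obtain c where "c \<noteq> 0" "g = mscale c h" by (auto simp: emb_def proj_class_eq_iff)
    moreover have "det (mscale c h) = c ^ 3 * det h"
      by (simp add: det_3 algebra_simps power3_eq_cube)
    ultimately have det: "det g \<noteq> 0" using h by simp
    obtain P Q where PQ: "is_fraction V f P Q" "Q g (Com g) \<noteq> 0"
      using regularD(2)[OF f _ g[unfolded emb_def]] V by blast
    obtain d e where b: "bihom d e P" "bihom d e Q" using is_fraction_bihom[OF PQ(1)] .
    obtain R where R: "\<And>V f g.
      (\<forall>h. det h \<noteq> 0 \<longrightarrow> Q h (Com h) \<noteq> 0 \<longrightarrow> emb h \<in> big_cell \<longrightarrow>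
         emb h \<in> V \<and> f (emb h) = P h (Com h) / Q h (Com h)) \<Longrightarrow>
      det g \<noteq> 0 \<Longrightarrow> Q g (Com g) \<noteq> 0 \<Longrightarrow> emb g \<in> big_cell \<Longrightarrow>
      D0 V f (emb g) = R g / (Q g (Com g)) ^ 4 \<and> D0_entries (\<lambda>h. f (emb h)) g = R g / (Q g (Com g)) ^ 4"
      using D0_fraction[OF bihomD(1)[OF b(1)] bihomD(1)[OF b(2)]] by blast
    have "D0 V f (emb g) = R g / (Q g (Com g)) ^ 4 \<and> D0_entries (\<lambda>h. f (emb h)) g = R g / (Q g (Com g)) ^ 4"
    proof (rule R)
      show "\<forall>h. det h \<noteq> 0 \<longrightarrow> Q h (Com h) \<noteq> 0 \<longrightarrow> emb h \<in> big_cell \<longrightarrow>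
         emb h \<in> V \<and> f (emb h) = P h (Com h) / Q h (Com h)"
        using is_fractionD[OF PQ(1) group_wonderful] by (simp add: emb_def)
      show "emb g \<in> big_cell" using g V by blast
    qed (use det PQ(2) in simp_all)
    then show "D0 V f (emb g) = D0_entries (\<lambda>h. f (emb h)) g" by simp
  qed
  show "(D0 :: 'k sheaf_op) \<in> diff_ops big_cell" by (rule D0_diff_op)
  show "\<exists>D \<in> diff_ops (wonderful :: 'k proj2 set).
    \<forall>V. zopen V \<and> V \<subseteq> big_cell \<longrightarrow> (\<forall>f\<in>regular V. D V f = D0 V f)"
  proof (intro bexI[OF _ D0_ext_diff_op] allI impI ballI)
    fix V :: "'k proj2 set" and f assume V: "zopen V \<and> V \<subseteq> big_cell" and f: "f \<in> regular V"
    have "restr V f = f" using regularD(1)[OF f] V by (auto simp: restr_def fun_eq_iff)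
    moreover have "V \<inter> big_cell = V" using V by blast
    moreover have "D0 V f \<in> regular V"
      unfolding D0_cell_deriv using V by (intro cell_deriv_regular f) auto
    ultimately show "D0_ext V f = D0 V f" using D0_ext_eq[OF _ f] V by simp
  qed
qed

end
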